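(* Let $\Sigma$ be a closed surface of genus at least $2$, $M=S^1\times\Sigma$, $p:S^1\times\mathbb{D}\to M$ the covering induced by the universal covering $p_\Sigma:\mathbb{D}\to\Sigma=\mathbb{D}/G$, and let $\omega_M$, $\alpha$, $\eta$, $\underline\eta$ be the forms constructed in the context (Lutz twist construction). Then the triple $$(p:S^1\times\mathbb{D}\to M,\ \omega^L:=\omega_M+d\underline\eta,\ \alpha^L:=\alpha+\eta)$$ is a virtual contact structure equipped with an overtwisted disk, i.e. $(S^1\times\mathbb{D},\ker\alpha^L)$ contains an overtwisted disk.
   Context: Virtual contact structure: a Hamiltonian structure on an oriented 3-manifold $M$ is a closed nowhere vanishing 2-form $\omega$; $X^\omega$ is a non-vanishing vector field on $M$ generating $\ker\omega$, in the direction determined by the orientation. $(p:\widehat M\to M,\omega,\lambda)$ is a virtual contact structure if $p$ is a covering and $\lambda\in\Omega^1(\widehat M)$ satisfies $d\lambda=p^*\omega$, $\|\lambda\|_{C^0}\le C'<\infty$ and $\inf_{x\in\widehat M}\lambda(x)(\widehat X(x))\ge\epsilon'>0$ for some constants $C',\epsilon'$, where $\widehat X$ is the lift of $X^\omega$ and the norm is that of the lift of a Riemannian metric on $M$. In this statement the forms $\alpha^L$, and hence $\underline\eta$, are only $C^1$ (they are built from $C^1$-functions), so $\omega^L$ is only continuous. Overtwisted disk: an embedded disk $F$ in a contact 3-manifold $(Q,\zeta)$ with $T\partial F\subset\zeta|_{\partial F}$ such that $TF\cap\zeta|_F$ defines a smooth 1-dimensional characteristic foliation on $F$ except at a unique elliptic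 singular point $e\in\mathrm{int}\,F$ with $T_eF=\zeta_e$. Construction. $\mathbb{D}=\{x+iy\in\mathbb{C}: x^2+y^2<1\}$ is the Poincaré disk with metric $ds^2=\frac{dx^2+dy^2}{(1-x^2-y^2)^2}$, $G$ is a discrete group of isometries of $\mathbb{D}$ with $\Sigma=\mathbb{D}/G$ and universal covering map $p_\Sigma$; $(r,\varphi)$ are polar coordinates on $\mathbb{C}$; $\omega_\Sigma$ is the area form on $\Sigma$ with $p_\Sigma^*\omega_\Sigma=\frac{2\,dx\wedge dy}{(1-x^2-y^2)^2}=\frac{2r\,dr\wedge d\varphi}{(1-r^2)^2}$. Let $t$ be the coordinate on $S^1$, let $\pi:S^1\times\mathbb{D}\to\mathbb{D}$ and $\pi_\Sigma:M\to\Sigma$ be the projections, and let $\omega_M=\pi_\Sigma^*\omega_\Sigma$. $G$ acts on $S^1\times\mathbb{D}$ trivially on the $S^1$-factor; $p=\mathrm{id}\times p_\Sigma$. The 1-form $$\alpha=dt+\frac{x\,dy-y\,dx}{1-x^2-y^2}=dt+\frac{r^2d\varphi}{1-r^2}$$ is a primitive of $p^*\omega_M$. Norms on $S^1\times\mathbb{D}$ are with respect to the product metric. Let $B_\delta(0)=\{r<\delta\}$ and choose $\delta\in(0,\frac13]$ with $g(B_\delta(0))\cap B_\delta(0)=\emptyset$ for all $g\in G\setminus\{\mathrm{id}\}$, choose $\epsilon\in(0,\frac{\delta}{10}]$, and put $C=\max\{\|\alpha\|_\infty,1\}$. Let $f_1,f_2:[0,\delta]\to\mathbb{R}$ be $C^1$-functions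 such that: (i) $f_1(r)=-1$, $f_2(r)=\frac{-r^2}{1-r^2}$ for $r\in[0,\frac\epsilon2)$; (ii) $f_1(r)=1$, $f_2(r)=\frac{r^2}{1-r^2}$ for $r\in(\delta-\frac\epsilon2,\delta]$; (iii) $f_2(\frac\delta2)=-4C$, $f_2'(\frac\delta2)=0$; (iv) $f_1',f_2'$ are piecewise linear on $[\frac\epsilon2,\delta-\frac\epsilon2]$; (v) $f_1'$ is constant on $[\epsilon,\delta-\epsilon]$; (vi) $f_2'$ is constant on $[\epsilon,\frac\delta2-\epsilon]$ and on $[\frac\delta2+\epsilon,\delta-\epsilon]$ (the two constants may differ); (vii) $f_1'$ is differentiable except at $\{\frac\epsilon2,\epsilon,\delta-\epsilon,\delta-\frac\epsilon2\}$; (viii) $f_2'$ is differentiable except at $\{\frac\epsilon2,\epsilon,\frac\delta2-\epsilon,\frac\delta2,\frac\delta2+\epsilon,\delta-\epsilon,\delta-\frac\epsilon2\}$. Let $\alpha^L_\delta:=f_1(r)dt+f_2(r)d\varphi$ on $\pi^{-1}(B_\delta(0))$, let $\eta_\delta$ be the 1-form on $S^1\times\mathbb{D}$ equal to $\alpha^L_\delta-\alpha$ on $\pi^{-1}(B_\delta(0))$ and vanishing elsewhere, and let $\eta:=\sum_{g\in G}g^*\eta_\delta$, which is $G$-invariant. Then $\underline\eta$ is the 1-form on $M$ with $p^*\underline\eta=\eta$. *)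

theory Defs
  imports "HOL-Analysis.Analysis" "HOL-Algebra.Bij" "HOL-Algebra.Free_Abelian_Groups"
    "HOL-Homology.Homology"
begin

section \<open>Differentiability classes\<close>

text \<open>Only meant for open sets S, where all iterated directional derivatives up to order k are
  required to exist and to be continuous.\<close>

primrec Ck_on ::
  "nat \<Rightarrow> 'e::euclidean_space set \<Rightarrow> ('e \<Rightarrow> 'b::real_normed_vector) \<Rightarrow> bool" where
  "Ck_on 0 S f \<longleftrightarrow> continuous_on S f"
| "Ck_on (Suc k) S f \<longleftrightarrow>
     (\<forall>x\<in>S. f differentiable (at x)) \<and> (\<forall>v. Ck_on k S (\<lambda>x. frechet_derivative f (at x) v))"

definition smooth_on :: "'e::euclidean_space set \<Rightarrow> ('e \<Rightarrow> 'b::real_normed_vector) \<Rightarrow> bool" where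
  "smooth_on S f \<longleftrightarrow> (\<forall>k. Ck_on k S f)"

section \<open>Smooth manifolds\<close>

text \<open>A chart is given by its inverse, i.e. as a local parametrisation: a pair (U, psi) of an open
  subset U of the model space and a homeomorphism psi from U onto an open subset of the manifold.\<close>

type_synonym ('e, 'a) chart = "'e set \<times> ('e \<Rightarrow> 'a)"

definition rep_dom :: "('a \<Rightarrow> 'b) \<Rightarrow> ('e, 'a) chart \<Rightarrow> ('f, 'b) chart \<Rightarrow> 'e set" where
  "rep_dom F c d = {u \<in> fst c. F (snd c u) \<in> snd d ` fst d}"

definition local_rep :: "('a \<Rightarrow> 'b) \<Rightarrow> ('e, 'a) chart \<Rightarrow> ('f, 'b) chart \<Rightarrow> 'e \<Rightarrow> 'f" where
  "local_rep F c d = (\<lambda>u. inv_into (fst d) (snd d) (F (snd c u)))"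

abbreviation D_rep :: "('a \<Rightarrow> 'b) \<Rightarrow> ('e::euclidean_space, 'a) chart
    \<Rightarrow> ('f::euclidean_space, 'b) chart \<Rightarrow> 'e \<Rightarrow> 'e \<Rightarrow> 'f" where
  "D_rep F c d u \<equiv> frechet_derivative (local_rep F c d) (at u)"

definition smooth_manifold ::
  "'a::topological_space set \<Rightarrow> ('e::euclidean_space, 'a) chart set \<Rightarrow> bool" where
  "smooth_manifold X A \<longleftrightarrow>
     Hausdorff_space (top_of_set X) \<and> second_countable (top_of_set X) \<and>
     (\<Union>c\<in>A. snd c ` fst c) = X \<and>
     (\<forall>(U, \<psi>)\<in>A. open U \<and> openin (top_of_set X) (\<psi> ` U) \<and>
        homeomorphism U (\<psi> ` U) \<psi> (inv_into U \<psi>)) \<and>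
     (\<forall>c\<in>A. \<forall>d\<in>A. smooth_on (rep_dom id c d) (local_rep id c d))"

definition smooth_map :: "'a::topological_space set \<Rightarrow> ('e::euclidean_space, 'a) chart set
    \<Rightarrow> 'b::topological_space set \<Rightarrow> ('f::euclidean_space, 'b) chart set \<Rightarrow> ('a \<Rightarrow> 'b) \<Rightarrow> bool" where
  "smooth_map X A Y B F \<longleftrightarrow> continuous_on X F \<and> F ` X \<subseteq> Y \<and>
     (\<forall>c\<in>A. \<forall>d\<in>B. smooth_on (rep_dom F c d) (local_rep F c d))"

text \<open>The manifold structure on the target of a covering map p with source an open subset V of the
  model space, consisting of the restrictions of p to those open sets on which it is injective.
  (It is smooth if the deck transformations are.)\<close>

definition covering_atlas :: "'e::topological_space set \<Rightarrow> ('e \<Rightarrow> 'a) \<Rightarrow> ('e, 'a) chart set" where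
  "covering_atlas V p = {(U, p) | U. open U \<and> U \<subseteq> V \<and> inj_on p U}"

definition prod_atlas ::
  "('e, 'a) chart set \<Rightarrow> ('f, 'b) chart set \<Rightarrow> ('e \<times> 'f, 'a \<times> 'b) chart set" where
  "prod_atlas A B = {(U \<times> V, map_prod \<phi> \<psi>) | U V \<phi> \<psi>. (U, \<phi>) \<in> A \<and> (V, \<psi>) \<in> B}"

section \<open>Tensor fields\<close>

text \<open>Tensor fields are families of local representatives, one for each chart of the atlas, which
  transform into each other under the changes of charts.  A 1-form a has the value a c u v on the
  tangent vector that is represented in the chart c by v at u.  The values at arguments outside
  the atlas or outside the domain of the chart carry no meaning.\<close>

type_synonym ('e, 'a) field1 = "('e, 'a) chart \<Rightarrow> 'e \<Rightarrow> 'e \<Rightarrow> real"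
type_synonym ('e, 'a) field2 = "('e, 'a) chart \<Rightarrow> 'e \<Rightarrow> 'e \<Rightarrow> 'e \<Rightarrow> real"
type_synonym ('e, 'a) vfield = "('e, 'a) chart \<Rightarrow> 'e \<Rightarrow> 'e"

definition form1 :: "('e::euclidean_space, 'a) chart set \<Rightarrow> ('e, 'a) field1 \<Rightarrow> bool" where
  "form1 A a \<longleftrightarrow>
     (\<forall>c\<in>A. \<forall>u\<in>fst c. linear (a c u)) \<and>
     (\<forall>c\<in>A. \<forall>d\<in>A. \<forall>u\<in>rep_dom id c d. \<forall>v.
        a c u v = a d (local_rep id c d u) (D_rep id c d u v))"

definition tensor2 :: "('e::euclidean_space, 'a) chart set \<Rightarrow> ('e, 'a) field2 \<Rightarrow> bool" where
  "tensor2 A b \<longleftrightarrow>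
     (\<forall>c\<in>A. \<forall>u\<in>fst c. bilinear (b c u)) \<and>
     (\<forall>c\<in>A. \<forall>d\<in>A. \<forall>u\<in>rep_dom id c d. \<forall>v w.
        b c u v w = b d (local_rep id c d u) (D_rep id c d u v) (D_rep id c d u w))"

definition form2 :: "('e::euclidean_space, 'a) chart set \<Rightarrow> ('e, 'a) field2 \<Rightarrow> bool" where
  "form2 A b \<longleftrightarrow> tensor2 A b \<and> (\<forall>c\<in>A. \<forall>u\<in>fst c. \<forall>v. b c u v v = 0)"

definition Riemannian_metric :: "('e::euclidean_space, 'a) chart set \<Rightarrow> ('e, 'a) field2 \<Rightarrow> bool" where
  "Riemannian_metric A g \<longleftrightarrow> tensor2 A g \<and>
     (\<forall>c\<in>A. \<forall>u\<in>fst c. (\<forall>v w. g c u v w = g c u w v) \<and> (\<forall>v. v \<noteq> 0 \<longrightarrow> g c u v v > 0)) \<and>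
     (\<forall>c\<in>A. \<forall>v w. smooth_on (fst c) (\<lambda>u. g c u v w))"

definition vector_field :: "('e::euclidean_space, 'a) chart set \<Rightarrow> ('e, 'a) vfield \<Rightarrow> bool" where
  "vector_field A X \<longleftrightarrow>
     (\<forall>c\<in>A. \<forall>d\<in>A. \<forall>u\<in>rep_dom id c d. X d (local_rep id c d u) = D_rep id c d u (X c u))"

definition C1_field1 :: "('e::euclidean_space, 'a) chart set \<Rightarrow> ('e, 'a) field1 \<Rightarrow> bool" where
  "C1_field1 A a \<longleftrightarrow> (\<forall>c\<in>A. \<forall>v. Ck_on 1 (fst c) (\<lambda>u. a c u v))"

definition continuous_field2 :: "('e::euclidean_space, 'a) chart set \<Rightarrow> ('e, 'a) field2 \<Rightarrow> bool" where
  "continuous_field2 A b \<longleftrightarrow> (\<forall>c\<in>A. \<forall>v w. continuous_on (fst c) (\<lambda>u. b c u v w))"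

definition continuous_vfield :: "('e::euclidean_space, 'a) chart set \<Rightarrow> ('e, 'a) vfield \<Rightarrow> bool" where
  "continuous_vfield A X \<longleftrightarrow> (\<forall>c\<in>A. continuous_on (fst c) (X c))"

definition field1_eq :: "('e, 'a) chart set \<Rightarrow> ('e, 'a) field1 \<Rightarrow> ('e, 'a) field1 \<Rightarrow> bool" where
  "field1_eq A a b \<longleftrightarrow> (\<forall>c\<in>A. \<forall>u\<in>fst c. \<forall>v. a c u v = b c u v)"

definition field2_eq :: "('e, 'a) chart set \<Rightarrow> ('e, 'a) field2 \<Rightarrow> ('e, 'a) field2 \<Rightarrow> bool" where
  "field2_eq A a b \<longleftrightarrow> (\<forall>c\<in>A. \<forall>u\<in>fst c. \<forall>v w. a c u v w = b c u v w)"

definition target_chart ::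
  "('a \<Rightarrow> 'b) \<Rightarrow> ('f, 'b) chart set \<Rightarrow> ('e, 'a) chart \<Rightarrow> 'e \<Rightarrow> ('f, 'b) chart" where
  "target_chart F B c u = (SOME d. d \<in> B \<and> F (snd c u) \<in> snd d ` fst d)"

text \<open>For tensor fields on (Y, B) the pullbacks do not depend on the chosen target chart.\<close>

definition pull1 :: "('a \<Rightarrow> 'b) \<Rightarrow> ('f::euclidean_space, 'b) chart set \<Rightarrow> ('f, 'b) field1
    \<Rightarrow> ('e::euclidean_space, 'a) field1" where
  "pull1 F B b = (\<lambda>c u v. let d = target_chart F B c u in
     b d (local_rep F c d u) (D_rep F c d u v))"

definition pull2 :: "('a \<Rightarrow> 'b) \<Rightarrow> ('f::euclidean_space, 'b) chart set \<Rightarrow> ('f, 'b) field2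
    \<Rightarrow> ('e::euclidean_space, 'a) field2" where
  "pull2 F B b = (\<lambda>c u v w. let d = target_chart F B c u in
     b d (local_rep F c d u) (D_rep F c d u v) (D_rep F c d u w))"

definition descend1 :: "('a \<Rightarrow> 'b) \<Rightarrow> ('e::euclidean_space, 'a) chart set
    \<Rightarrow> ('f::euclidean_space, 'b) chart set \<Rightarrow> ('e, 'a) field1 \<Rightarrow> ('f, 'b) field1" where
  "descend1 p A B a = (SOME b. form1 B b \<and> field1_eq A (pull1 p B b) a)"

definition lifted_vfield :: "('a \<Rightarrow> 'b) \<Rightarrow> ('e::euclidean_space, 'a) chart set
    \<Rightarrow> ('f::euclidean_space, 'b) chart set \<Rightarrow> ('f, 'b) vfield \<Rightarrow> ('e, 'a) vfield \<Rightarrow> bool" where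
  "lifted_vfield p A B X Y \<longleftrightarrow> vector_field A Y \<and>
     (\<forall>c\<in>A. \<forall>d\<in>B. \<forall>u\<in>rep_dom p c d. D_rep p c d u (Y c u) = X d (local_rep p c d u))"

definition ext_d :: "('e::euclidean_space, 'a) field1 \<Rightarrow> ('e, 'a) field2" where
  "ext_d a = (\<lambda>c u v w. frechet_derivative (\<lambda>x. a c x w) (at u) v
                      - frechet_derivative (\<lambda>x. a c x v) (at u) w)"

definition wedge12 :: "('e \<Rightarrow> real) \<Rightarrow> ('e \<Rightarrow> 'e \<Rightarrow> real) \<Rightarrow> 'e \<Rightarrow> 'e \<Rightarrow> 'e \<Rightarrow> real" where
  "wedge12 a b = (\<lambda>v1 v2 v3. a v1 * b v2 v3 + a v2 * b v3 v1 + a v3 * b v1 v2)"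

text \<open>The norm of a 1-form at a point with respect to a metric g, and its supremum.\<close>

definition conorm :: "('e, 'a) field2 \<Rightarrow> ('e, 'a) field1 \<Rightarrow> ('e, 'a) chart \<Rightarrow> 'e \<Rightarrow> real" where
  "conorm g a c u = Sup {\<bar>a c u v\<bar> | v. g c u v v \<le> 1}"

definition C0_norm ::
  "('e, 'a) chart set \<Rightarrow> ('e, 'a) field2 \<Rightarrow> ('e, 'a) field1 \<Rightarrow> real" where
  "C0_norm A g a = Sup {conorm g a c u | c u. c \<in> A \<and> u \<in> fst c}"

section \<open>Virtual contact structures\<close>

text \<open>Three-manifolds are modelled on the product of the reals and the complex numbers, with
  oriented coordinates (t, x + i y).\<close>

type_synonym R3 = "real \<times> complex"

definition cross2 :: "complex \<Rightarrow> complex \<Rightarrow> real" where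
  "cross2 v w = Re v * Im w - Im v * Re w"

text \<open>The determinant dt \<and> dx \<and> dy.\<close>

definition vol3 :: "R3 \<Rightarrow> R3 \<Rightarrow> R3 \<Rightarrow> real" where
  "vol3 = wedge12 fst (\<lambda>v w. cross2 (snd v) (snd w))"

abbreviation "E1 \<equiv> (1, 0) :: R3"
abbreviation "E2 \<equiv> (0, 1) :: R3"
abbreviation "E3 \<equiv> (0, \<i>) :: R3"

definition oriented_3_manifold ::
  "'a::topological_space set \<Rightarrow> (R3, 'a) chart set \<Rightarrow> bool" where
  "oriented_3_manifold M A \<longleftrightarrow> smooth_manifold M A \<and>
     (\<forall>c\<in>A. \<forall>d\<in>A. \<forall>u\<in>rep_dom id c d.
        vol3 (D_rep id c d u E1) (D_rep id c d u E2) (D_rep id c d u E3) > 0)"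

text \<open>A 2-form b that is merely continuous is closed if it is closed in the sense of distributions,
  that is, if the integral of d phi \<and> b vanishes for all test functions phi.  For continuously
  differentiable b this is the usual notion.\<close>

definition closed_form2 :: "(R3, 'a) chart set \<Rightarrow> (R3, 'a) field2 \<Rightarrow> bool" where
  "closed_form2 A b \<longleftrightarrow>
     (\<forall>c\<in>A. \<forall>\<phi>::R3 \<Rightarrow> real. \<forall>K. smooth_on UNIV \<phi> \<and> compact K \<and> K \<subseteq> fst c \<and> (\<forall>u. u \<notin> K \<longrightarrow> \<phi> u = 0) \<longrightarrow>
        (LINT u|lborel. wedge12 (frechet_derivative \<phi> (at u)) (b c u) E1 E2 E3) = 0)"

definition Hamiltonian_structure :: "(R3, 'a) chart set \<Rightarrow> (R3, 'a) field2 \<Rightarrow> bool" where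
  "Hamiltonian_structure A \<omega> \<longleftrightarrow> form2 A \<omega> \<and> continuous_field2 A \<omega> \<and> closed_form2 A \<omega> \<and>
     (\<forall>c\<in>A. \<forall>u\<in>fst c. \<exists>v w. \<omega> c u v w \<noteq> 0)"

text \<open>The direction of X is determined by requiring that (X, v, w) is a positive basis whenever
  omega (v, w) is positive.\<close>

definition kernel_vfield :: "(R3, 'a) chart set \<Rightarrow> (R3, 'a) field2 \<Rightarrow> (R3, 'a) vfield \<Rightarrow> bool" where
  "kernel_vfield A \<omega> X \<longleftrightarrow> vector_field A X \<and> continuous_vfield A X \<and>
     (\<forall>c\<in>A. \<forall>u\<in>fst c. X c u \<noteq> 0 \<and> {v. \<forall>w. \<omega> c u v w = 0} = span {X c u} \<and>
        (\<forall>v w. \<omega> c u v w > 0 \<longrightarrow> vol3 (X c u) v w > 0))"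

definition smooth_covering :: "'a::topological_space set \<Rightarrow> (R3, 'a) chart set
    \<Rightarrow> ('a \<Rightarrow> 'b) \<Rightarrow> 'b::topological_space set \<Rightarrow> (R3, 'b) chart set \<Rightarrow> bool" where
  "smooth_covering X A p Y B \<longleftrightarrow> covering_space X p Y \<and> smooth_map X A Y B p \<and>
     (\<forall>c\<in>A. \<forall>d\<in>B. \<forall>u\<in>rep_dom p c d. bij (D_rep p c d u))"

definition virtual_contact_structure ::
  "'a::topological_space set \<Rightarrow> (R3, 'a) chart set \<Rightarrow> ('a \<Rightarrow> 'b)
    \<Rightarrow> 'b::topological_space set \<Rightarrow> (R3, 'b) chart set
    \<Rightarrow> (R3, 'b) field2 \<Rightarrow> (R3, 'a) field1 \<Rightarrow> bool" where
  "virtual_contact_structure M' A' p M A \<omega> lam \<longleftrightarrow>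
     oriented_3_manifold M A \<and> smooth_manifold M' A' \<and> smooth_covering M' A' p M A \<and>
     Hamiltonian_structure A \<omega> \<and>
     form1 A' lam \<and> C1_field1 A' lam \<and> field2_eq A' (ext_d lam) (pull2 p A \<omega>) \<and>
     (\<exists>g C'. Riemannian_metric A g \<and> (\<forall>c\<in>A'. \<forall>u\<in>fst c. conorm (pull2 p A g) lam c u \<le> C')) \<and>
     (\<exists>X X' \<epsilon>'. kernel_vfield A \<omega> X \<and> lifted_vfield p A' A X X' \<and>
        \<epsilon>' > 0 \<and> (\<forall>c\<in>A'. \<forall>u\<in>fst c. lam c u (X' c u) \<ge> \<epsilon>'))"

section \<open>Overtwisted disks\<close>

definition contact_form :: "(R3, 'a) chart set \<Rightarrow> (R3, 'a) field1 \<Rightarrow> bool" where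
  "contact_form A \<alpha> \<longleftrightarrow> form1 A \<alpha> \<and> C1_field1 A \<alpha> \<and>
     (\<forall>c\<in>A. \<forall>u\<in>fst c. \<exists>v1 v2 v3. wedge12 (\<alpha> c u) (ext_d \<alpha> c u) v1 v2 v3 \<noteq> 0)"

text \<open>An overtwisted disk F in (Q, ker alpha) is parametrised by a smooth embedding Phi of the closed
  unit disk, that is, of a neighbourhood U of it; beta is the pullback of alpha.  As alpha vanishes
  nowhere, the tangent plane of F at Phi z coincides with the contact plane iff beta vanishes at z;
  elsewhere they intersect in the line spanned by the image of the kernel of beta.
  The characteristic foliation near the singular point e is directed by the vector field Y with
  Y \<lrcorner> (dx \<and> dy) = beta, and e is elliptic if the linearisation of Y at e has positive determinant.\<close>

definition overtwisted_disk ::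
  "'a::topological_space set \<Rightarrow> (R3, 'a) chart set \<Rightarrow> (R3, 'a) field1 \<Rightarrow> 'a set \<Rightarrow> bool" where
  "overtwisted_disk Q A \<alpha> F \<longleftrightarrow> smooth_manifold Q A \<and> contact_form A \<alpha> \<and>
     (\<exists>(U::complex set) \<Phi> e.
        open U \<and> cball 0 1 \<subseteq> U \<and> smooth_map U {(U, id)} Q A \<Phi> \<and> inj_on \<Phi> U \<and>
        (\<forall>d\<in>A. \<forall>z\<in>rep_dom \<Phi> (U, id) d. inj (D_rep \<Phi> (U, id) d z)) \<and>
        F = \<Phi> ` cball 0 1 \<and>
        (let \<beta> = pull1 \<Phi> A \<alpha> (U, id) in
          (\<forall>z\<in>sphere 0 1. \<beta> z (\<i> * z) = 0) \<and>
          e \<in> ball 0 1 \<and> (\<forall>v. \<beta> e v = 0) \<and>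
          (\<forall>z0\<in>cball 0 1 - {e}. \<exists>N (Z :: complex \<Rightarrow> complex). open N \<and> z0 \<in> N \<and> smooth_on N Z \<and>
             (\<forall>z\<in>N \<inter> cball 0 1. Z z \<noteq> 0 \<and> {v. \<beta> z v = 0} = span {Z z})) \<and>
          (\<exists>L. ((\<lambda>z. Complex (\<beta> z \<i>) (- \<beta> z 1)) has_derivative L) (at e) \<and>
             cross2 (L 1) (L \<i>) > 0)))"

section \<open>Surfaces and the Poincare disk\<close>

text \<open>The genus g of a closed surface is determined by its first homology being free abelian of rank
  2 g; for non-orientable closed surfaces this group has torsion.\<close>

definition closed_surface_of_genus :: "nat \<Rightarrow> 'a::topological_space set \<Rightarrow> bool" where
  "closed_surface_of_genus g S \<longleftrightarrow>
     Hausdorff_space (top_of_set S) \<and> second_countable (top_of_set S) \<and> compact S \<and> connected S \<and> S \<noteq> {} \<and>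
     (\<forall>x\<in>S. \<exists>U (V :: complex set). openin (top_of_set S) U \<and> x \<in> U \<and> open V \<and> U homeomorphic V) \<and>
     homology_group 1 (top_of_set S) \<cong> free_Abelian_group {..<2 * g}"

definition unit_disk :: "complex set" where
  "unit_disk = ball 0 1"

definition hyp_metric :: "complex \<Rightarrow> complex \<Rightarrow> complex \<Rightarrow> real" where
  "hyp_metric z v w = (v \<bullet> w) / (1 - (cmod z)\<^sup>2)\<^sup>2"

definition hyp_area :: "(complex, complex) field2" where
  "hyp_area = (\<lambda>c z v w. 2 * cross2 v w / (1 - (cmod z)\<^sup>2)\<^sup>2)"

definition hyp_isometry :: "(complex \<Rightarrow> complex) \<Rightarrow> bool" where
  "hyp_isometry g \<longleftrightarrow> bij_betw g unit_disk unit_disk \<and> smooth_on unit_disk g \<and>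
     (\<forall>z\<in>unit_disk. \<forall>v w.
        hyp_metric (g z) (frechet_derivative g (at z) v) (frechet_derivative g (at z) w) = hyp_metric z v w)"

text \<open>Discreteness refers to the compact-open topology, i.e. uniform convergence on compact sets.
  By the definition of the group of bijections, elements of G are extensional functions.\<close>

definition discrete_isometry_group :: "(complex \<Rightarrow> complex) set \<Rightarrow> bool" where
  "discrete_isometry_group G \<longleftrightarrow> subgroup G (BijGroup unit_disk) \<and> (\<forall>g\<in>G. hyp_isometry g) \<and>
     (\<exists>K e. compact K \<and> K \<subseteq> unit_disk \<and> e > 0 \<and>
        (\<forall>g\<in>G. (\<forall>z\<in>K. dist (g z) z < e) \<longrightarrow> g = \<one>\<^bsub>BijGroup unit_disk\<^esub>))"

text \<open>p is a universal covering map of S whose fibres are the orbits of G.\<close>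

definition orbit_covering ::
  "(complex \<Rightarrow> complex) set \<Rightarrow> (complex \<Rightarrow> 'a::topological_space) \<Rightarrow> 'a set \<Rightarrow> bool" where
  "orbit_covering G p S \<longleftrightarrow> covering_space unit_disk p S \<and>
     (\<forall>z\<in>unit_disk. \<forall>w\<in>unit_disk. p z = p w \<longleftrightarrow> (\<exists>g\<in>G. w = g z))"

abbreviation disk_atlas :: "(complex, complex) chart set" where
  "disk_atlas \<equiv> {(unit_disk, id)}"

abbreviation circle_atlas :: "(real, complex) chart set" where
  "circle_atlas \<equiv> covering_atlas UNIV cis"

abbreviation cyl :: "(complex \<times> complex) set" where
  "cyl \<equiv> sphere 0 1 \<times> unit_disk"

abbreviation cyl_atlas :: "(R3, complex \<times> complex) chart set" where
  "cyl_atlas \<equiv> prod_atlas circle_atlas disk_atlas"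

abbreviation surface_atlas :: "(complex \<Rightarrow> 'a) \<Rightarrow> (complex, 'a) chart set" where
  "surface_atlas p\<Sigma> \<equiv> covering_atlas unit_disk p\<Sigma>"

abbreviation M_atlas :: "(complex \<Rightarrow> 'a) \<Rightarrow> (R3, complex \<times> 'a) chart set" where
  "M_atlas p\<Sigma> \<equiv> prod_atlas circle_atlas (surface_atlas p\<Sigma>)"

section \<open>The Lutz twist\<close>

text \<open>Each chart of the cylinder (circle times disk) is a restriction of the map taking (t, z) to (cis t, z), so
  global tensor fields are given by one formula in the coordinates (t, z).\<close>

definition cyl_metric :: "(R3, complex \<times> complex) field2" where
  "cyl_metric = (\<lambda>c (t, z) (\<tau>, v) (\<sigma>, w). \<tau> * \<sigma> + hyp_metric z v w)"

definition prim_form :: "(R3, complex \<times> complex) field1" where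
  "prim_form = (\<lambda>c (t, z) (\<tau>, v). \<tau> + cross2 z v / (1 - (cmod z)\<^sup>2))"

text \<open>d phi = (x dy - y dx) / r^2; by the convention for division it is 0 at the origin, which yields
  the continuous extension of f2(r) d phi if f2(r) = - r^2 / (1 - r^2) near r = 0.\<close>

definition dphi :: "complex \<Rightarrow> complex \<Rightarrow> real" where
  "dphi z v = cross2 z v / (cmod z)\<^sup>2"

definition twist_form :: "(real \<Rightarrow> real) \<Rightarrow> (real \<Rightarrow> real) \<Rightarrow> (R3, complex \<times> complex) field1" where
  "twist_form f1 f2 = (\<lambda>c (t, z) (\<tau>, v). f1 (cmod z) * \<tau> + f2 (cmod z) * dphi z v)"

definition eta_loc ::
  "real \<Rightarrow> (real \<Rightarrow> real) \<Rightarrow> (real \<Rightarrow> real) \<Rightarrow> (R3, complex \<times> complex) field1" where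
  "eta_loc \<delta> f1 f2 = (\<lambda>c u v.
     if cmod (snd u) < \<delta> then twist_form f1 f2 c u v - prim_form c u v else 0)"

text \<open>At each point at most one summand is nonzero, so this is a locally finite sum.\<close>

definition eta :: "(complex \<Rightarrow> complex) set \<Rightarrow> real \<Rightarrow> (real \<Rightarrow> real) \<Rightarrow> (real \<Rightarrow> real)
    \<Rightarrow> (R3, complex \<times> complex) field1" where
  "eta G \<delta> f1 f2 = (\<lambda>c u v.
     \<Sum>\<^sub>\<infinity>g\<in>G. pull1 (map_prod id g) cyl_atlas (eta_loc \<delta> f1 f2) c u v)"

definition piecewise_linear_on :: "real \<Rightarrow> real \<Rightarrow> (real \<Rightarrow> real) \<Rightarrow> bool" where
  "piecewise_linear_on a b h \<longleftrightarrow> (\<exists>P. finite P \<and>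
     (\<forall>x y. a \<le> x \<and> x < y \<and> y \<le> b \<and> {x<..<y} \<inter> P = {} \<longrightarrow>
        (\<exists>m k. \<forall>r\<in>{x<..<y}. h r = m * r + k)))"

text \<open>f1' and f2' are the derivatives of f1 and f2 (one-sided at the end points).\<close>

definition twist_profile :: "real \<Rightarrow> real \<Rightarrow> real \<Rightarrow> (real \<Rightarrow> real) \<Rightarrow> (real \<Rightarrow> real)
    \<Rightarrow> (real \<Rightarrow> real) \<Rightarrow> (real \<Rightarrow> real) \<Rightarrow> bool" where
  "twist_profile \<delta> \<epsilon> C f1 f2 f1' f2' \<longleftrightarrow>
     (\<forall>r\<in>{0..\<delta>}. (f1 has_real_derivative f1' r) (at r within {0..\<delta>})) \<and> continuous_on {0..\<delta>} f1' \<and>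
     (\<forall>r\<in>{0..\<delta>}. (f2 has_real_derivative f2' r) (at r within {0..\<delta>})) \<and> continuous_on {0..\<delta>} f2' \<and>
     (\<forall>r\<in>{0..<\<epsilon>/2}. f1 r = -1 \<and> f2 r = - r\<^sup>2 / (1 - r\<^sup>2)) \<and>
     (\<forall>r\<in>{\<delta> - \<epsilon>/2<..\<delta>}. f1 r = 1 \<and> f2 r = r\<^sup>2 / (1 - r\<^sup>2)) \<and>
     f2 (\<delta>/2) = - 4 * C \<and> f2' (\<delta>/2) = 0 \<and>
     piecewise_linear_on (\<epsilon>/2) (\<delta> - \<epsilon>/2) f1' \<and> piecewise_linear_on (\<epsilon>/2) (\<delta> - \<epsilon>/2) f2' \<and>
     f1' constant_on {\<epsilon>..\<delta> - \<epsilon>} \<and>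
     f2' constant_on {\<epsilon>..\<delta>/2 - \<epsilon>} \<and> f2' constant_on {\<delta>/2 + \<epsilon>..\<delta> - \<epsilon>} \<and>
     (\<forall>r\<in>{0..\<delta>} - {\<epsilon>/2, \<epsilon>, \<delta> - \<epsilon>, \<delta> - \<epsilon>/2}. f1' differentiable (at r within {0..\<delta>})) \<and>
     (\<forall>r\<in>{0..\<delta>} - {\<epsilon>/2, \<epsilon>, \<delta>/2 - \<epsilon>, \<delta>/2, \<delta>/2 + \<epsilon>, \<delta> - \<epsilon>, \<delta> - \<epsilon>/2}.
        f2' differentiable (at r within {0..\<delta>}))"

end

theory Submission
  imports Defs "HOL-Complex_Analysis.Complex_Analysis"
begin

text \<open>
  The form \<open>\<alpha>L\<close> is \<open>dt + r\<^sup>2 d\<phi> / (1 - r\<^sup>2)\<close> outside the translates of the tube \<open>r < \<delta>\<close> and pulled back from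
  \<open>f1(r) dt + f2(r) d\<phi>\<close> inside them.  It is invariant under \<open>G\<close>, so its differential descends, and all bounds
  need only be established on one tube.  There \<open>\<alpha>L \<and> d\<alpha>L\<close> is a positive multiple of \<open>f1 f2' - f1' f2\<close>, and
  likewise for \<open>\<alpha>L(X)\<close>.  Since \<open>f1'\<close> and \<open>f2'\<close> are polygons, the profile is explicit up to a few parameters:
  \<open>f1\<close> increases from -1 to 1 and changes sign at \<open>\<delta>/2\<close>, exactly where \<open>f2\<close> attains its very negative
  minimum \<open>-4 C\<close>; hence \<open>f1 f2'\<close> and \<open>- f1' f2\<close> are nonnegative up to errors that are small compared with
  the other term.  As \<open>\<omega>L\<close> is only continuous, its closedness is an integration by parts against
  test functions.

  Let \<open>r0\<close> be the zero of \<open>f2\<close> in \<open>(\<delta>/2, \<delta>)\<close>.  On the meridian disk \<open>t = const, r \<le> r0\<close> the form restricts to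
  \<open>f2(r) d\<phi>\<close>, which vanishes along the whole boundary.  We therefore use the graph \<open>t = h(r)\<close> of a smooth
  function that is constant for \<open>r \<le> \<rho>\<close> and satisfies \<open>h' > 0\<close> for \<open>r > \<rho>\<close>, where \<open>\<rho>\<close> is slightly smaller
  than \<open>r0\<close>: the restriction \<open>f1 h' dr + f2 d\<phi>\<close> has the origin as its only zero and \<open>r = r0\<close> as a leaf.
  The foliation is smooth although \<open>f1\<close> and \<open>f2\<close> are only \<open>C\<^sup>1\<close>, because it is radial for \<open>r < \<rho>\<close> and \<open>f1\<close> and \<open>f2\<close> are quadratic
  polynomials just to the left of \<open>r0\<close>.
\<close>

section \<open>Differentiability classes\<close>

text \<open>Invariance holds for \<open>eta\<close>, for the differential of
  \<open>\<alpha>L\<close> and for its kernel field, but not for \<open>\<alpha>L\<close> itself: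
  \<open>prim_form\<close> is a primitive of the lift of an area form, which on a closed surface has
  no primitive, so \<open>prim_form\<close> cannot be invariant under \<open>G\<close>. On the tube
  that \<open>g\<close> carries to the standard one, \<open>\<alpha>L\<close> is the pullback of the
  model form plus the difference between \<open>prim_form\<close> and its pullback by
  \<open>g\<close>. This closed correction varies from tube to tube, so the contact condition is not
  literally the same inequality on all of them. What saves the argument is that the disk part of
  \<open>prim_form\<close> has hyperbolic norm |z| < 1 everywhere. Together with f1' >= 0 this
  bounds the correction uniformly: it suffices that f1 f2' - f1' (f2 + r) is bounded below by a
  positive constant, where the extra r pays for the worst tube. The depth -4 C of \<open>f2\<close>
  leaves ample room for it. On the standard tube the correction vanishes, and there the overtwisted
  disk is placed.\<close>

lemma has_derivative_cong_open:
  assumes "open N" "y \<in> N" "\<And>x. x \<in> N \<Longrightarrow> f x = h x"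
  shows "(f has_derivative D) (at y) \<longleftrightarrow> (h has_derivative D) (at y)"
  using assms by (metis has_derivative_transform_within_open)

lemma frechet_derivative_cong_open:
  assumes "open N" "y \<in> N" "\<And>x. x \<in> N \<Longrightarrow> f x = h x"
  shows "frechet_derivative f (at y) = frechet_derivative h (at y)"
  unfolding frechet_derivative_def using has_derivative_cong_open[OF assms] by simp

lemma frechet_derivativeI: "(f has_derivative D) (at x) \<Longrightarrow> frechet_derivative f (at x) = D"
  using frechet_derivative_at by metis

lemma Ck_on_subset: "Ck_on k T f \<Longrightarrow> S \<subseteq> T \<Longrightarrow> Ck_on k S f"
  by (induction k arbitrary: f) (auto intro: continuous_on_subset)

text \<open>A Frechet derivative at a point depends only on the germ of the function, so
  \<open>Ck_on\<close> may be checked with a different formula near each point. The gluing at the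
  core and at the edges of the tubes goes through this.\<close>

lemma Ck_on_local:
  assumes "\<And>x. x \<in> S \<Longrightarrow> \<exists>N h. open N \<and> x \<in> N \<and> Ck_on k N h \<and> (\<forall>y\<in>N. f y = h y)"
  shows "Ck_on k S f"
  using assms
proof (induction k arbitrary: f)
  case 0
  have "isCont f x" if x: "x \<in> S" for x
  proof -
    obtain N h where N: "open N" "x \<in> N" "continuous_on N h" "\<forall>y\<in>N. f y = h y"
      using 0[OF x] by auto
    then have "isCont h x" by (simp add: continuous_on_eq_continuous_at)
    moreover have "eventually (\<lambda>y. h y = f y) (nhds x)"
      using N eventually_nhds by (metis (mono_tags, lifting))
    ultimately show ?thesis by (metis isCont_cong)
  qed
  then show ?case by (simp add: continuous_at_imp_continuous_on)
next
  case (Suc k)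
  have "f differentiable (at x)" if x: "x \<in> S" for x
  proof -
    obtain N h where N: "open N" "x \<in> N" "h differentiable (at x)" "\<forall>y\<in>N. f y = h y"
      using Suc.prems[OF x] by auto
    then show ?thesis unfolding differentiable_def by (metis has_derivative_cong_open)
  qed
  moreover have "Ck_on k S (\<lambda>x. frechet_derivative f (at x) v)" for v
  proof (rule Suc.IH)
    fix x assume x: "x \<in> S"
    obtain N h where N: "open N" "x \<in> N" "Ck_on (Suc k) N h" "\<forall>y\<in>N. f y = h y"
      using Suc.prems[OF x] by blast
    then have "frechet_derivative f (at y) = frechet_derivative h (at y)" if "y \<in> N" for y
      using frechet_derivative_cong_open[of N y f h] that by blast
    with N show "\<exists>N h. open N \<and> x \<in> N \<and> Ck_on k N h \<and> (\<forall>y\<in>N. frechet_derivative f (at y) v = h y)"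
      by (intro exI[of _ N] exI[of _ "\<lambda>y. frechet_derivative h (at y) v"]) auto
  qed
  ultimately show ?case by simp
qed

lemma Ck_on_cong:
  assumes "open S" "Ck_on k S h" "\<And>x. x \<in> S \<Longrightarrow> f x = h x"
  shows "Ck_on k S f"
  by (rule Ck_on_local) (use assms in blast)

lemma Ck_on_SucI:
  assumes "open S" "\<And>x. x \<in> S \<Longrightarrow> (f has_derivative D x) (at x)" "\<And>v. Ck_on k S (\<lambda>x. D x v)"
  shows "Ck_on (Suc k) S f"
proof -
  have "Ck_on k S (\<lambda>x. frechet_derivative f (at x) v)" for v
    using frechet_derivativeI[OF assms(2)] by (intro Ck_on_cong[OF assms(1) assms(3)[of v]]) simp
  then show ?thesis using assms(2) unfolding Ck_on.simps by (auto simp: differentiable_def)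
qed

lemma Ck_on_SucD: "Ck_on (Suc k) S f \<Longrightarrow> Ck_on k S f"
proof (induction k arbitrary: f)
  case 0
  then show ?case
    by (auto intro!: continuous_at_imp_continuous_on differentiable_imp_continuous_within)
next
  case (Suc k)
  from Suc.prems have "\<forall>x\<in>S. f differentiable (at x)"
    and "Ck_on (Suc k) S (\<lambda>x. frechet_derivative f (at x) v)" for v
    unfolding Ck_on.simps(2)[of "Suc k"] by blast+
  with Suc.IH show ?case by simp
qed

lemma Ck_on_mono: "Ck_on k S f \<Longrightarrow> l \<le> k \<Longrightarrow> Ck_on l S f"
  by (induction k) (use Ck_on_SucD le_Suc_eq in blast)+

lemma Ck_on_has_derivative:
  "Ck_on (Suc k) S f \<Longrightarrow> x \<in> S \<Longrightarrow> (f has_derivative frechet_derivative f (at x)) (at x)"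
  using frechet_derivative_works by auto

lemma Ck_on_continuous: "Ck_on k S f \<Longrightarrow> continuous_on S f"
  using Ck_on_mono[of k S f 0] by simp

lemma Ck_on_const [simp]: "Ck_on k S (\<lambda>x. c)"
  by (induction k arbitrary: c) auto

lemma Ck_on_bounded_linear_apply: "bounded_linear L \<Longrightarrow> Ck_on k S L"
proof (cases k)
  case (Suc m)
  assume L: "bounded_linear L"
  then have "frechet_derivative L (at x) = L" for x
    by (simp add: bounded_linear_imp_has_derivative frechet_derivativeI)
  then show ?thesis
    using L Suc by (auto simp: differentiable_def dest: bounded_linear_imp_has_derivative)
qed (auto intro: linear_continuous_on)

lemma Ck_on_add:
  assumes "open S" "Ck_on k S f" "Ck_on k S g"
  shows "Ck_on k S (\<lambda>x. f x + g x)"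
  using assms(2,3)
proof (induction k arbitrary: f g)
  case (Suc k)
  then show ?case
    by (intro Ck_on_SucI[OF assms(1), of _ "\<lambda>x v. frechet_derivative f (at x) v + frechet_derivative g (at x) v"]
        has_derivative_add Suc.IH) (auto simp: frechet_derivative_works)
qed (auto intro: continuous_intros)

lemma Ck_on_bounded_linear:
  assumes "open S" "bounded_linear L" "Ck_on k S f"
  shows "Ck_on k S (\<lambda>x. L (f x))"
  using assms(3)
proof (induction k arbitrary: f)
  case (Suc k)
  then show ?case
    by (intro Ck_on_SucI[OF assms(1), of _ "\<lambda>x v. L (frechet_derivative f (at x) v)"]
        bounded_linear.has_derivative[OF assms(2)] Suc.IH) (auto simp: frechet_derivative_works)
qed (auto intro!: bounded_linear.continuous_on[OF assms(2)])

lemma Ck_on_bilinear: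
  assumes "open S" "bounded_bilinear b" "Ck_on k S f" "Ck_on k S g"
  shows "Ck_on k S (\<lambda>x. b (f x) (g x))"
  using assms(3,4)
proof (induction k arbitrary: f g)
  case (Suc k)
  have "Ck_on k S f" "Ck_on k S g" using Suc.prems Ck_on_SucD by auto
  with Suc show ?case
    by (intro Ck_on_SucI[OF assms(1), of _ "\<lambda>x v. b (f x) (frechet_derivative g (at x) v) + b (frechet_derivative f (at x) v) (g x)"]
        bounded_bilinear.FDERIV[OF assms(2)] Ck_on_add assms(1) Suc.IH) (auto simp: frechet_derivative_works)
qed (auto intro!: bounded_bilinear.continuous_on[OF assms(2)])

lemmas Ck_on_mult = Ck_on_bilinear[OF _ bounded_bilinear_mult]
lemmas Ck_on_scaleR = Ck_on_bilinear[OF _ bounded_bilinear_scaleR]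
lemmas Ck_on_inner = Ck_on_bilinear[OF _ bounded_bilinear_inner]
lemmas Ck_on_minus = Ck_on_bounded_linear[OF _ bounded_linear_minus[OF bounded_linear_ident]]

lemma Ck_on_diff:
  "open S \<Longrightarrow> Ck_on k S f \<Longrightarrow> Ck_on k S g \<Longrightarrow> Ck_on k S (\<lambda>x. f x - g x)"
  using Ck_on_add[of S k f "\<lambda>x. - g x"] Ck_on_minus[of S k g] by simp

lemma Ck_on_sum:
  assumes "open S" "finite I" "\<And>i. i \<in> I \<Longrightarrow> Ck_on k S (f i)"
  shows "Ck_on k S (\<lambda>x. \<Sum>i\<in>I. f i x)"
  using assms(2,3) by (induction I rule: finite_induct) (auto intro: Ck_on_add[OF assms(1)])

lemma Ck_on_compose:
  fixes g :: "'e::euclidean_space \<Rightarrow> 'f::euclidean_space" and f :: "'f \<Rightarrow> 'b::real_normed_vector"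
  assumes "open S" "open T" "Ck_on k S g" "Ck_on k T f" "g ` S \<subseteq> T"
  shows "Ck_on k S (\<lambda>x. f (g x))"
  using assms(3,4)
proof (induction k arbitrary: f)
  case 0
  then show ?case
    using assms(5) by (auto intro: continuous_on_compose2)
next
  case (Suc k)
  have D: "((\<lambda>x. f (g x)) has_derivative
      (\<lambda>v. frechet_derivative f (at (g x)) (frechet_derivative g (at x) v))) (at x)" if "x \<in> S" for x
    using that Suc.prems assms(5)
    by (intro has_derivative_compose[of g _ x UNIV f]) (auto simp: frechet_derivative_works[symmetric])
  \<comment> \<open>\<open>Ck_on\<close> speaks of derivatives in fixed directions, but the chain
    rule differentiates \<open>f\<close> in a direction that moves with \<open>x\<close>. Expanding
    this direction in the basis leaves products to which the induction hypothesis applies.\<close>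
  have lin: "frechet_derivative f (at (g x)) w = (\<Sum>i\<in>Basis. (w \<bullet> i) *\<^sub>R frechet_derivative f (at (g x)) i)"
    if "x \<in> S" for x w
  proof -
    interpret linear "frechet_derivative f (at (g x))"
      using Suc.prems that assms(5) by (intro linear_frechet_derivative) auto
    show ?thesis by (subst (1) euclidean_representation[of w, symmetric]) (simp add: sum scale)
  qed
  have "Ck_on k S (\<lambda>x. \<Sum>i\<in>Basis. (frechet_derivative g (at x) v \<bullet> i) *\<^sub>R frechet_derivative f (at (g x)) i)" for v
  proof (intro Ck_on_sum Ck_on_scaleR Ck_on_inner assms(1) finite_Basis Ck_on_const)
    show "Ck_on k S (\<lambda>x. frechet_derivative g (at x) v)" using Suc.prems by simp
    show "Ck_on k S (\<lambda>x. frechet_derivative f (at (g x)) i)" for i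
      using Suc by (auto intro!: Suc.IH Ck_on_SucD[of k S g])
  qed
  then show ?case
    using lin D
    by (intro Ck_on_SucI[where D = "\<lambda>x v. frechet_derivative f (at (g x)) (frechet_derivative g (at x) v)"] assms(1))
       (auto intro: Ck_on_cong[OF assms(1)])
qed

text \<open>The induction runs over \<open>k\<close> for all \<open>n\<close> at once: a family
  closed under differentiation consists of smooth functions. It serves the real powers and the flat
  function.\<close>

lemma Ck_on_real_sequence:
  fixes F :: "nat \<Rightarrow> real \<Rightarrow> real"
  assumes "open T" "\<And>n x. x \<in> T \<Longrightarrow> (F n has_real_derivative F (Suc n) x) (at x)"
  shows "Ck_on k T (F n)"
proof (induction k arbitrary: n)
  case 0
  then show ?case
    using assms(2) by (auto intro!: continuous_at_imp_continuous_on DERIV_isCont)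
next
  case (Suc k)
  show ?case
    by (rule Ck_on_SucI[where D = "\<lambda>x v. F (Suc n) x * v"])
       (use assms Suc in \<open>auto simp: has_field_derivative_def intro!: Ck_on_mult\<close>)
qed

lemma Ck_on_real1:
  fixes f f' :: "real \<Rightarrow> real"
  assumes "open T" "\<And>x. x \<in> T \<Longrightarrow> (f has_real_derivative f' x) (at x)" "continuous_on T f'"
  shows "Ck_on 1 T f"
  unfolding One_nat_def
  by (rule Ck_on_SucI[where D = "\<lambda>x v. f' x * v"])
     (use assms in \<open>auto simp: has_field_derivative_def intro!: continuous_intros\<close>)

lemma Ck_on_powr: "Ck_on k {0<..} (\<lambda>x::real. x powr a)"
proof -
  define F where "F n x = (\<Prod>i<n. a - real i) * x powr (a - real n)" for n and x :: real
  have "Ck_on k {0<..} (F 0)"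
    by (rule Ck_on_real_sequence)
       (auto simp: F_def intro!: derivative_eq_intros simp: field_simps)
  then show ?thesis by (simp add: F_def[abs_def])
qed

lemma Ck_on_inverse_pos: "Ck_on k {0<..} (inverse :: real \<Rightarrow> real)"
  by (rule Ck_on_cong[OF _ Ck_on_powr[of _ "-1"]]) (auto simp: powr_minus)

lemma Ck_on_norm:
  fixes S :: "'e::euclidean_space set"
  assumes "open S" "0 \<notin> S"
  shows "Ck_on k S norm"
proof -
  have "Ck_on k S (\<lambda>x. (x \<bullet> x) powr (1/2))"
    by (rule Ck_on_compose[OF assms(1) _ Ck_on_inner[OF assms(1)] Ck_on_powr])
       (use assms in \<open>auto intro!: Ck_on_bounded_linear_apply bounded_linear_ident\<close>)
  then show ?thesis
    by (rule Ck_on_cong[OF assms(1)]) (auto simp: powr_half_sqrt norm_eq_sqrt_inner)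
qed

text \<open>Every coordinate change below is locally of this kind: a shift of the angle and an
  isometry of the disk.\<close>

lemma smooth_on_prod_translation:
  fixes g :: "'e::euclidean_space \<Rightarrow> 'f::euclidean_space"
  assumes "smooth_on S g" "open S"
  shows "smooth_on (UNIV \<times> S) (\<lambda>(t::real, z). (t + k, g z))"
proof -
  have lin: "bounded_linear (\<lambda>u::'f. (0::real, u))" "bounded_linear (\<lambda>u::real. (u, 0::'f))"
    by (simp_all add: bounded_linear_Pair bounded_linear_ident bounded_linear_zero)
  have op: "open (UNIV \<times> S :: (real \<times> 'e) set)" using assms(2) by (simp add: open_Times)
  have "Ck_on n ((UNIV :: real set) \<times> S) (\<lambda>x. (0::real, g (snd x)))" for n
    by (rule Ck_on_bounded_linear[OF op lin(1)], rule Ck_on_compose[OF op assms(2), where f = g and g = snd])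
       (use assms(1) in \<open>auto simp: smooth_on_def Ck_on_bounded_linear_apply bounded_linear_snd\<close>)
  moreover have "Ck_on n ((UNIV :: real set) \<times> S) (\<lambda>x. (fst x + k, 0::'f))" for n
    by (rule Ck_on_bounded_linear[OF op lin(2)], rule Ck_on_add[OF op])
       (auto simp: Ck_on_bounded_linear_apply bounded_linear_fst)
  ultimately have "Ck_on n ((UNIV :: real set) \<times> S) (\<lambda>x. (fst x + k, 0) + (0, g (snd x)))" for n
    using Ck_on_add[OF op] by blast
  then show ?thesis unfolding smooth_on_def by (simp add: split_def)
qed

lemma smooth_on_local:
  assumes "\<And>x. x \<in> S \<Longrightarrow> \<exists>N h. open N \<and> x \<in> N \<and> smooth_on N h \<and> (\<forall>y\<in>N. f y = h y)"
  shows "smooth_on S f"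
  unfolding smooth_on_def
proof (intro allI Ck_on_local)
  fix k x assume "x \<in> S"
  from assms[OF this] show "\<exists>N h. open N \<and> x \<in> N \<and> Ck_on k N h \<and> (\<forall>y\<in>N. f y = h y)"
    unfolding smooth_on_def by metis
qed

section \<open>Flat functions and closed forms\<close>

text \<open>\<open>flat n\<close> is the n-th derivative of exp(-1/x), extended by 0 to x <= 0. In
  the variable y = 1/x one has dy/dx = -y^2, so the derivative of exp(-y) P(y) is exp(-y) y^2 (P(y)
  - P'(y)); this is the recursion.\<close>

primrec flat_poly :: "nat \<Rightarrow> real poly" where
  "flat_poly 0 = 1"
| "flat_poly (Suc n) = [:0, 0, 1:] * (flat_poly n - pderiv (flat_poly n))"

definition flat :: "nat \<Rightarrow> real \<Rightarrow> real" where
  "flat n x = (if 0 < x then exp (- 1 / x) * poly (flat_poly n) (1 / x) else 0)"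

lemma poly_exp_tendsto_0: "((\<lambda>y::real. poly p y * exp (- y)) \<longlongrightarrow> 0) at_top"
proof -
  have "((\<lambda>y. \<Sum>i\<le>Polynomial.degree p. Polynomial.coeff p i * (y ^ i / exp y)) \<longlongrightarrow> (\<Sum>i\<le>Polynomial.degree p. Polynomial.coeff p i * 0)) at_top"
    by (intro tendsto_sum tendsto_mult tendsto_const tendsto_power_div_exp_0)
  then show ?thesis
    by (simp add: poly_altdef exp_minus sum_distrib_right divide_inverse mult.assoc)
qed

lemma flat_has_derivative: "(flat n has_real_derivative flat (Suc n) x) (at x)"
proof -
  consider "x > 0" | "x < 0" | "x = 0" by linarith
  then show ?thesis
  proof cases
    case 1
    let ?f = "\<lambda>x. exp (- 1 / x) * poly (flat_poly n) (1 / x)"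
    have "(?f has_real_derivative
       exp (- 1 / x) * (1 / x\<^sup>2) * poly (flat_poly n) (1 / x)
         + exp (- 1 / x) * (poly (pderiv (flat_poly n)) (1 / x) * (- 1 / x\<^sup>2))) (at x)"
      using 1 by (auto intro!: derivative_eq_intros simp: power2_eq_square)
    also have "exp (- 1 / x) * (1 / x\<^sup>2) * poly (flat_poly n) (1 / x)
         + exp (- 1 / x) * (poly (pderiv (flat_poly n)) (1 / x) * (- 1 / x\<^sup>2)) = flat (Suc n) x"
      using 1 by (simp add: flat_def power2_eq_square algebra_simps power_divide)
    finally have "(?f has_real_derivative flat (Suc n) x) (at x)" .
    then show ?thesis
      by (rule has_field_derivative_transform_within_open[of _ _ _ "{0<..}"]) (use 1 in \<open>auto simp: flat_def\<close>)
  next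
    case 2
    have "((\<lambda>x. 0) has_real_derivative flat (Suc n) x) (at x)" using 2 by (simp add: flat_def)
    then show ?thesis
      by (rule has_field_derivative_transform_within_open[of _ _ _ "{..<0}"]) (use 2 in \<open>auto simp: flat_def\<close>)
  next
    case 3
    \<comment> \<open>With y = 1/h the difference quotient at 0 from the right is y P(y) exp(-y),
      which tends to 0 as y grows; \<open>pCons 0\<close> supplies the factor y.\<close>
    have "((\<lambda>h. (flat n (0 + h) - flat n 0) / h) \<longlongrightarrow> 0) (at_right 0)"
    proof (subst filterlim_at_right_to_top, rule Lim_transform_eventually)
      show "((\<lambda>y::real. poly (pCons 0 (flat_poly n)) y * exp (- y)) \<longlongrightarrow> 0) at_top"
        by (rule poly_exp_tendsto_0)
      show "\<forall>\<^sub>F y in at_top. poly (pCons 0 (flat_poly n)) y * exp (- y)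
          = (flat n (0 + inverse y) - flat n 0) / inverse y"
        using eventually_gt_at_top[of 0] by eventually_elim (simp add: flat_def divide_inverse)
    qed
    moreover have "((\<lambda>h. (flat n (0 + h) - flat n 0) / h) \<longlongrightarrow> 0) (at_left 0)"
      by (rule Lim_transform_eventually[of "\<lambda>h. 0"])
         (auto simp: flat_def eventually_at_filter)
    ultimately have "((\<lambda>h. (flat n (0 + h) - flat n 0) / h) \<longlongrightarrow> 0) (at 0)"
      using filterlim_at_split by blast
    then show ?thesis using 3 by (simp add: DERIV_def flat_def)
  qed
qed

lemma Ck_on_flat: "Ck_on k UNIV (flat n)"
  by (rule Ck_on_real_sequence) (auto intro: flat_has_derivative)

lemma flat_1_pos: "x > 0 \<Longrightarrow> flat 1 x > 0"
  by (simp add: flat_def power2_eq_square)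

section \<open>Symmetry of second derivatives and integration by parts\<close>

lemma Ck_on_has_derivative_line:
  assumes "Ck_on (Suc k) UNIV f"
  shows "((\<lambda>s. f (x + s *\<^sub>R v)) has_vector_derivative frechet_derivative f (at (x + s *\<^sub>R v)) v) (at s)"
proof -
  have D: "(f has_derivative frechet_derivative f (at (x + s *\<^sub>R v))) (at (x + s *\<^sub>R v))"
    using assms by (intro Ck_on_has_derivative) auto
  have "((\<lambda>s. x + s *\<^sub>R v) has_derivative (\<lambda>s. s *\<^sub>R v)) (at s)"
    by (auto intro!: derivative_eq_intros)
  from has_derivative_compose[OF this D]
  show ?thesis
    using has_derivative_linear[OF D] by (simp add: has_vector_derivative_def linear_cmul)
qed

text \<open>The mean value theorem is applied to the increment along \<open>w\<close> as a function
  of the step along \<open>v\<close>, and then once more along \<open>w\<close>. The second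
  difference is symmetric in \<open>v\<close> and \<open>w\<close> while the right-hand side singles
  out one order of differentiation, so in the limit the mixed derivatives agree.\<close>

lemma second_difference_mvt:
  fixes \<phi> :: "'e::euclidean_space \<Rightarrow> real"
  assumes "Ck_on 2 UNIV \<phi>" "s > 0"
  obtains a b where "0 < a" "a < s" "0 < b" "b < s"
    "\<phi> (x + s *\<^sub>R v + s *\<^sub>R w) - \<phi> (x + s *\<^sub>R v) - \<phi> (x + s *\<^sub>R w) + \<phi> x
      = s\<^sup>2 * frechet_derivative (\<lambda>y. frechet_derivative \<phi> (at y) v) (at (x + a *\<^sub>R v + b *\<^sub>R w)) w"
proof -
  let ?\<phi>v = "\<lambda>y. frechet_derivative \<phi> (at y) v"
  have C1: "Ck_on (Suc 0) UNIV \<phi>" and C1v: "Ck_on (Suc 0) UNIV ?\<phi>v"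
    using assms(1) Ck_on_mono[of 2 UNIV \<phi> "Suc 0"] by (simp_all add: numeral_2_eq_2)
  define u where "u a = \<phi> ((x + s *\<^sub>R w) + a *\<^sub>R v) - \<phi> (x + a *\<^sub>R v)" for a
  have "(u has_real_derivative ?\<phi>v ((x + s *\<^sub>R w) + a *\<^sub>R v) - ?\<phi>v (x + a *\<^sub>R v)) (at a)" for a
    unfolding u_def[abs_def] has_real_derivative_iff_has_vector_derivative
    by (intro has_vector_derivative_diff Ck_on_has_derivative_line[OF C1])
  from MVT2[OF assms(2) this] obtain a
    where a: "0 < a" "a < s" "u s - u 0 = s * (?\<phi>v ((x + s *\<^sub>R w) + a *\<^sub>R v) - ?\<phi>v (x + a *\<^sub>R v))"
    by auto
  have "((\<lambda>b. ?\<phi>v ((x + a *\<^sub>R v) + b *\<^sub>R w)) has_real_derivative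
      frechet_derivative ?\<phi>v (at ((x + a *\<^sub>R v) + b *\<^sub>R w)) w) (at b)" for b
    unfolding has_real_derivative_iff_has_vector_derivative
    by (intro Ck_on_has_derivative_line[OF C1v])
  from MVT2[OF assms(2) this] obtain b where b: "0 < b" "b < s"
    "?\<phi>v ((x + a *\<^sub>R v) + s *\<^sub>R w) - ?\<phi>v (x + a *\<^sub>R v)
      = s * frechet_derivative ?\<phi>v (at ((x + a *\<^sub>R v) + b *\<^sub>R w)) w"
    by auto
  show ?thesis
    using that[OF a(1,2) b(1,2)] a(3) b(3) unfolding u_def
    by (simp add: algebra_simps power2_eq_square)
qed

lemma second_derivative_limit:
  fixes \<phi> :: "'e::euclidean_space \<Rightarrow> real"
  assumes "Ck_on 2 UNIV \<phi>"
  shows "(\<lambda>n. (\<phi> (x + (1 / Suc n) *\<^sub>R v + (1 / Suc n) *\<^sub>R w) - \<phi> (x + (1 / Suc n) *\<^sub>R v)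
      - \<phi> (x + (1 / Suc n) *\<^sub>R w) + \<phi> x) / (1 / Suc n)\<^sup>2)
    \<longlonglongrightarrow> frechet_derivative (\<lambda>y. frechet_derivative \<phi> (at y) v) (at x) w"
proof -
  let ?D = "\<lambda>x. frechet_derivative (\<lambda>y. frechet_derivative \<phi> (at y) v) (at x) w"
  let ?s = "\<lambda>n. 1 / real (Suc n)"
  have "\<exists>a b. 0 < a \<and> a < ?s n \<and> 0 < b \<and> b < ?s n \<and>
     \<phi> (x + ?s n *\<^sub>R v + ?s n *\<^sub>R w) - \<phi> (x + ?s n *\<^sub>R v) - \<phi> (x + ?s n *\<^sub>R w) + \<phi> x
      = (?s n)\<^sup>2 * ?D (x + a *\<^sub>R v + b *\<^sub>R w)" for n
    by (rule second_difference_mvt[OF assms, of "?s n" x v w]) (simp, blast)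
  then obtain a b where ab: "\<And>n. 0 < a n" "\<And>n. a n < ?s n" "\<And>n. 0 < b n" "\<And>n. b n < ?s n"
    "\<And>n. \<phi> (x + ?s n *\<^sub>R v + ?s n *\<^sub>R w) - \<phi> (x + ?s n *\<^sub>R v) - \<phi> (x + ?s n *\<^sub>R w) + \<phi> x
      = (?s n)\<^sup>2 * ?D (x + a n *\<^sub>R v + b n *\<^sub>R w)"
    by metis
  have s: "?s \<longlonglongrightarrow> 0" using LIMSEQ_inverse_real_of_nat by (simp add: inverse_eq_divide)
  have "a \<longlonglongrightarrow> 0" "b \<longlonglongrightarrow> 0"
    using ab(1-4) by (auto intro!: tendsto_sandwich[OF _ _ tendsto_const s] always_eventually simp: less_imp_le)
  then have "(\<lambda>n. x + a n *\<^sub>R v + b n *\<^sub>R w) \<longlonglongrightarrow> x + 0 *\<^sub>R v + 0 *\<^sub>R w"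
    by (intro tendsto_intros)
  moreover have "isCont ?D (x + 0 *\<^sub>R v + 0 *\<^sub>R w)"
    using assms by (simp add: numeral_2_eq_2 continuous_on_eq_continuous_at)
  ultimately have "(\<lambda>n. ?D (x + a n *\<^sub>R v + b n *\<^sub>R w)) \<longlonglongrightarrow> ?D (x + 0 *\<^sub>R v + 0 *\<^sub>R w)"
    using isCont_tendsto_compose by blast
  then show ?thesis unfolding ab(5) by simp
qed

lemma symmetric_second_derivative:
  fixes \<phi> :: "'e::euclidean_space \<Rightarrow> real"
  assumes "Ck_on 2 UNIV \<phi>"
  shows "frechet_derivative (\<lambda>y. frechet_derivative \<phi> (at y) v) (at x) w
    = frechet_derivative (\<lambda>y. frechet_derivative \<phi> (at y) w) (at x) v"
  using second_derivative_limit[OF assms, of x v w] second_derivative_limit[OF assms, of x w v]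
  by (auto intro: LIMSEQ_unique simp: algebra_simps)

lemma integrable_compact_support:
  fixes f :: "'e::euclidean_space \<Rightarrow> real"
  assumes "compact K" "continuous_on UNIV f" "\<And>u. u \<notin> K \<Longrightarrow> f u = 0"
  shows "integrable lborel f"
proof -
  have "integrable lborel (\<lambda>u. indicator K u *\<^sub>R f u)"
    using assms(1,2) by (intro borel_integrable_compact) (auto intro: continuous_on_subset)
  also have "(\<lambda>u. indicator K u *\<^sub>R f u) = f"
  proof
    show "indicator K u *\<^sub>R f u = f u" for u by (cases "u \<in> K") (use assms(3) in auto)
  qed
  finally show ?thesis .
qed

text \<open>By translation invariance of Lebesgue measure the difference quotients of
  \<open>W\<close> along \<open>v\<close> have integral 0, and dominated convergence carries this
  over to \<open>D\<close>. Asking for a derivative along the single direction \<open>v\<close> is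
  essential for the closedness proof, where \<open>W\<close> is a test function times the merely
  continuous \<open>curl\<close>, which is constant along \<open>t\<close>.\<close>

lemma integral_directional_derivative_eq_0:
  fixes W D :: "'e::euclidean_space \<Rightarrow> real"
  assumes K: "compact K" and W0: "\<And>u. u \<notin> K \<Longrightarrow> W u = 0"
    and contW: "continuous_on UNIV W" and contD: "continuous_on UNIV D"
    and deriv: "\<And>u. ((\<lambda>s. W (u + s *\<^sub>R v)) has_real_derivative D u) (at 0)"
  shows "(LINT u|lborel. D u) = 0"
proof -
  have D0: "D u = 0" if "u \<notin> K" for u
  proof -
    have "open ((\<lambda>s. u + s *\<^sub>R v) -` (- K))"
      by (intro open_vimage) (auto simp: K compact_imp_closed open_Compl intro!: continuous_intros)
    then have "((\<lambda>s. 0) has_real_derivative D u) (at 0)"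
      by (intro has_field_derivative_transform_within_open[OF deriv[of u]]) (use that W0 in auto)
    then show ?thesis using DERIV_unique DERIV_const by blast
  qed
  have "compact (D ` K)" using K contD compact_continuous_image continuous_on_subset by blast
  then obtain B where B: "\<And>u. u \<in> K \<Longrightarrow> \<bar>D u\<bar> \<le> B" "B > 0"
    using compact_imp_bounded bounded_pos by (metis image_eqI real_norm_def)
  then have B: "\<bar>D u\<bar> \<le> B" for u using D0 by (cases "u \<in> K") auto
  have deriv': "((\<lambda>s. W (u + s *\<^sub>R v)) has_real_derivative D (u + s *\<^sub>R v)) (at s)" for u s
  proof -
    have "((\<lambda>h. W ((u + s *\<^sub>R v) + (h - s) *\<^sub>R v)) has_real_derivative D (u + s *\<^sub>R v) * 1) (at s)"
      by (rule DERIV_chain'[where g = "\<lambda>h. W ((u + s *\<^sub>R v) + h *\<^sub>R v)"])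
         (auto intro!: derivative_eq_intros deriv)
    then show ?thesis by (simp add: algebra_simps)
  qed
  \<comment> \<open>The steps \<open>h n\<close> are at most 1, so all difference quotients vanish
    off this smeared copy of \<open>K\<close>; it carries the dominating function.\<close>
  define K' where "K' = (\<lambda>(k, s). k - s *\<^sub>R v) ` (K \<times> {0..1})"
  have K': "compact K'"
    unfolding K'_def by (intro compact_continuous_image compact_Times K compact_Icc)
      (auto intro!: continuous_intros simp: split_def)
  define h where "h n = 1 / real (Suc n)" for n
  have h: "0 < h n" "h n \<le> 1" for n by (auto simp: h_def)
  define f where "f n u = (W (u + h n *\<^sub>R v) - W u) / h n" for n u
  have int: "integrable lborel W" by (rule integrable_compact_support[OF K contW W0])
  have shift: "integrable lborel (\<lambda>u. W (u + c))" "(LINT u|lborel. W (u + c)) = (LINT u|lborel. W u)" for c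
  proof -
    have m: "(+) c \<in> measurable lborel borel" "W \<in> borel_measurable borel"
      using contW by (auto intro: borel_measurable_continuous_onI)
    have "integrable (distr lborel borel ((+) c)) W" using int by (simp add: lborel_distr_plus)
    then show "integrable lborel (\<lambda>u. W (u + c))"
      by (subst (asm) integrable_distr_eq[OF m]) (simp add: add.commute)
    have "(LINT u|distr lborel borel ((+) c). W u) = (LINT u|lborel. W (c + u))"
      by (rule integral_distr[OF m])
    then show "(LINT u|lborel. W (u + c)) = (LINT u|lborel. W u)"
      by (simp add: lborel_distr_plus add.commute)
  qed
  have bound: "\<bar>f n u\<bar> \<le> B * indicator K' u" for n u
  proof -
    obtain s where s: "0 < s" "s < h n" "W (u + h n *\<^sub>R v) - W (u + 0 *\<^sub>R v) = (h n - 0) * D (u + s *\<^sub>R v)"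
      using MVT2[OF h(1)[of n] deriv'[of u]] by blast
    then have fD: "f n u = D (u + s *\<^sub>R v)" using h[of n] by (simp add: f_def)
    show ?thesis
    proof (cases "u \<in> K'")
      case True
      then show ?thesis using B fD by simp
    next
      case False
      have "u + s *\<^sub>R v \<notin> K"
      proof
        assume "u + s *\<^sub>R v \<in> K"
        then have "(u + s *\<^sub>R v) - s *\<^sub>R v \<in> K'"
          unfolding K'_def using s h(2)[of n] by (intro image_eqI[of _ _ "(u + s *\<^sub>R v, s)"]) auto
        with False show False by simp
      qed
      then show ?thesis using fD D0 False by simp
    qed
  qed
  have lim: "(\<lambda>n. f n u) \<longlonglongrightarrow> D u" for u
  proof -
    have "(\<lambda>s. (W (u + s *\<^sub>R v) - W u) / s) \<midarrow>0\<rightarrow> D u"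
      using deriv[of u] by (simp add: DERIV_def)
    moreover have "filterlim h (at 0) sequentially"
      unfolding filterlim_at using LIMSEQ_inverse_real_of_nat h(1)
      by (auto simp: h_def[abs_def] inverse_eq_divide)
    ultimately show ?thesis
      unfolding f_def by (rule filterlim_compose)
  qed
  have "(\<lambda>n. LINT u|lborel. f n u) \<longlonglongrightarrow> (LINT u|lborel. D u)"
  proof (rule integral_dominated_convergence[where w = "\<lambda>u. B * indicator K' u"])
    show "D \<in> borel_measurable lborel" using contD by (simp add: borel_measurable_continuous_onI)
    have "(\<lambda>u. W (u + c)) \<in> borel_measurable lborel" for c using shift(1) by blast
    moreover have "W \<in> borel_measurable lborel" using int by blast
    ultimately show "f n \<in> borel_measurable lborel" for n
      unfolding f_def[abs_def] by measurable
    show "integrable lborel (\<lambda>u. B * indicator K' u)"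
      using K' by (intro integrable_mult_right integrable_real_indicator)
        (use emeasure_bounded_finite[OF compact_imp_bounded[OF K']] in \<open>auto simp: borel_compact\<close>)
  qed (use lim bound in auto)
  moreover have "(LINT u|lborel. f n u) = 0" for n
    using shift int unfolding f_def by simp
  ultimately show ?thesis by (simp add: LIMSEQ_const_iff)
qed

section \<open>Covering atlases\<close>

lemma covering_space_open_image:
  assumes "covering_space c p S" "openin (top_of_set c) T"
  shows "openin (top_of_set S) (p ` T)"
proof (subst openin_subopen, intro ballI)
  fix y assume "y \<in> p ` T"
  then obtain x where x: "x \<in> T" "y = p x" by blast
  then have "x \<in> c" using assms(2) openin_imp_subset by blast
  then obtain A B q where AB: "x \<in> A" "openin (top_of_set c) A" "openin (top_of_set S) B" "homeomorphism A B p q"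
    using covering_space_local_homeomorphism[OF assms(1)] by metis
  have "openin (top_of_set A) (A \<inter> T)"
    using assms(2) AB(2) by (meson inf_le1 openin_Int openin_imp_subset openin_subset_trans)
  then have "openin (top_of_set B) (p ` (A \<inter> T))"
    using homeomorphism_imp_open_map[OF AB(4)] by blast
  then have "openin (top_of_set S) (p ` (A \<inter> T))"
    using AB(3) openin_trans by blast
  then show "\<exists>U. openin (top_of_set S) U \<and> y \<in> U \<and> U \<subseteq> p ` T"
    using x AB(1) by (intro exI[of _ "p ` (A \<inter> T)"]) auto
qed

lemma second_countable_prod_topology:
  assumes "second_countable X" "second_countable Y"
  shows "second_countable (prod_topology X Y)"
proof -
  obtain A where A: "countable A" "\<And>V. V \<in> A \<Longrightarrow> openin X V"
    "\<And>U x. openin X U \<Longrightarrow> x \<in> U \<Longrightarrow> \<exists>V\<in>A. x \<in> V \<and> V \<subseteq> U"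
    using assms(1) unfolding second_countable_def by metis
  obtain B where B: "countable B" "\<And>V. V \<in> B \<Longrightarrow> openin Y V"
    "\<And>U x. openin Y U \<Longrightarrow> x \<in> U \<Longrightarrow> \<exists>V\<in>B. x \<in> V \<and> V \<subseteq> U"
    using assms(2) unfolding second_countable_def by metis
  define C where "C = (\<lambda>(a, b). a \<times> b) ` (A \<times> B)"
  have "countable C" unfolding C_def using A(1) B(1) by blast
  moreover have "openin (prod_topology X Y) V" if "V \<in> C" for V
    using that A(2) B(2) unfolding C_def by (auto simp: openin_prod_Times_iff)
  moreover have "\<exists>V\<in>C. x \<in> V \<and> V \<subseteq> U" if U: "openin (prod_topology X Y) U" and x: "x \<in> U" for U x
  proof -
    obtain S T where ST: "openin X S" "openin Y T" "fst x \<in> S" "snd x \<in> T" "S \<times> T \<subseteq> U"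
      using U x unfolding openin_prod_topology_alt by (metis prod.collapse)
    obtain a b where "a \<in> A" "fst x \<in> a" "a \<subseteq> S" "b \<in> B" "snd x \<in> b" "b \<subseteq> T"
      using A(3)[OF ST(1,3)] B(3)[OF ST(2,4)] by blast
    then show ?thesis using ST(5) unfolding C_def by (intro bexI[of _ "a \<times> b"]) (auto simp: mem_Times_iff)
  qed
  ultimately show ?thesis unfolding second_countable_def by metis
qed

lemma homeomorphism_chart:
  assumes "open U" "continuous_on U f" "inj_on f U"
    "\<And>W. open W \<Longrightarrow> W \<subseteq> U \<Longrightarrow> openin (top_of_set S) (f ` W)"
  shows "homeomorphism U (f ` U) f (inv_into U f)"
proof -
  have "continuous_on (f ` U) (inv_into U f)"
  proof (rule continuous_on_inverse_open_map[OF assms(2) refl])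
    show "openin (top_of_set (f ` U)) (f ` W)" if "openin (top_of_set U) W" for W
    proof -
      have "openin (top_of_set S) (f ` W)" "openin (top_of_set S) (f ` U)"
        using that assms(1,4) openin_open_eq by (blast, simp)
      then show ?thesis using that
        by (meson image_mono openin_imp_subset openin_subset_trans)
    qed
  qed (use assms(3) in auto)
  then show ?thesis using assms(2,3) by (auto simp: homeomorphism_def)
qed

lemma homeomorphism_map_prod:
  assumes "homeomorphism S S' f f'" "homeomorphism T T' g g'"
  shows "homeomorphism (S \<times> T) (S' \<times> T') (map_prod f g) (map_prod f' g')"
proof -
  have c: "continuous_on (A \<times> B) (map_prod h k)" if "continuous_on A h" "continuous_on B k"
    for A :: "'x::topological_space set" and B :: "'y::topological_space set"
      and h :: "'x \<Rightarrow> 'z::topological_space" and k :: "'y \<Rightarrow> 'w::topological_space"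
    unfolding map_prod_def split_def
    by (intro continuous_on_Pair continuous_on_compose2[OF that(1) continuous_on_fst]
        continuous_on_compose2[OF that(2) continuous_on_snd] continuous_on_id) auto
  show ?thesis
    using assms by (intro homeomorphismI c) (auto simp: homeomorphism_def)
qed

lemma cis_open_map:
  assumes "open W"
  shows "openin (top_of_set (sphere 0 1)) (cis ` W)"
proof -
  have "open (exp ` (Im -` W))"
  proof (rule open_mapping_thm2[of exp UNIV])
    show "open (Im -` W)" using assms by (intro open_vimage) (auto intro: continuous_intros)
    show "\<not> exp constant_on X" if "open X" "X \<noteq> {}" for X :: "complex set"
    proof
      assume "exp constant_on X"
      obtain x where "x \<in> X" using \<open>X \<noteq> {}\<close> by blast
      have "((\<lambda>z. exp x) has_field_derivative exp x) (at x)"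
        by (rule has_field_derivative_transform_within_open[OF DERIV_exp \<open>open X\<close> \<open>x \<in> X\<close>])
           (use \<open>exp constant_on X\<close> \<open>x \<in> X\<close> in \<open>auto simp: constant_on_def\<close>)
      then show False using DERIV_unique[OF _ DERIV_const] exp_not_eq_zero by blast
    qed
  qed (auto intro: holomorphic_intros)
  moreover have "cis ` W = sphere 0 1 \<inter> exp ` (Im -` W)"
  proof -
    have "exp z \<in> cis ` W" if "Im z \<in> W" "cmod (exp z) = 1" for z
    proof -
      have "Re z = 0" using that(2) by simp
      then have "exp z = cis (Im z)" by (simp add: exp_eq_polar)
      then show ?thesis using that(1) by blast
    qed
    moreover have "cis x \<in> exp ` (Im -` W)" if "x \<in> W" for x
      using that by (auto simp: cis_conv_exp intro!: image_eqI[of _ exp "\<i> * of_real x"])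
    ultimately show ?thesis by auto
  qed
  ultimately show ?thesis by (auto simp: openin_open)
qed

lemma continuous_on_cis [continuous_intros]: "continuous_on S cis"
  by (auto simp: cis_conv_exp intro!: continuous_intros)

lemma sphere_eq_cis: "x \<in> sphere 0 1 \<Longrightarrow> \<exists>t. x = cis t"
  using complex_norm_eq_1_exp[of x] by (metis cis_conv_exp dist_0_norm mem_sphere)

text \<open>The length 2 is below the period 2 pi, so these intervals provide charts around every
  point of the circle.\<close>

lemma inj_on_cis: "inj_on cis {a - 1<..<a + 1}"
proof (rule inj_onI)
  fix x y assume xy: "x \<in> {a - 1<..<a + 1}" "y \<in> {a - 1<..<a + 1}" "cis x = cis y"
  then have "cis (x - y) = 1" by (simp flip: cis_divide)
  then have "cos (x - y) = 1" by (metis cis.sel(1) one_complex.sel(1))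
  then obtain n :: int where n: "x - y = of_int n * 2 * pi" using cos_one_2pi_int by blast
  have "\<bar>x - y\<bar> < 2" using xy by auto
  then have "\<bar>of_int n\<bar> * (2 * pi) < 2" using n by (simp add: abs_mult)
  moreover have "2 * pi > 2" using pi_gt3 by simp
  ultimately have "\<bar>real_of_int n\<bar> < 1"
    by (smt (verit) mult_le_cancel_right1)
  then have "n = 0" by linarith
  then show "x = y" using n by simp
qed

lemma circle_atlas_cover: "(\<Union>c\<in>circle_atlas. snd c ` fst c) = sphere 0 1"
proof -
  have "\<exists>c\<in>circle_atlas. x \<in> snd c ` fst c" if x: "x \<in> sphere 0 1" for x
  proof -
    obtain t where "x = cis t" using sphere_eq_cis[OF x] by blast
    then show ?thesis using inj_on_cis[of t]
      by (intro bexI[of _ "({t - 1<..<t + 1}, cis)"]) (auto simp: covering_atlas_def)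
  qed
  then show ?thesis by (auto simp: covering_atlas_def)
qed

text \<open>If \<open>f\<close> lifts to \<open>g\<close> through \<open>q\<close>, then the local
  inverse of \<open>q\<close> recovers \<open>g\<close> near \<open>z\<close>: continuity keeps the
  values of \<open>g\<close> inside \<open>V\<close>, where \<open>q\<close> is injective. All local
  representatives are computed in this way.\<close>

lemma inv_into_lift:
  assumes "open V" "inj_on q V" "open N" "z \<in> N" "isCont g z" "g z \<in> V"
    "\<And>x. x \<in> N \<Longrightarrow> f x = q (g x)"
  obtains W where "open W" "z \<in> W" "W \<subseteq> N" "\<And>x. x \<in> W \<Longrightarrow> g x \<in> V \<and> inv_into V q (f x) = g x"
proof -
  have "\<forall>\<^sub>F x in nhds z. g x \<in> V"
    using assms(1,5,6) unfolding isCont_def by (metis tendsto_at_iff_tendsto_nhds topological_tendstoD)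
  then obtain W where "open W" "z \<in> W" "\<And>x. x \<in> W \<Longrightarrow> g x \<in> V"
    unfolding eventually_nhds by blast
  then show ?thesis
    using assms by (intro that[of "W \<inter> N"]) (auto simp: inv_into_f_f)
qed

text \<open>The charts \<open>c\<close> and \<open>d\<close> may assign different angles to the same
  point of the circle. Their difference \<open>k\<close> is a period of \<open>cis\<close> and stays
  constant nearby.\<close>

lemma local_rep_prod:
  assumes c: "snd c = map_prod cis q" and d: "d = (U \<times> V, map_prod cis q')"
    and U: "open U" "inj_on cis U" and V: "open V" "inj_on q' V"
    and N: "open N" "z \<in> N" "isCont g z" "g z \<in> V" "\<And>x. x \<in> N \<Longrightarrow> f (q x) = q' (g x)"
    and t: "t + k \<in> U" "cis (t + k) = cis t"
  obtains W where "open W" "(t, z) \<in> W" "W \<subseteq> UNIV \<times> N"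
    "\<And>s x. (s, x) \<in> W \<Longrightarrow> (s + k, g x) \<in> fst d \<and> local_rep (map_prod id f) c d (s, x) = (s + k, g x)"
proof -
  obtain Z where Z: "open Z" "z \<in> Z" "Z \<subseteq> N" "\<And>x. x \<in> Z \<Longrightarrow> g x \<in> V"
    using inv_into_lift[OF V N(1-4), of "\<lambda>x. q' (g x)"] by metis
  have "open ((\<lambda>s. s + k) -` U)" using U(1) by (intro open_vimage) (auto intro: continuous_intros)
  moreover have "cis (s + k) = cis s" for s
    using t(2) by (metis cis_mult cis_neq_zero mult_cancel_left2 mult.commute)
  ultimately show ?thesis using Z t(1) U(2) V(2) N(5)
    by (intro that[of "((\<lambda>s. s + k) -` U) \<times> Z"])
       (auto simp: open_Times d c local_rep_def intro!: inv_into_f_eq inj_onI dest: inj_onD)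
qed

lemma circle_atlasD: "(U, f) \<in> circle_atlas \<Longrightarrow> open U \<and> inj_on cis U \<and> f = cis"
  by (auto simp: covering_atlas_def)

lemma covering_space_circle_Times:
  assumes "covering_space X p S"
  shows "covering_space (A \<times> X) (map_prod id p) (A \<times> S)"
proof
  show "continuous_on (A \<times> X) (map_prod id p)"
    unfolding map_prod_def split_def id_def
    by (intro continuous_on_Pair continuous_on_fst continuous_on_id
        continuous_on_compose2[OF covering_space_imp_continuous[OF assms] continuous_on_snd]) auto
  show "map_prod id p ` (A \<times> X) = A \<times> S"
    using covering_space_imp_surjective[OF assms] by (simp add: map_prod_surj_on)
  fix x assume x: "x \<in> A \<times> S"
  then obtain T v where T: "snd x \<in> T" "openin (top_of_set S) T" "\<Union>v = X \<inter> p -` T"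
    "\<forall>u \<in> v. openin (top_of_set X) u" "pairwise disjnt v" "\<forall>u \<in> v. \<exists>q. homeomorphism u T p q"
    using assms unfolding covering_space_def by (metis mem_Times_iff)
  show "\<exists>T. x \<in> T \<and> openin (top_of_set (A \<times> S)) T \<and>
     (\<exists>v. \<Union>v = (A \<times> X) \<inter> map_prod id p -` T \<and> (\<forall>u \<in> v. openin (top_of_set (A \<times> X)) u) \<and>
       pairwise disjnt v \<and> (\<forall>u \<in> v. \<exists>q. homeomorphism u T (map_prod id p) q))"
  proof (intro exI[of _ "A \<times> T"] exI[of _ "(\<times>) A ` v"] conjI ballI)
    show "x \<in> A \<times> T" using x T(1) by (auto simp: mem_Times_iff)
    show "openin (top_of_set (A \<times> S)) (A \<times> T)" using T(2) by (intro openin_Times) auto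
    show "\<Union> ((\<times>) A ` v) = A \<times> X \<inter> map_prod id p -` (A \<times> T)" using T(3) by auto
    show "pairwise disjnt ((\<times>) A ` v)"
      using T(5) by (auto simp: pairwise_def disjnt_def)
    fix u assume "u \<in> (\<times>) A ` v"
    then obtain w where w: "u = A \<times> w" "w \<in> v" by blast
    then show "openin (top_of_set (A \<times> X)) u" using T(4) by (auto intro!: openin_Times)
    obtain q where "homeomorphism w T p q" using T(6) w by blast
    moreover have "homeomorphism A A id id" by (simp add: homeomorphism_def)
    ultimately show "\<exists>q. homeomorphism u (A \<times> T) (map_prod id p) q"
      using homeomorphism_map_prod w(1) by blast
  qed
qed

section \<open>Isometries of the Poincare disk\<close>

lemma open_unit_disk [simp]: "open unit_disk"
  by (simp add: unit_disk_def)

lemma cross2_cnj: "cross2 v w = Im (cnj v * w)"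
  by (simp add: cross2_def)

lemma cross2_mult_right: "cross2 b (c * v) = cross2 (cnj c * b) v"
  by (simp add: cross2_cnj mult_ac)

lemma cross2_mult_mult: "cross2 (c * v) (c * w) = (cmod c)\<^sup>2 * cross2 v w"
  by (simp add: cross2_def cmod_power2) (simp add: algebra_simps power2_eq_square)

lemma cross2_self [simp]: "cross2 v v = 0"
  by (simp add: cross2_def)

lemma cross2_add_left: "cross2 (a + b) v = cross2 a v + cross2 b v"
  by (simp add: cross2_def algebra_simps)

lemma cross2_diff_left: "cross2 (a - b) v = cross2 a v - cross2 b v"
  by (simp add: cross2_def algebra_simps)

lemma cross2_parallel:
  assumes "y \<noteq> 0" "cross2 y v = 0"
  shows "v = ((y \<bullet> v) / (y \<bullet> y)) *\<^sub>R y"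
proof -
  have "(y \<bullet> y) *\<^sub>R v = (y \<bullet> v) *\<^sub>R y + cross2 y v *\<^sub>R (\<i> * y)"
    by (simp add: cross2_def inner_complex_def complex_eq_iff algebra_simps)
  then have "(y \<bullet> y) *\<^sub>R v = (y \<bullet> v) *\<^sub>R y" using assms(2) by simp
  then have "(1 / (y \<bullet> y)) *\<^sub>R ((y \<bullet> y) *\<^sub>R v) = (1 / (y \<bullet> y)) *\<^sub>R ((y \<bullet> v) *\<^sub>R y)" by simp
  then show ?thesis using assms(1) by simp
qed

lemma cross2_scaleR_left: "cross2 (k *\<^sub>R w) v = k * cross2 w v"
  by (simp add: cross2_def algebra_simps)

lemma cross2_scaleR_right: "cross2 w (k *\<^sub>R v) = k * cross2 w v"
  by (simp add: cross2_def algebra_simps)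

lemma cross2_zero [simp]: "cross2 0 v = 0" "cross2 v 0 = 0"
  by (simp_all add: cross2_def)

lemma abs_cross2_le: "\<bar>cross2 b v\<bar> \<le> cmod b * cmod v"
  using abs_Im_le_cmod[of "cnj b * v"] by (simp add: cross2_cnj norm_mult)

lemma bounded_bilinear_cross2: "bounded_bilinear cross2"
proof
  show "\<exists>K. \<forall>a b. norm (cross2 a b) \<le> norm a * norm b * K"
  proof (intro exI[of _ 1] allI)
    fix a b
    have "norm (cross2 a b) \<le> cmod (cnj a * b)"
      unfolding cross2_cnj real_norm_def by (rule abs_Im_le_cmod)
    then show "norm (cross2 a b) \<le> norm a * norm b * 1" by (simp add: norm_mult)
  qed
qed (simp_all add: cross2_def algebra_simps)

lemma cross2_eqI: "(\<And>v. cross2 a v = cross2 b v) \<Longrightarrow> a = b"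
proof -
  assume "\<And>v. cross2 a v = cross2 b v"
  from this[of 1] this[of \<i>] show "a = b" by (simp add: cross2_def complex_eq_iff)
qed

text \<open>A similarity maps 1 and i to orthogonal vectors of equal length; positive orientation
  leaves only i L(1) as the image of i, so \<open>L\<close> is multiplication by L(1).\<close>

lemma conformal_linear:
  assumes "linear L" and inner: "\<And>v w. L v \<bullet> L w = m * (v \<bullet> w)" and orient: "cross2 (L 1) (L \<i>) > 0"
  shows "L v = L 1 * v"
proof -
  define a b where "a = L 1" and "b = L \<i>"
  have 1: "a \<bullet> b = 0" "a \<bullet> a = m" "b \<bullet> b = m"
    using inner[of 1 \<i>] inner[of 1 1] inner[of \<i> \<i>] by (auto simp: a_def b_def)
  \<comment> \<open>Lagrange's identity determines the determinant up to its sign, which the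
    orientation fixes. Then the squared norm of b - i a expands to m + m - 2 m = 0.\<close>
  have "(cross2 a b)\<^sup>2 = (a \<bullet> a) * (b \<bullet> b) - (a \<bullet> b)\<^sup>2"
    by (simp add: cross2_def inner_complex_def algebra_simps power2_eq_square)
  then have "(cross2 a b)\<^sup>2 = m\<^sup>2" using 1 by (simp add: power2_eq_square)
  moreover have "m \<ge> 0" using 1(2) by (metis inner_ge_zero)
  ultimately have cr: "cross2 a b = m" using orient power2_eq_iff[of "cross2 a b" m] unfolding a_def b_def by linarith
  have "(norm (b - \<i> * a))\<^sup>2 = b \<bullet> b + a \<bullet> a - 2 * cross2 a b"
    by (simp add: power2_norm_eq_inner cross2_def inner_complex_def algebra_simps)
  then have b: "b = \<i> * a" using 1 cr by simp
  have "v = Re v *\<^sub>R 1 + Im v *\<^sub>R \<i>" by (simp add: complex_eq_iff)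
  then have "L v = L (Re v *\<^sub>R 1 + Im v *\<^sub>R \<i>)" by simp
  also have "\<dots> = Re v *\<^sub>R a + Im v *\<^sub>R b"
    using assms(1) by (simp add: linear_add linear_scale a_def b_def)
  also have "\<dots> = a * v" by (simp add: b complex_eq_iff)
  finally show ?thesis by (simp add: a_def)
qed

lemma prod_atlasE:
  assumes "c \<in> prod_atlas circle_atlas B" "B \<subseteq> covering_atlas unit_disk q"
  obtains U V where "c = (U \<times> V, map_prod cis q)" "open U" "inj_on cis U"
    "(V, q) \<in> B" "open V" "V \<subseteq> unit_disk" "inj_on q V"
proof -
  obtain U V f g where UV: "c = (U \<times> V, map_prod f g)" "(U, f) \<in> circle_atlas" "(V, g) \<in> B"
    using assms(1) unfolding prod_atlas_def by blast
  moreover have "(V, g) \<in> covering_atlas unit_disk q" using UV(3) assms(2) by blast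
  ultimately show ?thesis using circle_atlasD[OF UV(2)] by (intro that[of U V]) (auto simp: covering_atlas_def)
qed

lemma disk_atlas_subset: "disk_atlas \<subseteq> covering_atlas unit_disk id"
  by (auto simp: covering_atlas_def)

lemma second_countable_top_of_set: "second_countable (top_of_set (S :: 'b::second_countable_topology set))"
proof (rule second_countable_subtopology)
  obtain B :: "'b set set" where B: "countable B" "\<And>C. C \<in> B \<Longrightarrow> open C"
    "\<And>S. open S \<Longrightarrow> \<exists>U. U \<subseteq> B \<and> S = \<Union>U"
    using univ_second_countable by blast
  have "\<exists>V\<in>B. x \<in> V \<and> V \<subseteq> U" if "open U" "x \<in> U" for U x
    using B(3)[OF that(1)] that(2) by auto
  then show "second_countable (euclidean :: 'b topology)"
    unfolding second_countable_def using B(1,2) by (intro exI[of _ B]) simp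
qed

section \<open>The covering group of a hyperbolic surface\<close>

locale hyperbolic_surface =
  fixes G :: "(complex \<Rightarrow> complex) set" and p\<Sigma> :: "complex \<Rightarrow> 'a::topological_space"
    and \<Sigma> :: "'a set" and \<omega>\<Sigma> :: "(complex, 'a) field2"
  assumes Hausdorff_\<Sigma>: "Hausdorff_space (top_of_set \<Sigma>)"
    and second_countable_\<Sigma>: "second_countable (top_of_set \<Sigma>)"
    and group: "discrete_isometry_group G"
    and cover: "orbit_covering G p\<Sigma> \<Sigma>"
    and area: "form2 (surface_atlas p\<Sigma>) \<omega>\<Sigma>"
      "field2_eq disk_atlas (pull2 p\<Sigma> (surface_atlas p\<Sigma>) \<omega>\<Sigma>) hyp_area"
begin

lemma G_bij: "g \<in> G \<Longrightarrow> bij_betw g unit_disk unit_disk"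
  using group by (simp add: discrete_isometry_group_def hyp_isometry_def)

lemma G_maps: "g \<in> G \<Longrightarrow> z \<in> unit_disk \<Longrightarrow> g z \<in> unit_disk"
  using G_bij bij_betw_apply by metis

lemma G_subgroup: "subgroup G (BijGroup unit_disk)"
  using group by (simp add: discrete_isometry_group_def)

lemma G_Bij: "g \<in> G \<Longrightarrow> g \<in> Bij unit_disk"
  using subgroup.subset[OF G_subgroup] by (auto simp: BijGroup_def)

lemma G_one: "(\<lambda>x\<in>unit_disk. x) \<in> G"
  using subgroup.one_closed[OF G_subgroup] by (simp add: BijGroup_def)

lemma G_compose: "g \<in> G \<Longrightarrow> h \<in> G \<Longrightarrow> compose unit_disk g h \<in> G"
  using subgroup.m_closed[OF G_subgroup, of g h] by (simp add: BijGroup_def G_Bij)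

lemma G_inverse:
  assumes "g \<in> G"
  obtains h where "h \<in> G" "\<And>x. x \<in> unit_disk \<Longrightarrow> h (g x) = x" "\<And>x. x \<in> unit_disk \<Longrightarrow> g (h x) = x"
proof
  let ?h = "inv\<^bsub>BijGroup unit_disk\<^esub> g"
  show hG: "?h \<in> G" using subgroup.m_inv_closed[OF G_subgroup assms] .
  have "?h = (\<lambda>x\<in>unit_disk. inv_into unit_disk g x)"
    using G_Bij[OF assms] by (simp add: inv_BijGroup)
  then show "?h (g x) = x" "g (?h x) = x" if "x \<in> unit_disk" for x
    using that G_maps[OF assms that] G_bij[OF assms]
    by (simp_all add: bij_betw_inv_into_left bij_betw_inv_into_right)
qed

lemma G_eqI:
  assumes "g \<in> G" "h \<in> G" "\<And>x. x \<in> unit_disk \<Longrightarrow> g x = h x"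
  shows "g = h"
  using assms G_Bij Bij_imp_extensional by (metis extensionalityI)

lemma G_smooth: "g \<in> G \<Longrightarrow> smooth_on unit_disk g"
  using group by (simp add: discrete_isometry_group_def hyp_isometry_def)

lemma G_has_derivative:
  "g \<in> G \<Longrightarrow> z \<in> unit_disk \<Longrightarrow> (g has_derivative frechet_derivative g (at z)) (at z)"
  using G_smooth[of g] Ck_on_has_derivative[of 0 unit_disk g] by (simp add: smooth_on_def)

lemma G_isCont: "g \<in> G \<Longrightarrow> z \<in> unit_disk \<Longrightarrow> isCont g z"
  using G_has_derivative has_derivative_continuous by blast

lemma G_isometry: "g \<in> G \<Longrightarrow> z \<in> unit_disk \<Longrightarrow>
    hyp_metric (g z) (frechet_derivative g (at z) v) (frechet_derivative g (at z) w) = hyp_metric z v w"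
  using group by (simp add: discrete_isometry_group_def hyp_isometry_def)

lemma covering_p\<Sigma>: "covering_space unit_disk p\<Sigma> \<Sigma>"
  using cover by (simp add: orbit_covering_def)

lemma p\<Sigma>_eq_iff: "z \<in> unit_disk \<Longrightarrow> w \<in> unit_disk \<Longrightarrow> p\<Sigma> z = p\<Sigma> w \<longleftrightarrow> (\<exists>g\<in>G. w = g z)"
  using cover by (simp add: orbit_covering_def)

lemma p\<Sigma>_G: "g \<in> G \<Longrightarrow> z \<in> unit_disk \<Longrightarrow> p\<Sigma> (g z) = p\<Sigma> z"
  using p\<Sigma>_eq_iff[of z "g z"] G_maps by metis

lemma p\<Sigma>_open_map: "open W \<Longrightarrow> W \<subseteq> unit_disk \<Longrightarrow> openin (top_of_set \<Sigma>) (p\<Sigma> ` W)"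
  using covering_space_open_image[OF covering_p\<Sigma>] openin_open_eq[OF open_unit_disk] by blast

lemma surface_chart:
  assumes "z \<in> unit_disk"
  obtains V where "(V, p\<Sigma>) \<in> surface_atlas p\<Sigma>" "z \<in> V"
proof -
  obtain T u q where T: "z \<in> T" "openin (top_of_set unit_disk) T" "homeomorphism T u p\<Sigma> q"
    using covering_space_local_homeomorphism[OF covering_p\<Sigma> assms] by metis
  have "inj_on p\<Sigma> T" using T(3) by (metis homeomorphism_def inj_on_inverseI)
  then show ?thesis
    using T openin_open_eq[OF open_unit_disk] by (intro that[of T]) (auto simp: covering_atlas_def)
qed

lemma surface_atlas_cover: "(\<Union>c\<in>surface_atlas p\<Sigma>. snd c ` fst c) = \<Sigma>"
proof
  show "(\<Union>c\<in>surface_atlas p\<Sigma>. snd c ` fst c) \<subseteq> \<Sigma>"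
    using covering_space_imp_surjective[OF covering_p\<Sigma>] by (auto simp: covering_atlas_def)
  show "\<Sigma> \<subseteq> (\<Union>c\<in>surface_atlas p\<Sigma>. snd c ` fst c)"
  proof
    fix x assume "x \<in> \<Sigma>"
    then obtain z where z: "z \<in> unit_disk" "x = p\<Sigma> z"
      using covering_space_imp_surjective[OF covering_p\<Sigma>] by blast
    then show "x \<in> (\<Union>c\<in>surface_atlas p\<Sigma>. snd c ` fst c)"
      by (metis UN_I fst_conv imageI snd_conv surface_chart)
  qed
qed

text \<open>In a chart \<open>(V, p\<Sigma>)\<close> the covering map is the identity in
  coordinates: this chart with \<open>id\<close> and the chart \<open>(unit_disk, id)\<close> with
  \<open>p\<Sigma>\<close> have the same local representative in any target chart. Hence the
  transformation law of \<open>\<omega>\<Sigma>\<close> and the definition of its pullback produce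
  the same number.\<close>

lemma area_chart:
  assumes "(V, p\<Sigma>) \<in> surface_atlas p\<Sigma>" "z \<in> V"
  shows "\<omega>\<Sigma> (V, p\<Sigma>) z v w = hyp_area d z v w"
proof -
  have zD: "z \<in> unit_disk" using assms by (auto simp: covering_atlas_def)
  define d0 where "d0 = target_chart p\<Sigma> (surface_atlas p\<Sigma>) (unit_disk, id) z"
  have eq: "target_chart p\<Sigma> (surface_atlas p\<Sigma>) (unit_disk, id) z = d0"
    "local_rep id (V, p\<Sigma>) d0 = local_rep p\<Sigma> (unit_disk, id) d0"
    by (simp_all add: d0_def local_rep_def)
  have "\<exists>d. d \<in> surface_atlas p\<Sigma> \<and> p\<Sigma> z \<in> snd d ` fst d" using assms by force
  then have "d0 \<in> surface_atlas p\<Sigma> \<and> p\<Sigma> z \<in> snd d0 ` fst d0"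
    unfolding d0_def target_chart_def by (metis (mono_tags, lifting) id_apply snd_conv someI_ex)
  then have "z \<in> rep_dom id (V, p\<Sigma>) d0" "d0 \<in> surface_atlas p\<Sigma>"
    using assms by (auto simp: rep_dom_def)
  then have "\<omega>\<Sigma> (V, p\<Sigma>) z v w = pull2 p\<Sigma> (surface_atlas p\<Sigma>) \<omega>\<Sigma> (unit_disk, id) z v w"
    using area(1) assms unfolding form2_def tensor2_def pull2_def eq(1) Let_def eq(2)[symmetric] by blast
  then show ?thesis
    using area(2) zD by (simp add: field2_eq_def hyp_area_def)
qed

text \<open>The map \<open>g\<close> is a change between two charts of the surface, so this is the
  transformation law of \<open>\<omega>\<Sigma>\<close>. It shows that \<open>g\<close> preserves
  orientation, which being an isometry would leave open.\<close>

lemma area_invariant: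
  assumes "g \<in> G" "z \<in> unit_disk"
  shows "hyp_area d (g z) (frechet_derivative g (at z) v) (frechet_derivative g (at z) w) = hyp_area d z v w"
proof -
  obtain V where V: "(V, p\<Sigma>) \<in> surface_atlas p\<Sigma>" "z \<in> V" using surface_chart assms by blast
  obtain V' where V': "(V', p\<Sigma>) \<in> surface_atlas p\<Sigma>" "g z \<in> V'" using surface_chart G_maps assms by blast
  have "open V'" "inj_on p\<Sigma> V'" using V' by (auto simp: covering_atlas_def)
  from inv_into_lift[OF this open_unit_disk assms(2) G_isCont[OF assms] V'(2), of p\<Sigma>]
  obtain W where W: "open W" "z \<in> W" "\<And>x. x \<in> W \<Longrightarrow> inv_into V' p\<Sigma> (p\<Sigma> x) = g x"
    using p\<Sigma>_G[OF assms(1)] by metis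
  have rep: "local_rep id (V, p\<Sigma>) (V', p\<Sigma>) x = g x" if "x \<in> W" for x
    using W(3)[OF that] by (simp add: local_rep_def)
  have "z \<in> rep_dom id (V, p\<Sigma>) (V', p\<Sigma>)"
    using V V' p\<Sigma>_G[OF assms] by (auto simp: rep_dom_def) (metis image_eqI)
  then have "\<omega>\<Sigma> (V, p\<Sigma>) z v w = \<omega>\<Sigma> (V', p\<Sigma>) (local_rep id (V, p\<Sigma>) (V', p\<Sigma>) z)
      (D_rep id (V, p\<Sigma>) (V', p\<Sigma>) z v) (D_rep id (V, p\<Sigma>) (V', p\<Sigma>) z w)"
    using area(1) V(1) V'(1) unfolding form2_def tensor2_def by blast
  then have "\<omega>\<Sigma> (V, p\<Sigma>) z v w = \<omega>\<Sigma> (V', p\<Sigma>) (g z) (frechet_derivative g (at z) v) (frechet_derivative g (at z) w)"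
    by (simp only: rep[OF W(2)] frechet_derivative_cong_open[OF W(1,2) rep])
  then show ?thesis by (simp only: area_chart[OF V, of v w d] area_chart[OF V', of _ _ d])
qed

lemma unit_disk_pos: "z \<in> unit_disk \<Longrightarrow> 0 < 1 - (cmod z)\<^sup>2"
  by (simp add: unit_disk_def power_less_one_iff abs_square_less_1)

text \<open>The metric makes the derivative a similarity and the area form makes it orientation
  preserving, so it is multiplication by a complex number: \<open>g\<close> is holomorphic. The
  modulus of its derivative is the ratio of the conformal factors.\<close>

lemma G_derivative:
  assumes "g \<in> G" "z \<in> unit_disk"
  shows "frechet_derivative g (at z) = (\<lambda>v. deriv g z * v)"
    and "(g has_field_derivative deriv g z) (at z)"
    and "(cmod (deriv g z))\<^sup>2 * (1 - (cmod z)\<^sup>2)\<^sup>2 = (1 - (cmod (g z))\<^sup>2)\<^sup>2"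
    and "deriv g z \<noteq> 0"
proof -
  let ?D = "frechet_derivative g (at z)"
  have pos: "0 < 1 - (cmod z)\<^sup>2" "0 < 1 - (cmod (g z))\<^sup>2"
    using unit_disk_pos assms G_maps by blast+
  have lin: "linear ?D" using has_derivative_linear[OF G_has_derivative[OF assms]] .
  have inner: "?D v \<bullet> ?D w = ((1 - (cmod (g z))\<^sup>2)\<^sup>2 / (1 - (cmod z)\<^sup>2)\<^sup>2) * (v \<bullet> w)" for v w
    using G_isometry[OF assms, of v w] pos by (simp add: hyp_metric_def field_simps)
  have "hyp_area undefined z 1 \<i> > 0" using pos by (simp add: hyp_area_def cross2_def)
  then have "hyp_area undefined (g z) (?D 1) (?D \<i>) > 0" using area_invariant[OF assms] by simp
  then have "cross2 (?D 1) (?D \<i>) > 0"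
    using pos by (simp add: hyp_area_def zero_less_divide_iff zero_less_mult_iff)
  from conformal_linear[OF lin inner this] have D: "?D = (\<lambda>v. ?D 1 * v)" by blast
  have "(g has_field_derivative ?D 1) (at z)"
    unfolding has_field_derivative_def D[symmetric] by (rule G_has_derivative[OF assms])
  moreover from this have d: "?D 1 = deriv g z" by (simp add: DERIV_imp_deriv)
  ultimately show "(g has_field_derivative deriv g z) (at z)" by simp
  show "?D = (\<lambda>v. deriv g z * v)" using D d by simp
  show eq: "(cmod (deriv g z))\<^sup>2 * (1 - (cmod z)\<^sup>2)\<^sup>2 = (1 - (cmod (g z))\<^sup>2)\<^sup>2"
    using inner[of 1 1] pos by (simp add: d power2_norm_eq_inner[symmetric])
  show "deriv g z \<noteq> 0" using eq pos by auto
qed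

lemma G_cmod_deriv:
  assumes "g \<in> G" "z \<in> unit_disk"
  shows "cmod (deriv g z) * (1 - (cmod z)\<^sup>2) = 1 - (cmod (g z))\<^sup>2"
proof (rule power2_eq_imp_eq)
  show "(cmod (deriv g z) * (1 - (cmod z)\<^sup>2))\<^sup>2 = (1 - (cmod (g z))\<^sup>2)\<^sup>2"
    using G_derivative(3)[OF assms] by (simp add: power_mult_distrib)
qed (use unit_disk_pos[OF assms(2)] unit_disk_pos[OF G_maps[OF assms]] in auto)

lemma Ck_on_deriv:
  assumes "g \<in> G"
  shows "Ck_on k unit_disk (deriv g)"
proof (rule Ck_on_cong[OF open_unit_disk])
  have "Ck_on (Suc k) unit_disk g" using G_smooth[OF assms] by (simp only: smooth_on_def)
  then show "Ck_on k unit_disk (\<lambda>z. frechet_derivative g (at z) 1)" by simp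
qed (simp add: G_derivative(1)[OF assms])

text \<open>This treats four kinds of maps at once: the covering, the identity of the quotient, a
  deck transformation, and the identity of the cylinder. The charts in use are restrictions of (t,
  z) |-> (cis t, q z), and each of these maps becomes an element of \<open>G\<close> in the second
  coordinate.\<close>

definition lifts :: "('b \<Rightarrow> 'c) \<Rightarrow> (complex \<Rightarrow> 'b) \<Rightarrow> (complex \<Rightarrow> 'c) \<Rightarrow> bool" where
  "lifts f q q' \<longleftrightarrow> (\<forall>z\<in>unit_disk. \<forall>w\<in>unit_disk. f (q z) = q' w \<longrightarrow>
     (\<exists>g\<in>G. g z = w \<and> (\<forall>x\<in>unit_disk. f (q x) = q' (g x))))"

lemma lifts_p\<Sigma>: "lifts p\<Sigma> id p\<Sigma>" "lifts id p\<Sigma> p\<Sigma>"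
proof -
  have "\<exists>g\<in>G. g z = w \<and> (\<forall>x\<in>unit_disk. p\<Sigma> x = p\<Sigma> (g x))"
    if "z \<in> unit_disk" "w \<in> unit_disk" "p\<Sigma> z = p\<Sigma> w" for z w
    using that p\<Sigma>_eq_iff[of z w] p\<Sigma>_G by metis
  then show "lifts p\<Sigma> id p\<Sigma>" "lifts id p\<Sigma> p\<Sigma>" unfolding lifts_def by simp_all
qed

lemma lifts_G: "g \<in> G \<Longrightarrow> lifts g id id"
  unfolding lifts_def by auto

lemma lifts_id: "lifts id id id"
  unfolding lifts_def using G_one by (auto intro!: bexI[of _ "\<lambda>x\<in>unit_disk. x"])

text \<open>The one computation behind all chart changes: \<open>lifts\<close> selects the element
  \<open>g\<close> that connects the two chosen preimages in the disk, and \<open>k\<close> is the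
  difference of the two angles. Later facts about local representatives only read off this
  pair.\<close>

lemma rep_domE:
  assumes "lifts f q q'" "c \<in> prod_atlas circle_atlas B" "B \<subseteq> covering_atlas unit_disk q"
    "d \<in> prod_atlas circle_atlas B'" "B' \<subseteq> covering_atlas unit_disk q'"
    "u \<in> rep_dom (map_prod id f) c d"
  obtains k g W where "g \<in> G" "open W" "u \<in> W" "W \<subseteq> UNIV \<times> unit_disk"
    "\<And>s x. (s, x) \<in> W \<Longrightarrow> (s + k, g x) \<in> fst d \<and> local_rep (map_prod id f) c d (s, x) = (s + k, g x)"
    "\<And>x. x \<in> unit_disk \<Longrightarrow> f (q x) = q' (g x)"
proof -
  from prod_atlasE[OF assms(2,3)] obtain U V where c: "c = (U \<times> V, map_prod cis q)" "V \<subseteq> unit_disk" by metis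
  from prod_atlasE[OF assms(4,5)] obtain U' V' where d: "d = (U' \<times> V', map_prod cis q')" "open U'" "inj_on cis U'"
    "open V'" "V' \<subseteq> unit_disk" "inj_on q' V'" by metis
  obtain t z where u: "u = (t, z)" by (cases u)
  have "t \<in> U" "z \<in> V" "map_prod id f (cis t, q z) \<in> map_prod cis q' ` (U' \<times> V')"
    using assms(6) unfolding u by (auto simp: rep_dom_def c d)
  then obtain t' w where tw: "t' \<in> U'" "cis t' = cis t" "w \<in> V'" "q' w = f (q z)" by auto
  have zD: "z \<in> unit_disk" "w \<in> unit_disk" using \<open>z \<in> V\<close> tw c d by auto
  then obtain g where g: "g \<in> G" "g z = w" "\<And>x. x \<in> unit_disk \<Longrightarrow> f (q x) = q' (g x)"
    using assms(1) tw(4) unfolding lifts_def by metis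
  have "snd c = map_prod cis q" using c by simp
  from local_rep_prod[OF this d(1-4,6) open_unit_disk zD(1) G_isCont[OF g(1) zD(1)] _ g(3), of t "t' - t"]
  obtain W where "open W" "(t, z) \<in> W" "W \<subseteq> UNIV \<times> unit_disk"
    "\<And>s x. (s, x) \<in> W \<Longrightarrow> (s + (t' - t), g x) \<in> fst d \<and> local_rep (map_prod id f) c d (s, x) = (s + (t' - t), g x)"
    using tw g(2) by auto
  then show ?thesis using g(3) by (intro that[OF g(1), of W "t' - t"]) (auto simp: u)
qed

lemma rep_derivE:
  assumes "lifts f q q'" "c \<in> prod_atlas circle_atlas B" "B \<subseteq> covering_atlas unit_disk q"
    "d \<in> prod_atlas circle_atlas B'" "B' \<subseteq> covering_atlas unit_disk q'"
    "(t, z) \<in> rep_dom (map_prod id f) c d"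
  obtains k g where "g \<in> G" "(t + k, g z) \<in> fst d" "local_rep (map_prod id f) c d (t, z) = (t + k, g z)"
    "D_rep (map_prod id f) c d (t, z) = (\<lambda>(\<tau>, v). (\<tau>, deriv g z * v))" "z \<in> unit_disk"
    "\<And>x. x \<in> unit_disk \<Longrightarrow> f (q x) = q' (g x)"
proof -
  obtain k g W where W: "g \<in> G" "open W" "(t, z) \<in> W" "W \<subseteq> UNIV \<times> unit_disk"
    "\<And>s x. (s, x) \<in> W \<Longrightarrow> (s + k, g x) \<in> fst d \<and> local_rep (map_prod id f) c d (s, x) = (s + k, g x)"
    "\<And>x. x \<in> unit_disk \<Longrightarrow> f (q x) = q' (g x)"
    using rep_domE[OF assms] by metis
  have z: "z \<in> unit_disk" using W by auto
  have "((\<lambda>x. g (snd x)) has_derivative (\<lambda>v. frechet_derivative g (at z) (snd v))) (at (t, z))"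
    by (rule has_derivative_compose[OF has_derivative_snd[OF has_derivative_ident]])
       (use G_has_derivative[OF W(1) z] in simp)
  then have "((\<lambda>x. (fst x + k, g (snd x))) has_derivative (\<lambda>v. (fst v + 0, deriv g z * snd v))) (at (t, z))"
    unfolding G_derivative(1)[OF W(1) z] by (intro derivative_intros)
  then have "(local_rep (map_prod id f) c d has_derivative (\<lambda>v. (fst v + 0, deriv g z * snd v))) (at (t, z))"
    by (rule has_derivative_transform_within_open[OF _ W(2,3)]) (use W(5) in auto)
  then have "D_rep (map_prod id f) c d (t, z) = (\<lambda>(\<tau>, v). (\<tau>, deriv g z * v))"
    by (simp add: frechet_derivativeI split_def)
  then show ?thesis using that[OF W(1)] W(5)[OF W(3)] z W(6) by blast
qed

lemma smooth_on_rep: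
  assumes "lifts f q q'" "c \<in> prod_atlas circle_atlas B" "B \<subseteq> covering_atlas unit_disk q"
    "d \<in> prod_atlas circle_atlas B'" "B' \<subseteq> covering_atlas unit_disk q'"
  shows "smooth_on (rep_dom (map_prod id f) c d) (local_rep (map_prod id f) c d)"
proof (rule smooth_on_local)
  fix u assume "u \<in> rep_dom (map_prod id f) c d"
  then obtain k g W where W: "g \<in> G" "open W" "u \<in> W" "W \<subseteq> UNIV \<times> unit_disk"
    "\<And>s x. (s, x) \<in> W \<Longrightarrow> local_rep (map_prod id f) c d (s, x) = (s + k, g x)"
    using rep_domE[OF assms] by metis
  have "smooth_on W (\<lambda>(s, x). (s + k, g x))"
    using smooth_on_prod_translation[OF G_smooth[OF W(1)] open_unit_disk, of k]
    unfolding smooth_on_def by (intro allI Ck_on_subset[OF _ W(4)]) simp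
  moreover have "\<forall>y\<in>W. local_rep (map_prod id f) c d y = (case y of (s, x) \<Rightarrow> (s + k, g x))"
  proof
    show "local_rep (map_prod id f) c d y = (case y of (s, x) \<Rightarrow> (s + k, g x))" if "y \<in> W" for y
      using W(5)[of "fst y" "snd y"] that by (simp add: split_beta)
  qed
  ultimately show "\<exists>N h. open N \<and> u \<in> N \<and> smooth_on N h \<and> (\<forall>y\<in>N. local_rep (map_prod id f) c d y = h y)"
    using W(2,3) by (intro exI[of _ W] exI[of _ "\<lambda>(s, x). (s + k, g x)"]) simp
qed

text \<open>Used twice: with q = \<open>id\<close> for the cylinder and with q =
  \<open>p\<Sigma>\<close> for the quotient.\<close>

lemma smooth_manifold_prod_atlas:
  fixes q :: "complex \<Rightarrow> 'b::topological_space"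
  assumes "lifts id q q" "B \<subseteq> covering_atlas unit_disk q" "Hausdorff_space (top_of_set S)"
    "second_countable (top_of_set S)" "continuous_on unit_disk q"
    "\<And>W. open W \<Longrightarrow> W \<subseteq> unit_disk \<Longrightarrow> openin (top_of_set S) (q ` W)"
    "(\<Union>c\<in>B. snd c ` fst c) = S"
  shows "smooth_manifold (sphere 0 1 \<times> S) (prod_atlas circle_atlas B)"
  unfolding smooth_manifold_def
proof (intro conjI ballI)
  show "Hausdorff_space (top_of_set ((sphere 0 1 :: complex set) \<times> S))"
    unfolding prod_topology_subtopology_eu[symmetric] Hausdorff_space_prod_topology
    using assms(3) by (simp add: Hausdorff_space_subtopology)
  show "second_countable (top_of_set ((sphere 0 1 :: complex set) \<times> S))"
    unfolding prod_topology_subtopology_eu[symmetric]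
    by (intro second_countable_prod_topology second_countable_top_of_set assms)
  show "(\<Union>c\<in>prod_atlas circle_atlas B. snd c ` fst c) = sphere 0 1 \<times> S"
  proof -
    have "(\<Union>c\<in>prod_atlas circle_atlas B. snd c ` fst c)
        = (\<Union>c\<in>circle_atlas. snd c ` fst c) \<times> (\<Union>c\<in>B. snd c ` fst c)"
      (is "?L = ?A \<times> ?B")
    proof (intro subset_antisym subsetI)
      fix x assume "x \<in> ?L"
      then obtain c where c: "c \<in> prod_atlas circle_atlas B" "x \<in> snd c ` fst c" by (rule UN_E)
      then obtain U V f g where UV: "(U, f) \<in> circle_atlas" "(V, g) \<in> B" "c = (U \<times> V, map_prod f g)"
        unfolding prod_atlas_def by blast
      then have "fst x \<in> f ` U" "snd x \<in> g ` V" using c(2) by auto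
      then have "fst x \<in> ?A" "snd x \<in> ?B"
        using UN_I[OF UV(1), of "fst x" "\<lambda>c. snd c ` fst c"] UN_I[OF UV(2), of "snd x" "\<lambda>c. snd c ` fst c"]
        by simp_all
      then show "x \<in> ?A \<times> ?B" by (simp only: mem_Times_iff)
    next
      fix x assume "x \<in> ?A \<times> ?B"
      then obtain c d where cd: "c \<in> circle_atlas" "fst x \<in> snd c ` fst c" "d \<in> B" "snd x \<in> snd d ` fst d"
        unfolding mem_Times_iff by blast
      then have "(fst c \<times> fst d, map_prod (snd c) (snd d)) \<in> prod_atlas circle_atlas B"
        unfolding prod_atlas_def mem_Collect_eq
        by (intro exI[of _ "fst c"] exI[of _ "fst d"] exI[of _ "snd c"] exI[of _ "snd d"]) simp
      moreover have "x \<in> map_prod (snd c) (snd d) ` (fst c \<times> fst d)"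
        using cd by (simp add: map_prod_surj_on mem_Times_iff)
      ultimately show "x \<in> ?L" by (rule_tac UN_I) (assumption, simp only: fst_conv snd_conv)
    qed
    then show ?thesis by (simp only: circle_atlas_cover assms(7))
  qed
  show "smooth_on (rep_dom id c d) (local_rep id c d)"
    if "c \<in> prod_atlas circle_atlas B" "d \<in> prod_atlas circle_atlas B" for c d
    using smooth_on_rep[OF assms(1) that(1) assms(2) that(2) assms(2)] by (simp add: map_prod.id)
  show "case c of (U, \<psi>) \<Rightarrow> open U \<and> openin (top_of_set ((sphere 0 1 :: complex set) \<times> S)) (\<psi> ` U) \<and>
      homeomorphism U (\<psi> ` U) \<psi> (inv_into U \<psi>)" if cB: "c \<in> prod_atlas circle_atlas B" for c
  proof -
    obtain U V where c: "c = (U \<times> V, map_prod cis q)" "open U" "inj_on cis U"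
      "open V" "V \<subseteq> unit_disk" "inj_on q V" using prod_atlasE[OF cB assms(2)] by metis
    have img: "map_prod cis q ` (U \<times> V) = cis ` U \<times> q ` V" by (simp add: map_prod_surj_on)
    have h: "homeomorphism U (cis ` U) cis (inv_into U cis)" "homeomorphism V (q ` V) q (inv_into V q)"
      using c assms(5,6) by (auto intro!: homeomorphism_chart[where S = "sphere 0 1"] homeomorphism_chart[where S = S]
          cis_open_map continuous_on_cis intro: continuous_on_subset)
    have "homeomorphism (U \<times> V) (cis ` U \<times> q ` V) (map_prod cis q) (inv_into (U \<times> V) (map_prod cis q))"
    proof (rule homeomorphism_cong[OF homeomorphism_map_prod[OF h]])
      show "inv_into (U \<times> V) (map_prod cis q) y = map_prod (inv_into U cis) (inv_into V q) y" if "y \<in> cis ` U \<times> q ` V" for y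
        using that c(3,6) by (auto intro!: inv_into_f_eq map_prod_inj_on)
    qed auto
    moreover have "openin (top_of_set ((sphere 0 1 :: complex set) \<times> S)) (cis ` U \<times> q ` V)"
      using c assms(6) by (intro openin_Times cis_open_map) auto
    ultimately show ?thesis using c by (simp add: img open_Times)
  qed
qed

end

section \<open>The profile of the twist\<close>

text \<open>Differentiability at the joint identifies the one-sided slopes \<open>m\<close> and
  \<open>n\<close>, and the common value there identifies the constants. This removes breakpoints
  that are not corners.\<close>

lemma affine_join:
  fixes h :: "real \<Rightarrow> real"
  assumes "x < p" "p < y" "\<And>r. r \<in> {x..p} \<Longrightarrow> h r = m * r + k" "\<And>r. r \<in> {p..y} \<Longrightarrow> h r = n * r + l"
    "h differentiable (at p)"
  shows "\<exists>m k. \<forall>r\<in>{x..y}. h r = m * r + k"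
proof -
  obtain D where D: "(h has_real_derivative D) (at p)"
    using assms(5) real_differentiable_def by blast
  have "((\<lambda>r. m * r + k) has_real_derivative D) (at p within {x..p})"
    by (rule has_field_derivative_transform_within[OF has_field_derivative_at_within[OF D] zero_less_one])
       (use assms in auto)
  moreover have "((\<lambda>r. m * r + k) has_real_derivative m) (at p within {x..p})"
    by (auto intro!: derivative_eq_intros)
  ultimately have "D = m"
    using vector_derivative_unique_within_closed_interval[of x p p] assms(1)
    by (simp add: has_real_derivative_iff_has_vector_derivative)
  have "((\<lambda>r. n * r + l) has_real_derivative D) (at p within {p..y})"
    by (rule has_field_derivative_transform_within[OF has_field_derivative_at_within[OF D] zero_less_one])
       (use assms in auto)
  moreover have "((\<lambda>r. n * r + l) has_real_derivative n) (at p within {p..y})"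
    by (auto intro!: derivative_eq_intros)
  ultimately have "D = n"
    using vector_derivative_unique_within_closed_interval[of p y p] assms(2)
    by (simp add: has_real_derivative_iff_has_vector_derivative)
  have "m * p + k = n * p + l" using assms(1-2) assms(3,4)[of p] by simp
  show ?thesis
  proof (intro exI ballI)
    show "h r = m * r + k" if "r \<in> {x..y}" for r
      using that assms(3,4)[of r] \<open>D = m\<close> \<open>D = n\<close> \<open>m * p + k = n * p + l\<close> by (cases "r \<le> p") auto
  qed
qed

lemma eq_at_endpoints:
  fixes h F :: "real \<Rightarrow> real"
  assumes "continuous_on {x..y} h" "continuous_on {x..y} F" "x < y"
    "\<And>r. r \<in> {x<..<y} \<Longrightarrow> h r = F r" "r \<in> {x..y}"
  shows "h r = F r"
proof -
  have "h r - F r = 0"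
    by (rule continuous_constant_on_closure[of "{x<..<y}" "\<lambda>r. h r - F r"])
       (use assms in \<open>auto intro!: continuous_intros simp: closure_greaterThanLessThan\<close>)
  then show ?thesis by simp
qed

text \<open>\<open>piecewise_linear_on\<close> allows an arbitrary finite set of breakpoints, and
  differentiability inside the interval makes all of them spurious. The induction is on their
  number: split at one of them and glue with \<open>affine_join\<close>.\<close>

lemma piecewise_linear_on_imp_affine:
  assumes pl: "piecewise_linear_on a b h" and "a \<le> x" "x < y" "y \<le> b" "continuous_on {x..y} h"
    and "\<And>r. r \<in> {x<..<y} \<Longrightarrow> h differentiable (at r)"
  obtains m k where "\<And>r. r \<in> {x..y} \<Longrightarrow> h r = m * r + k"
proof -
  obtain P where P: "finite P" "\<And>x y. a \<le> x \<Longrightarrow> x < y \<Longrightarrow> y \<le> b \<Longrightarrow> {x<..<y} \<inter> P = {} \<Longrightarrow>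
        \<exists>m k. \<forall>r\<in>{x<..<y}. h r = m * r + k"
    using pl unfolding piecewise_linear_on_def by metis
  have "\<exists>m k. \<forall>r\<in>{x..y}. h r = m * r + k"
    if "a \<le> x" "x < y" "y \<le> b" "continuous_on {x..y} h" "\<And>r. r \<in> {x<..<y} \<Longrightarrow> h differentiable (at r)" for x y
    using that
  proof (induction "card ({x<..<y} \<inter> P)" arbitrary: x y rule: less_induct)
    case less
    show ?case
    proof (cases "{x<..<y} \<inter> P = {}")
      case True
      then obtain m k where mk: "\<forall>r\<in>{x<..<y}. h r = m * r + k" using P(2)[of x y] less.prems by auto
      have "h r = m * r + k" if "r \<in> {x..y}" for r
        by (rule eq_at_endpoints[of x y h "\<lambda>r. m * r + k" r])
           (use that less.prems mk in \<open>auto intro!: continuous_intros\<close>)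
      then show ?thesis by blast
    next
      case False
      then obtain p where p: "x < p" "p < y" "p \<in> P" by auto
      have "card ({x<..<p} \<inter> P) < card ({x<..<y} \<inter> P)" "card ({p<..<y} \<inter> P) < card ({x<..<y} \<inter> P)"
      proof -
        have "p \<in> {x<..<y} \<inter> P" "p \<notin> {x<..<p} \<inter> P" "p \<notin> {p<..<y} \<inter> P"
          "{x<..<p} \<inter> P \<subseteq> {x<..<y} \<inter> P" "{p<..<y} \<inter> P \<subseteq> {x<..<y} \<inter> P"
          using p by auto
        then have "{x<..<p} \<inter> P \<subset> {x<..<y} \<inter> P" "{p<..<y} \<inter> P \<subset> {x<..<y} \<inter> P"
          by blast+
        then show "card ({x<..<p} \<inter> P) < card ({x<..<y} \<inter> P)" "card ({p<..<y} \<inter> P) < card ({x<..<y} \<inter> P)"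
          using P(1) by (simp_all add: psubset_card_mono)
      qed
      moreover have "continuous_on {x..p} h" "continuous_on {p..y} h"
        using less.prems(4) p by (auto intro: continuous_on_subset)
      ultimately have "\<exists>m k. \<forall>r\<in>{x..p}. h r = m * r + k" "\<exists>m k. \<forall>r\<in>{p..y}. h r = m * r + k"
        using less.hyps[of x p] less.hyps[of p y] less.prems p by auto
      moreover have "h differentiable (at p)" using less.prems p by auto
      ultimately show ?thesis using affine_join p(1,2) by metis
    qed
  qed
  from this[OF assms(2-)] show ?thesis using that by metis
qed

text \<open>The trapezoidal rule is exact when the derivative is affine.\<close>

lemma affine_antiderivative:
  fixes f h :: "real \<Rightarrow> real"
  assumes "\<And>r. r \<in> {x..y} \<Longrightarrow> (f has_real_derivative h r) (at r within {x..y})"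
    "\<And>r. r \<in> {x..y} \<Longrightarrow> h r = m * r + k" "r \<in> {x..y}"
  shows "f r = f x + (h x + h r) / 2 * (r - x)"
proof -
  have "\<exists>c. \<forall>r\<in>{x..y}. f r - (m * r\<^sup>2 / 2 + k * r) = c"
  proof (rule has_field_derivative_zero_constant)
    fix r assume r: "r \<in> {x..y}"
    show "((\<lambda>r. f r - (m * r\<^sup>2 / 2 + k * r)) has_field_derivative 0) (at r within {x..y})"
      using assms(1,2)[OF r] by (auto intro!: derivative_eq_intros)
  qed simp
  then obtain c where c: "\<And>r. r \<in> {x..y} \<Longrightarrow> f r = c + (m * r\<^sup>2 / 2 + k * r)"
    by (metis add_diff_cancel_right' diff_add_cancel)
  have "x \<in> {x..y}" using assms(3) by auto
  then show ?thesis
    using assms(3) by (simp add: c assms(2)) (simp add: field_simps power2_eq_square)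
qed

lemma has_real_derivative_unique_subinterval:
  fixes f F :: "real \<Rightarrow> real"
  assumes "(f has_real_derivative D) (at x within S)" "(F has_real_derivative E) (at x)"
    "{l..u} \<subseteq> S" "l < u" "x \<in> {l..u}" "\<And>r. r \<in> {l..u} \<Longrightarrow> f r = F r"
  shows "D = E"
proof -
  have "(f has_real_derivative D) (at x within {l..u})"
    using assms(1,3) has_field_derivative_subset by blast
  then have "(F has_real_derivative D) (at x within {l..u})"
    by (rule has_field_derivative_transform_within[OF _ zero_less_one]) (use assms in auto)
  moreover have "(F has_real_derivative E) (at x within {l..u})"
    using assms(2) by (rule has_field_derivative_at_within)
  ultimately show ?thesis
    using vector_derivative_unique_within_closed_interval[of l u x] assms(4,5)
    by (simp add: has_real_derivative_iff_has_vector_derivative)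
qed

section \<open>The exact shape of the profile\<close>

locale profile =
  fixes \<delta> \<epsilon> C :: real and f1 f2 f1' f2' :: "real \<Rightarrow> real"
  assumes \<delta>: "0 < \<delta>" "\<delta> \<le> 1/3" and \<epsilon>: "0 < \<epsilon>" "\<epsilon> \<le> \<delta>/10" and C: "1 \<le> C"
    and profile: "twist_profile \<delta> \<epsilon> C f1 f2 f1' f2'"
begin

lemma f_deriv:
  assumes "r \<in> {0..\<delta>}"
  shows "(f1 has_real_derivative f1' r) (at r within {0..\<delta>})" "(f2 has_real_derivative f2' r) (at r within {0..\<delta>})"
  using profile assms unfolding twist_profile_def by blast+

lemma f_deriv_at:
  assumes "0 < r" "r < \<delta>"
  shows "(f1 has_real_derivative f1' r) (at r)" "(f2 has_real_derivative f2' r) (at r)"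
  using f_deriv[of r] assms at_within_Icc_at[of 0 r \<delta>] by auto

lemma f'_continuous: "continuous_on {0..\<delta>} f1'" "continuous_on {0..\<delta>} f2'"
  using profile unfolding twist_profile_def by blast+

lemma f_continuous: "continuous_on {0..\<delta>} f1" "continuous_on {0..\<delta>} f2"
  unfolding continuous_on_eq_continuous_within using f_deriv DERIV_continuous by blast+

lemma profile_ends:
  "r \<in> {0..<\<epsilon>/2} \<Longrightarrow> f1 r = -1" "r \<in> {0..<\<epsilon>/2} \<Longrightarrow> f2 r = - (r\<^sup>2 / (1 - r\<^sup>2))"
  "r \<in> {\<delta> - \<epsilon>/2<..\<delta>} \<Longrightarrow> f1 r = 1" "r \<in> {\<delta> - \<epsilon>/2<..\<delta>} \<Longrightarrow> f2 r = r\<^sup>2 / (1 - r\<^sup>2)"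
  using profile unfolding twist_profile_def minus_divide_left by blast+

lemma square_neq_1: "0 \<le> r \<Longrightarrow> r \<le> \<delta> \<Longrightarrow> r\<^sup>2 \<noteq> 1"
  using \<delta> power_strict_mono[of r 1 2] by simp

lemma continuous_on_ratio: "S \<subseteq> {0..\<delta>} \<Longrightarrow> continuous_on S (\<lambda>r. r\<^sup>2 / (1 - r\<^sup>2))"
  by (intro continuous_intros) (use square_neq_1 in force)

lemma f_inner:
  assumes "r \<in> {0..\<epsilon>/2}"
  shows "f1 r = -1" "f2 r = - (r\<^sup>2 / (1 - r\<^sup>2))"
proof -
  have sub: "{0..\<epsilon>/2} \<subseteq> {0..\<delta>}" "0 < \<epsilon>/2" using \<delta> \<epsilon> by auto
  note c = continuous_on_subset[OF f_continuous(1) sub(1)] continuous_on_subset[OF f_continuous(2) sub(1)]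
  show "f1 r = -1"
    by (rule eq_at_endpoints[OF c(1) continuous_on_const sub(2) _ assms]) (simp add: profile_ends)
  show "f2 r = - (r\<^sup>2 / (1 - r\<^sup>2))"
    by (rule eq_at_endpoints[OF c(2) continuous_on_minus[OF continuous_on_ratio[OF sub(1)]] sub(2) _ assms])
       (simp add: profile_ends)
qed

lemma f_outer:
  assumes "r \<in> {\<delta> - \<epsilon>/2..\<delta>}"
  shows "f1 r = 1" "f2 r = r\<^sup>2 / (1 - r\<^sup>2)"
proof -
  have sub: "{\<delta> - \<epsilon>/2..\<delta>} \<subseteq> {0..\<delta>}" "\<delta> - \<epsilon>/2 < \<delta>" using \<delta> \<epsilon> by auto
  note c = continuous_on_subset[OF f_continuous(1) sub(1)] continuous_on_subset[OF f_continuous(2) sub(1)]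
  show "f1 r = 1"
    by (rule eq_at_endpoints[OF c(1) continuous_on_const sub(2) _ assms]) (simp add: profile_ends)
  show "f2 r = r\<^sup>2 / (1 - r\<^sup>2)"
    by (rule eq_at_endpoints[OF c(2) continuous_on_ratio[OF sub(1)] sub(2) _ assms])
       (simp add: profile_ends)
qed

lemma DERIV_ratio:
  assumes "r\<^sup>2 \<noteq> 1"
  shows "((\<lambda>r::real. r\<^sup>2 / (1 - r\<^sup>2)) has_real_derivative 2 * r / (1 - r\<^sup>2)\<^sup>2) (at r)"
proof -
  have "((\<lambda>r::real. r\<^sup>2 / (1 - r\<^sup>2)) has_real_derivative
      (2 * r * (1 - r\<^sup>2) - r\<^sup>2 * (- 2 * r)) / ((1 - r\<^sup>2) * (1 - r\<^sup>2))) (at r)"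
    using assms by (intro DERIV_divide) (auto intro!: derivative_eq_intros)
  also have "2 * r * (1 - r\<^sup>2) - r\<^sup>2 * (- 2 * r) = 2 * r"
    by (simp add: algebra_simps power2_eq_square)
  finally show ?thesis by (simp add: power2_eq_square)
qed

lemma f'_inner:
  assumes "r \<in> {0..\<epsilon>/2}"
  shows "f1' r = 0" "f2' r = - (2 * r / (1 - r\<^sup>2)\<^sup>2)"
proof -
  have r1: "r\<^sup>2 \<noteq> 1" using assms \<delta> \<epsilon> power_strict_mono[of r 1 2] by auto
  have r: "r \<in> {0..\<delta>}" "{0..\<epsilon>/2} \<subseteq> {0..\<delta>}" "0 < \<epsilon>/2" using assms \<epsilon> \<delta> by auto
  show "f1' r = 0"
    by (rule has_real_derivative_unique_subinterval[OF f_deriv(1)[OF r(1)] DERIV_const r(2,3) assms f_inner(1)])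
  show "f2' r = - (2 * r / (1 - r\<^sup>2)\<^sup>2)"
    by (rule has_real_derivative_unique_subinterval[OF f_deriv(2)[OF r(1)] DERIV_minus[OF DERIV_ratio[OF r1]] r(2,3) assms f_inner(2)])
qed

lemma f'_outer:
  assumes "r \<in> {\<delta> - \<epsilon>/2..\<delta>}"
  shows "f1' r = 0" "f2' r = 2 * r / (1 - r\<^sup>2)\<^sup>2"
proof -
  have r1: "r\<^sup>2 \<noteq> 1" using assms \<delta> \<epsilon> power_strict_mono[of r 1 2] by auto
  have r: "r \<in> {0..\<delta>}" "{\<delta> - \<epsilon>/2..\<delta>} \<subseteq> {0..\<delta>}" "\<delta> - \<epsilon>/2 < \<delta>" using assms \<epsilon> \<delta> by auto
  show "f1' r = 0"
    by (rule has_real_derivative_unique_subinterval[OF f_deriv(1)[OF r(1)] DERIV_const r(2,3) assms f_outer(1)])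
  show "f2' r = 2 * r / (1 - r\<^sup>2)\<^sup>2"
    by (rule has_real_derivative_unique_subinterval[OF f_deriv(2)[OF r(1)] DERIV_ratio[OF r1] r(2,3) assms f_outer(2)])
qed

definition f1_breaks :: "real set" where "f1_breaks = {\<epsilon>/2, \<epsilon>, \<delta> - \<epsilon>, \<delta> - \<epsilon>/2}"
definition f2_breaks :: "real set" where
  "f2_breaks = {\<epsilon>/2, \<epsilon>, \<delta>/2 - \<epsilon>, \<delta>/2, \<delta>/2 + \<epsilon>, \<delta> - \<epsilon>, \<delta> - \<epsilon>/2}"

lemma profile_piece:
  assumes "piecewise_linear_on (\<epsilon>/2) (\<delta> - \<epsilon>/2) h" "continuous_on {0..\<delta>} h"
    "\<And>r. r \<in> {0..\<delta>} \<Longrightarrow> (f has_real_derivative h r) (at r within {0..\<delta>})"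
    "\<And>r. r \<in> {0..\<delta>} - B \<Longrightarrow> h differentiable (at r within {0..\<delta>})"
    and xy: "\<epsilon>/2 \<le> x" "x < y" "y \<le> \<delta> - \<epsilon>/2" "{x<..<y} \<inter> B = {}"
  obtains m k where "\<forall>r\<in>{x..y}. h r = m * r + k" "\<forall>r\<in>{x..y}. f r = f x + (h x + h r) / 2 * (r - x)"
proof -
  have sub: "{x..y} \<subseteq> {0..\<delta>}" using xy \<epsilon> by auto
  have "h differentiable (at r)" if "r \<in> {x<..<y}" for r
  proof -
    have "r \<in> {0..\<delta>} - B" "0 < r" "r < \<delta>" using that xy \<epsilon> by auto
    then show ?thesis using assms(4) at_within_Icc_at[of 0 r \<delta>] by metis
  qed
  moreover have "continuous_on {x..y} h" using assms(2) sub continuous_on_subset by blast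
  ultimately obtain m k where mk: "\<And>r. r \<in> {x..y} \<Longrightarrow> h r = m * r + k"
    using piecewise_linear_on_imp_affine[OF assms(1) xy(1-3)] by metis
  have "(f has_real_derivative h r) (at r within {x..y})" if "r \<in> {x..y}" for r
    using that sub assms(3) has_field_derivative_subset by blast
  from affine_antiderivative[OF this mk] show ?thesis using that mk by blast
qed

lemma f1_piece:
  assumes "\<epsilon>/2 \<le> x" "x < y" "y \<le> \<delta> - \<epsilon>/2" "{x<..<y} \<inter> f1_breaks = {}"
  obtains m k where "\<forall>r\<in>{x..y}. f1' r = m * r + k" "\<forall>r\<in>{x..y}. f1 r = f1 x + (f1' x + f1' r) / 2 * (r - x)"
proof -
  have 1: "piecewise_linear_on (\<epsilon>/2) (\<delta> - \<epsilon>/2) f1'"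
    and 2: "\<And>r. r \<in> {0..\<delta>} - f1_breaks \<Longrightarrow> f1' differentiable (at r within {0..\<delta>})"
    using profile unfolding twist_profile_def f1_breaks_def by blast+
  show ?thesis by (rule profile_piece[OF 1 f'_continuous(1) f_deriv(1) 2 assms]) (assumption, assumption, rule that)
qed

lemma f2_piece:
  assumes "\<epsilon>/2 \<le> x" "x < y" "y \<le> \<delta> - \<epsilon>/2" "{x<..<y} \<inter> f2_breaks = {}"
  obtains m k where "\<forall>r\<in>{x..y}. f2' r = m * r + k" "\<forall>r\<in>{x..y}. f2 r = f2 x + (f2' x + f2' r) / 2 * (r - x)"
proof -
  have 1: "piecewise_linear_on (\<epsilon>/2) (\<delta> - \<epsilon>/2) f2'"
    and 2: "\<And>r. r \<in> {0..\<delta>} - f2_breaks \<Longrightarrow> f2' differentiable (at r within {0..\<delta>})"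
    using profile unfolding twist_profile_def f2_breaks_def by blast+
  show ?thesis by (rule profile_piece[OF 1 f'_continuous(2) f_deriv(2) 2 assms]) (assumption, assumption, rule that)
qed

text \<open>An edge of the polygon is parametrised by s in [0, 1] from either end, so that each
  piece can be measured from the end at which the values are known.\<close>

lemma interpolation:
  fixes f h :: "real \<Rightarrow> real"
  assumes mk: "\<forall>r\<in>{x..y}. h r = m * r + k"
    and f: "\<forall>r\<in>{x..y}. f r = f x + (h x + h r) / 2 * (r - x)"
    and xy: "x < y" and s: "s \<in> {0..1}"
  shows "h (x + s * (y - x)) = (1 - s) * h x + s * h y"
    and "f (x + s * (y - x)) = f x + ((2 - s) * h x + s * h y) / 2 * (s * (y - x))"
    and "h (y - s * (y - x)) = (1 - s) * h y + s * h x"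
    and "f (y - s * (y - x)) = f y - ((2 - s) * h y + s * h x) / 2 * (s * (y - x))"
proof -
  have b: "0 \<le> s * (y - x)" "s * (y - x) \<le> 1 * (y - x)"
    using s xy by (intro mult_nonneg_nonneg mult_right_mono; simp)+
  have "x + w \<in> {x..y} \<and> y - w \<in> {x..y}" if "0 \<le> w" "w \<le> 1 * (y - x)" for w using that by auto
  from this[OF b] have m1: "x + s * (y - x) \<in> {x..y}" and m2: "y - s * (y - x) \<in> {x..y}" by blast+
  have m3: "x \<in> {x..y}" "y \<in> {x..y}" using xy by auto
  note mk = mk[rule_format, OF m1] mk[rule_format, OF m2] mk[rule_format, OF m3(1)] mk[rule_format, OF m3(2)]
    and f = f[rule_format, OF m1] f[rule_format, OF m2] f[rule_format, OF m3(2)]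
  show 1: "h (x + s * (y - x)) = (1 - s) * h x + s * h y"
    unfolding mk by (simp add: algebra_simps)
  show 2: "h (y - s * (y - x)) = (1 - s) * h y + s * h x"
    unfolding mk by (simp add: algebra_simps)
  show "f (x + s * (y - x)) = f x + ((2 - s) * h x + s * h y) / 2 * (s * (y - x))"
    unfolding f(1) 1 by (simp add: algebra_simps)
  show "f (y - s * (y - x)) = f y - ((2 - s) * h y + s * h x) / 2 * (s * (y - x))"
    unfolding f(2) f(3) 2 by (simp add: field_simps)
qed

lemma interpolate:
  fixes x y r :: real
  assumes "r \<in> {x..y}" "x < y"
  obtains s where "s \<in> {0..1}" "r = x + s * (y - x)" "r = y - (1 - s) * (y - x)"
proof -
  have "(r - x) / (y - x) \<in> {0..1}" "r = x + (r - x) / (y - x) * (y - x)" using assms by (auto simp: divide_simps)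
  then show ?thesis by (intro that[of "(r - x) / (y - x)"]) (auto simp: algebra_simps)
qed

lemma interpolate':
  fixes x y r :: real
  assumes "r \<in> {x..y}" "x < y"
  obtains s where "s \<in> {0..1}" "r = y - s * (y - x)"
proof -
  obtain s where "s \<in> {0..1}" "r = y - (1 - s) * (y - x)" using interpolate[OF assms] by metis
  then show ?thesis by (intro that[of "1 - s"]) auto
qed

lemma \<epsilon>_bounds: "10 * \<epsilon> \<le> \<delta>" "\<epsilon> \<le> 1/30"
  using \<delta> \<epsilon> by auto

text \<open>The graph of \<open>f1'\<close> is a trapezoid of height \<open>m\<close>, whose
  parallel sides have lengths \<delta> - \<epsilon> and \<delta> - 2 \<epsilon>. Its area is the
  total increase 2 of \<open>f1\<close>, and by symmetry \<open>f1\<close> vanishes at \<delta>/2.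
  The bound 4/17 follows because the mean length is at least 17/2 \<epsilon>.\<close>

lemma f1_shape:
  defines "m \<equiv> f1' \<epsilon>"
  shows "m * (\<delta> - 3/2 * \<epsilon>) = 2" "m > 0" "m * \<epsilon> \<le> 4/17"
    "\<And>s. s \<in> {0..1} \<Longrightarrow> f1' (\<epsilon>/2 + s * (\<epsilon>/2)) = m * s \<and> f1 (\<epsilon>/2 + s * (\<epsilon>/2)) = -1 + m * \<epsilon> * s\<^sup>2 / 4"
    "\<And>r. r \<in> {\<epsilon>..\<delta> - \<epsilon>} \<Longrightarrow> f1' r = m \<and> f1 r = m * (r - \<delta>/2)"
    "\<And>s. s \<in> {0..1} \<Longrightarrow> f1' (\<delta> - \<epsilon>/2 - s * (\<epsilon>/2)) = m * s \<and> f1 (\<delta> - \<epsilon>/2 - s * (\<epsilon>/2)) = 1 - m * \<epsilon> * s\<^sup>2 / 4"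
proof -
  have ord: "\<epsilon>/2 < \<epsilon>" "\<epsilon> < \<delta> - \<epsilon>" "\<delta> - \<epsilon> < \<delta> - \<epsilon>/2" using \<epsilon> \<epsilon>_bounds by auto
  have p1a: "\<epsilon>/2 \<le> \<epsilon>/2" and p1b: "\<epsilon>/2 < \<epsilon>" and p1c: "\<epsilon> \<le> \<delta> - \<epsilon>/2"
    and p1d: "{\<epsilon>/2<..<\<epsilon>} \<inter> f1_breaks = {}"
    using ord \<epsilon> by (auto simp: f1_breaks_def)
  have p2a: "\<epsilon>/2 \<le> \<epsilon>" and p2b: "\<epsilon> < \<delta> - \<epsilon>" and p2c: "\<delta> - \<epsilon> \<le> \<delta> - \<epsilon>/2"
    and p2d: "{\<epsilon><..<\<delta> - \<epsilon>} \<inter> f1_breaks = {}"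
    using ord \<epsilon> by (auto simp: f1_breaks_def)
  have p3a: "\<epsilon>/2 \<le> \<delta>-\<epsilon>" and p3b: "\<delta>-\<epsilon> < \<delta>-\<epsilon>/2" and p3c: "\<delta>-\<epsilon>/2 \<le> \<delta> - \<epsilon>/2"
    and p3d: "{\<delta>-\<epsilon><..<\<delta>-\<epsilon>/2} \<inter> f1_breaks = {}"
    using ord \<epsilon> by (auto simp: f1_breaks_def)
  obtain m1 k1 where p1: "\<forall>r\<in>{\<epsilon>/2..\<epsilon>}. f1' r = m1 * r + k1"
    "\<forall>r\<in>{\<epsilon>/2..\<epsilon>}. f1 r = f1 (\<epsilon>/2) + (f1' (\<epsilon>/2) + f1' r) / 2 * (r - \<epsilon>/2)"
    by (rule f1_piece[of "\<epsilon>/2" "\<epsilon>", OF p1a p1b p1c p1d], rule that, assumption+)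
  obtain m2 k2 where "\<forall>r\<in>{\<epsilon>..\<delta> - \<epsilon>}. f1' r = m2 * r + k2"
    and p2: "\<forall>r\<in>{\<epsilon>..\<delta>-\<epsilon>}. f1 r = f1 \<epsilon> + (f1' \<epsilon> + f1' r) / 2 * (r - \<epsilon>)"
    by (rule f1_piece[of "\<epsilon>" "\<delta> - \<epsilon>", OF p2a p2b p2c p2d], rule that, assumption+)
  obtain m3 k3 where p3: "\<forall>r\<in>{\<delta>-\<epsilon>..\<delta>-\<epsilon>/2}. f1' r = m3 * r + k3"
    "\<forall>r\<in>{\<delta>-\<epsilon>..\<delta>-\<epsilon>/2}. f1 r = f1 (\<delta>-\<epsilon>) + (f1' (\<delta>-\<epsilon>) + f1' r) / 2 * (r - (\<delta>-\<epsilon>))"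
    by (rule f1_piece[of "\<delta>-\<epsilon>" "\<delta>-\<epsilon>/2", OF p3a p3b p3c p3d], rule that, assumption+)
  have "f1' constant_on {\<epsilon>..\<delta> - \<epsilon>}" using profile unfolding twist_profile_def by blast
  then have c: "f1' r = m" if "r \<in> {\<epsilon>..\<delta> - \<epsilon>}" for r
    using that ord unfolding constant_on_def m_def by force
  have ends: "f1 (\<epsilon>/2) = -1" "f1' (\<epsilon>/2) = 0" "f1 (\<delta>-\<epsilon>/2) = 1" "f1' (\<delta>-\<epsilon>/2) = 0"
    using \<epsilon> by (simp_all add: f_inner f_outer f'_inner f'_outer)
  have m3: "f1' (\<delta> - \<epsilon>) = m" using c ord by auto
  note 1 = interpolation[OF p1 ord(1), simplified ends m_def[symmetric]]
  note 3 = interpolation[OF p3 ord(3), simplified ends m3]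
  have len: "\<epsilon> - \<epsilon>/2 = \<epsilon>/2" "\<delta> - \<epsilon>/2 - (\<delta> - \<epsilon>) = \<epsilon>/2" by auto
  have e1: "f1 \<epsilon> = -1 + m * \<epsilon> / 4" using 1(2)[of 1] by simp
  have e2: "f1 (\<delta> - \<epsilon>) = 1 - m * \<epsilon> / 4" using 3(4)[of 1] by simp
  have e3: "f1 (\<delta> - \<epsilon>) = f1 \<epsilon> + m * (\<delta> - 2 * \<epsilon>)" using p2[rule_format, of "\<delta> - \<epsilon>"] ord m3 by (simp add: m_def)
  show eq: "m * (\<delta> - 3/2 * \<epsilon>) = 2" using e1 e2 e3 by (simp add: algebra_simps)
  have "0 < \<delta> - 3/2 * \<epsilon>" using \<epsilon>_bounds \<epsilon> by simp
  then show pos: "m > 0" using zero_less_mult_pos2[of m "\<delta> - 3/2 * \<epsilon>"] eq by simp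
  have "m * (17/2 * \<epsilon>) \<le> m * (\<delta> - 3/2 * \<epsilon>)" using pos \<epsilon>_bounds by (intro mult_left_mono) auto
  then show "m * \<epsilon> \<le> 4/17" using eq by simp
  show "f1' (\<epsilon>/2 + s * (\<epsilon>/2)) = m * s \<and> f1 (\<epsilon>/2 + s * (\<epsilon>/2)) = -1 + m * \<epsilon> * s\<^sup>2 / 4" if "s \<in> {0..1}" for s
    using 1(1,2)[OF that] by (simp add: len power2_eq_square mult_ac)
  show "f1' r = m \<and> f1 r = m * (r - \<delta>/2)" if "r \<in> {\<epsilon>..\<delta> - \<epsilon>}" for r
    using p2[rule_format, OF that] eq unfolding c[OF that] e1 m_def[symmetric] by (simp add: algebra_simps add_divide_distrib)
  show "f1' (\<delta> - \<epsilon>/2 - s * (\<epsilon>/2)) = m * s \<and> f1 (\<delta> - \<epsilon>/2 - s * (\<epsilon>/2)) = 1 - m * \<epsilon> * s\<^sup>2 / 4" if "s \<in> {0..1}" for s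
    using 3(3,4)[OF that] by (simp add: len power2_eq_square mult_ac)
qed

text \<open>On each side of \<delta>/2 the area under \<open>f2'\<close> is the prescribed change of
  \<open>f2\<close>. The edge of height \<open>n\<close> or n' and the sloping edges next to it
  contribute that height times the effective length \<delta>/2 - 5/4 \<epsilon>; the remaining terms
  \<open>\<sigma> * \<epsilon> / 4\<close> and \<open>b\<close>, or their counterparts on the other
  side, are small. This determines \<open>n\<close> and n' up to a small error.\<close>

lemma f2_shape:
  defines "n \<equiv> f2' \<epsilon>" and "n' \<equiv> f2' (\<delta> - \<epsilon>)"
    and "\<sigma> \<equiv> f2' (\<epsilon>/2)" and "\<sigma>' \<equiv> f2' (\<delta> - \<epsilon>/2)"
    and "b \<equiv> f2 (\<epsilon>/2)" and "b' \<equiv> f2 (\<delta> - \<epsilon>/2)"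
  shows "n \<le> -23" "23/9 \<le> n' * \<delta>/3" "- (n * \<epsilon>) \<le> 16/15 * C" "n' * \<epsilon> \<le> 4/15 * (4 * C + 1/8)"
    "-(n * (\<delta>/2 - \<epsilon>)) \<ge> 3"
    "\<sigma> < 0" "\<sigma>' > 0" "b < 0" "0 < b'" "b' \<le> 1/8"
    "\<And>s. s \<in> {0..1} \<Longrightarrow> f2' (\<epsilon>/2 + s * (\<epsilon>/2)) = (1 - s) * \<sigma> + s * n \<and>
      f2 (\<epsilon>/2 + s * (\<epsilon>/2)) = b + ((2 - s) * \<sigma> + s * n) / 2 * (s * (\<epsilon>/2))"
    "\<And>r. r \<in> {\<epsilon>..\<delta>/2 - \<epsilon>} \<Longrightarrow> f2' r = n \<and> f2 r = f2 \<epsilon> + n * (r - \<epsilon>)"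
    "\<And>s. s \<in> {0..1} \<Longrightarrow> f2' (\<delta>/2 - s * \<epsilon>) = n * s \<and> f2 (\<delta>/2 - s * \<epsilon>) = -4 * C - n * \<epsilon> * s\<^sup>2 / 2"
    "\<And>s. s \<in> {0..1} \<Longrightarrow> f2' (\<delta>/2 + s * \<epsilon>) = n' * s \<and> f2 (\<delta>/2 + s * \<epsilon>) = -4 * C + n' * \<epsilon> * s\<^sup>2 / 2"
    "\<And>r. r \<in> {\<delta>/2 + \<epsilon>..\<delta> - \<epsilon>} \<Longrightarrow> f2' r = n' \<and> f2 r = -4 * C + n' * \<epsilon> / 2 + n' * (r - \<delta>/2 - \<epsilon>)"
    "\<And>s. s \<in> {0..1} \<Longrightarrow> f2' (\<delta> - \<epsilon>/2 - s * (\<epsilon>/2)) = (1 - s) * \<sigma>' + s * n' \<and>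
      f2 (\<delta> - \<epsilon>/2 - s * (\<epsilon>/2)) = b' - ((2 - s) * \<sigma>' + s * n') / 2 * (s * (\<epsilon>/2))"
proof -
  have ord: "\<epsilon>/2 < \<epsilon>" "\<epsilon> < \<delta>/2 - \<epsilon>" "\<delta>/2 - \<epsilon> < \<delta>/2" "\<delta>/2 < \<delta>/2 + \<epsilon>" "\<delta>/2 + \<epsilon> < \<delta> - \<epsilon>"
    "\<delta> - \<epsilon> < \<delta> - \<epsilon>/2" using \<epsilon> \<epsilon>_bounds by auto
  have p1a: "\<epsilon>/2 \<le> \<epsilon>/2" and p1b: "\<epsilon>/2 < \<epsilon>" and p1c: "\<epsilon> \<le> \<delta> - \<epsilon>/2"
    and p1d: "{\<epsilon>/2<..<\<epsilon>} \<inter> f2_breaks = {}"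
    using ord \<epsilon> by (auto simp: f2_breaks_def)
  have p2a: "\<epsilon>/2 \<le> \<epsilon>" and p2b: "\<epsilon> < \<delta>/2 - \<epsilon>" and p2c: "\<delta>/2 - \<epsilon> \<le> \<delta> - \<epsilon>/2"
    and p2d: "{\<epsilon><..<\<delta>/2 - \<epsilon>} \<inter> f2_breaks = {}"
    using ord \<epsilon> by (auto simp: f2_breaks_def)
  have p3a: "\<epsilon>/2 \<le> \<delta>/2-\<epsilon>" and p3b: "\<delta>/2-\<epsilon> < \<delta>/2" and p3c: "\<delta>/2 \<le> \<delta> - \<epsilon>/2"
    and p3d: "{\<delta>/2-\<epsilon><..<\<delta>/2} \<inter> f2_breaks = {}"
    using ord \<epsilon> by (auto simp: f2_breaks_def)
  have p4a: "\<epsilon>/2 \<le> \<delta>/2" and p4b: "\<delta>/2 < \<delta>/2+\<epsilon>" and p4c: "\<delta>/2+\<epsilon> \<le> \<delta> - \<epsilon>/2"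
    and p4d: "{\<delta>/2<..<\<delta>/2+\<epsilon>} \<inter> f2_breaks = {}"
    using ord \<epsilon> by (auto simp: f2_breaks_def)
  have p5a: "\<epsilon>/2 \<le> \<delta>/2+\<epsilon>" and p5b: "\<delta>/2+\<epsilon> < \<delta> - \<epsilon>" and p5c: "\<delta> - \<epsilon> \<le> \<delta> - \<epsilon>/2"
    and p5d: "{\<delta>/2+\<epsilon><..<\<delta> - \<epsilon>} \<inter> f2_breaks = {}"
    using ord \<epsilon> by (auto simp: f2_breaks_def)
  have p6a: "\<epsilon>/2 \<le> \<delta>-\<epsilon>" and p6b: "\<delta>-\<epsilon> < \<delta>-\<epsilon>/2" and p6c: "\<delta>-\<epsilon>/2 \<le> \<delta> - \<epsilon>/2"
    and p6d: "{\<delta>-\<epsilon><..<\<delta>-\<epsilon>/2} \<inter> f2_breaks = {}"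
    using ord \<epsilon> by (auto simp: f2_breaks_def)
  obtain m1 k1 where p1: "\<forall>r\<in>{\<epsilon>/2..\<epsilon>}. f2' r = m1 * r + k1"
    "\<forall>r\<in>{\<epsilon>/2..\<epsilon>}. f2 r = f2 (\<epsilon>/2) + (f2' (\<epsilon>/2) + f2' r) / 2 * (r - \<epsilon>/2)"
    by (rule f2_piece[of "\<epsilon>/2" "\<epsilon>", OF p1a p1b p1c p1d], rule that, assumption+)
  obtain m2 k2 where "\<forall>r\<in>{\<epsilon>..\<delta>/2 - \<epsilon>}. f2' r = m2 * r + k2"
    and p2: "\<forall>r\<in>{\<epsilon>..\<delta>/2-\<epsilon>}. f2 r = f2 \<epsilon> + (f2' \<epsilon> + f2' r) / 2 * (r - \<epsilon>)"
    by (rule f2_piece[of "\<epsilon>" "\<delta>/2 - \<epsilon>", OF p2a p2b p2c p2d], rule that, assumption+)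
  obtain m3 k3 where p3: "\<forall>r\<in>{\<delta>/2-\<epsilon>..\<delta>/2}. f2' r = m3 * r + k3"
    "\<forall>r\<in>{\<delta>/2-\<epsilon>..\<delta>/2}. f2 r = f2 (\<delta>/2-\<epsilon>) + (f2' (\<delta>/2-\<epsilon>) + f2' r) / 2 * (r - (\<delta>/2-\<epsilon>))"
    by (rule f2_piece[of "\<delta>/2-\<epsilon>" "\<delta>/2", OF p3a p3b p3c p3d], rule that, assumption+)
  obtain m4 k4 where p4: "\<forall>r\<in>{\<delta>/2..\<delta>/2+\<epsilon>}. f2' r = m4 * r + k4"
    "\<forall>r\<in>{\<delta>/2..\<delta>/2+\<epsilon>}. f2 r = f2 (\<delta>/2) + (f2' (\<delta>/2) + f2' r) / 2 * (r - \<delta>/2)"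
    by (rule f2_piece[of "\<delta>/2" "\<delta>/2+\<epsilon>", OF p4a p4b p4c p4d], rule that, assumption+)
  obtain m5 k5 where "\<forall>r\<in>{\<delta>/2+\<epsilon>..\<delta>-\<epsilon>}. f2' r = m5 * r + k5"
    and p5: "\<forall>r\<in>{\<delta>/2+\<epsilon>..\<delta>-\<epsilon>}. f2 r = f2 (\<delta>/2+\<epsilon>) + (f2' (\<delta>/2+\<epsilon>) + f2' r) / 2 * (r - (\<delta>/2+\<epsilon>))"
    by (rule f2_piece[of "\<delta>/2+\<epsilon>" "\<delta> - \<epsilon>", OF p5a p5b p5c p5d], rule that, assumption+)
  obtain m6 k6 where p6: "\<forall>r\<in>{\<delta>-\<epsilon>..\<delta>-\<epsilon>/2}. f2' r = m6 * r + k6"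
    "\<forall>r\<in>{\<delta>-\<epsilon>..\<delta>-\<epsilon>/2}. f2 r = f2 (\<delta>-\<epsilon>) + (f2' (\<delta>-\<epsilon>) + f2' r) / 2 * (r - (\<delta>-\<epsilon>))"
    by (rule f2_piece[of "\<delta>-\<epsilon>" "\<delta>-\<epsilon>/2", OF p6a p6b p6c p6d], rule that, assumption+)
  have "f2' constant_on {\<epsilon>..\<delta>/2 - \<epsilon>}" "f2' constant_on {\<delta>/2 + \<epsilon>..\<delta> - \<epsilon>}"
    using profile unfolding twist_profile_def by blast+
  then have c: "r \<in> {\<epsilon>..\<delta>/2 - \<epsilon>} \<Longrightarrow> f2' r = n" "r \<in> {\<delta>/2 + \<epsilon>..\<delta> - \<epsilon>} \<Longrightarrow> f2' r = n'" for r
    using ord unfolding constant_on_def n_def n'_def by force+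
  have mid: "f2 (\<delta>/2) = -4 * C" "f2' (\<delta>/2) = 0"
    using profile unfolding twist_profile_def by auto
  have n1: "f2' (\<delta>/2 - \<epsilon>) = n" "f2' (\<delta>/2 + \<epsilon>) = n'" using c ord by auto
  note 1 = interpolation[OF p1 ord(1), folded n_def \<sigma>_def b_def]
  note 3 = interpolation[OF p3 ord(3), simplified mid n1]
  note 4 = interpolation[OF p4 ord(4), simplified mid n1]
  note 6 = interpolation[OF p6 ord(6), folded n'_def \<sigma>'_def b'_def]
  have len: "\<epsilon> - \<epsilon>/2 = \<epsilon>/2" "\<delta> - \<epsilon>/2 - (\<delta> - \<epsilon>) = \<epsilon>/2" by auto
  show r1: "f2' (\<epsilon>/2 + s * (\<epsilon>/2)) = (1 - s) * \<sigma> + s * n \<and>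
      f2 (\<epsilon>/2 + s * (\<epsilon>/2)) = b + ((2 - s) * \<sigma> + s * n) / 2 * (s * (\<epsilon>/2))" if "s \<in> {0..1}" for s
    using 1(1,2)[OF that] unfolding len by blast
  show r2: "f2' r = n \<and> f2 r = f2 \<epsilon> + n * (r - \<epsilon>)" if "r \<in> {\<epsilon>..\<delta>/2 - \<epsilon>}" for r
    using p2[rule_format, OF that] c(1)[OF that] by (simp add: n_def)
  show r3: "f2' (\<delta>/2 - s * \<epsilon>) = n * s \<and> f2 (\<delta>/2 - s * \<epsilon>) = -4 * C - n * \<epsilon> * s\<^sup>2 / 2" if "s \<in> {0..1}" for s
    using 3(3,4)[OF that] by (simp add: power2_eq_square mult_ac)
  show r4: "f2' (\<delta>/2 + s * \<epsilon>) = n' * s \<and> f2 (\<delta>/2 + s * \<epsilon>) = -4 * C + n' * \<epsilon> * s\<^sup>2 / 2" if "s \<in> {0..1}" for s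
    using 4(1,2)[OF that] by (simp add: power2_eq_square mult_ac)
  have e4: "f2 (\<delta>/2 + \<epsilon>) = -4 * C + n' * \<epsilon> / 2" using r4[of 1] by simp
  show r5: "f2' r = n' \<and> f2 r = -4 * C + n' * \<epsilon> / 2 + n' * (r - \<delta>/2 - \<epsilon>)" if "r \<in> {\<delta>/2 + \<epsilon>..\<delta> - \<epsilon>}" for r
    using p5[rule_format, OF that] unfolding n1 c(2)[OF that] e4 by (simp add: algebra_simps)
  show r6: "f2' (\<delta> - \<epsilon>/2 - s * (\<epsilon>/2)) = (1 - s) * \<sigma>' + s * n' \<and>
      f2 (\<delta> - \<epsilon>/2 - s * (\<epsilon>/2)) = b' - ((2 - s) * \<sigma>' + s * n') / 2 * (s * (\<epsilon>/2))" if "s \<in> {0..1}" for s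
    using 6(3,4)[OF that] unfolding len by blast
  \<comment> \<open>All these bounds come from 1 - r^2 >= 8/9 for r <= 1/3.\<close>
  have sq: "0 < 1 - r\<^sup>2" "r\<^sup>2 / (1 - r\<^sup>2) \<le> 9/8 * r\<^sup>2" "2 * r / (1 - r\<^sup>2)\<^sup>2 \<le> 3 * r" "r\<^sup>2 \<le> r/3"
    "r\<^sup>2 / (1 - r\<^sup>2) \<le> 1/8" "2 * r / (1 - r\<^sup>2)\<^sup>2 \<le> 1" if "0 < r" "r \<le> 1/3" for r :: real
  proof -
    have "r\<^sup>2 \<le> (1/3)\<^sup>2" using that by (intro power_mono) auto
    then have 8: "8/9 \<le> 1 - r\<^sup>2" by (simp add: power2_eq_square)
    then show "0 < 1 - r\<^sup>2" by simp
    show r2: "r\<^sup>2 / (1 - r\<^sup>2) \<le> 9/8 * r\<^sup>2"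
      using frac_le[of "r\<^sup>2" "r\<^sup>2" "8/9" "1 - r\<^sup>2"] 8 by simp
    have "(8/9)\<^sup>2 \<le> (1 - r\<^sup>2)\<^sup>2" using 8 by (intro power_mono) auto
    then show r3: "2 * r / (1 - r\<^sup>2)\<^sup>2 \<le> 3 * r"
      using frac_le[of "2 * r" "2 * r" "2/3" "(1 - r\<^sup>2)\<^sup>2"] that by (simp add: power2_eq_square)
    show r4: "r\<^sup>2 \<le> r/3" using that by (simp add: power2_eq_square)
    show "r\<^sup>2 / (1 - r\<^sup>2) \<le> 1/8" using r2 r4 that by linarith
    show "2 * r / (1 - r\<^sup>2)\<^sup>2 \<le> 1" using r3 that by linarith
  qed
  have b: "b = - ((\<epsilon>/2)\<^sup>2 / (1 - (\<epsilon>/2)\<^sup>2))" "\<sigma> = - (2 * (\<epsilon>/2) / (1 - (\<epsilon>/2)\<^sup>2)\<^sup>2)"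
    "b' = (\<delta> - \<epsilon>/2)\<^sup>2 / (1 - (\<delta> - \<epsilon>/2)\<^sup>2)" "\<sigma>' = 2 * (\<delta> - \<epsilon>/2) / (1 - (\<delta> - \<epsilon>/2)\<^sup>2)\<^sup>2"
    unfolding b_def b'_def \<sigma>_def \<sigma>'_def using \<epsilon> f_inner(2)[of "\<epsilon>/2"] f'_inner(2)[of "\<epsilon>/2"]
      f_outer(2)[of "\<delta> - \<epsilon>/2"] f'_outer(2)[of "\<delta> - \<epsilon>/2"] by auto
  have x: "0 < \<epsilon>/2" "\<epsilon>/2 \<le> 1/3" "0 < \<delta> - \<epsilon>/2" "\<delta> - \<epsilon>/2 \<le> 1/3" using \<epsilon> \<epsilon>_bounds \<delta> by auto
  note sq1 = sq[OF x(1,2)] and sq2 = sq[OF x(3,4)]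
  have signs: "\<sigma> < 0" "\<sigma>' > 0" "b < 0" "0 < b'"
    unfolding b using sq1(1) sq2(1) x by auto
  have bnds: "- b \<le> 1/50" "- \<sigma> \<le> 1/10" "b' \<le> 1/8" "\<sigma>' \<le> 1"
    unfolding b using sq1(2-4) sq2(5,6) x \<epsilon>_bounds by linarith+
  have f2\<epsilon>: "f2 \<epsilon> = b + (\<sigma> + n) * \<epsilon> / 4" using r1[of 1] by simp
  have "f2 (\<delta>/2 - \<epsilon>) = f2 \<epsilon> + n * (\<delta>/2 - 2 * \<epsilon>)" using r2[of "\<delta>/2 - \<epsilon>"] ord by simp
  moreover have "f2 (\<delta>/2 - \<epsilon>) = -4 * C - n * \<epsilon> / 2" using r3[of 1] by simp
  ultimately have N: "n * (\<delta>/2 - 5/4 * \<epsilon>) = -4 * C - b - \<sigma> * \<epsilon> / 4"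
    unfolding f2\<epsilon> by (simp add: field_simps)
  have "f2 (\<delta> - \<epsilon>) = -4 * C + n' * \<epsilon> / 2 + n' * (\<delta>/2 - 2 * \<epsilon>)" using r5[of "\<delta> - \<epsilon>"] ord by simp
  moreover have "f2 (\<delta> - \<epsilon>) = b' - (\<sigma>' + n') * \<epsilon> / 4" using r6[of 1] by simp
  ultimately have N': "n' * (\<delta>/2 - 5/4 * \<epsilon>) = 4 * C + b' - \<sigma>' * \<epsilon> / 4"
    by (simp add: field_simps)
  have \<sigma>\<epsilon>: "- \<sigma> * \<epsilon> \<le> 1/10 * (1/30)" "0 \<le> - \<sigma> * \<epsilon>" "\<sigma>' * \<epsilon> \<le> 1 * (1/30)" "0 \<le> \<sigma>' * \<epsilon>"
    using mult_mono[OF bnds(2) \<epsilon>_bounds(2)] mult_mono[OF bnds(4) \<epsilon>_bounds(2)]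
      mult_nonneg_nonneg[of "- \<sigma>" \<epsilon>] mult_nonneg_nonneg[of \<sigma>' \<epsilon>] signs \<epsilon> by linarith+
  have N1: "n * (\<delta>/2 - 5/4 * \<epsilon>) \<le> -39/10" "- (n * (\<delta>/2 - 5/4 * \<epsilon>)) \<le> 4 * C"
    unfolding N using \<sigma>\<epsilon> bnds signs C by linarith+
  have N2: "n' * (\<delta>/2 - 5/4 * \<epsilon>) \<ge> 39/10" "n' * (\<delta>/2 - 5/4 * \<epsilon>) \<le> 4 * C + 1/8"
    unfolding N' using \<sigma>\<epsilon> bnds signs C by linarith+
  \<comment> \<open>The effective length lies between 15/4 \<epsilon> and 1/6. The lower bound
    yields the factors 16/15 and 4/15, and the upper bound turns 39/10 into 6 * 39/10 > 23; being at
    most \<delta>/2, the length also gives 2/3 * 39/10 > 23/9.\<close>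
  have w: "15/4 * \<epsilon> \<le> \<delta>/2 - 5/4 * \<epsilon>" "\<delta>/2 - 5/4 * \<epsilon> \<le> 1/6" "0 < \<delta>/2 - 5/4 * \<epsilon>" "\<delta>/2 - 5/4 * \<epsilon> \<le> \<delta>/2"
    "\<delta>/2 - 5/4 * \<epsilon> \<le> \<delta>/2 - \<epsilon>"
    using \<epsilon>_bounds \<epsilon> \<delta> by auto
  have n0: "n < 0" using N1(1) mult_nonneg_nonneg[of n "\<delta>/2 - 5/4 * \<epsilon>"] w(3) by linarith
  have n'0: "n' > 0" using N2(1) zero_less_mult_pos2[OF _ w(3), of n'] by linarith
  have "39/10 \<le> - n * (1/6)"
    using mult_left_mono[OF w(2), of "- n"] n0 N1(1) unfolding mult_minus_left by linarith
  then show "n \<le> -23" by simp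
  show "23/9 \<le> n' * \<delta>/3" using mult_left_mono[OF w(4), of n'] n'0 N2(1) by linarith
  show "- (n * \<epsilon>) \<le> 16/15 * C" using mult_left_mono[OF w(1), of "- n"] n0 N1(2) unfolding mult_minus_left by linarith
  have "n' * (15/4 * \<epsilon>) \<le> 4 * C + 1/8"
    using order_trans[OF mult_left_mono[OF w(1) less_imp_le[OF n'0]] N2(2)] .
  then show "n' * \<epsilon> \<le> 4/15 * (4 * C + 1/8)" by simp
  show "-(n * (\<delta>/2 - \<epsilon>)) \<ge> 3" using mult_left_mono_neg[OF w(5) less_imp_le[OF n0]] N1(1) by linarith
  show "\<sigma> < 0" "\<sigma>' > 0" "b < 0" "0 < b'" "b' \<le> 1/8" by (fact signs bnds(3))+
qed

text \<open>The corner pieces are parametrised away from \<epsilon>/2, from \<delta>/2 and from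
  \<delta> - \<epsilon>/2, in agreement with the formulas for \<open>f1\<close> and
  \<open>f2\<close>.\<close>

lemma regions:
  assumes "r \<in> {\<epsilon>/2..\<delta> - \<epsilon>/2}"
  obtains (1) s where "s \<in> {0..1}" "r = \<epsilon>/2 + s * (\<epsilon>/2)"
    | (2) "r \<in> {\<epsilon>..\<delta>/2 - \<epsilon>}"
    | (3) s where "s \<in> {0..1}" "r = \<delta>/2 - s * \<epsilon>"
    | (4) s where "s \<in> {0..1}" "r = \<delta>/2 + s * \<epsilon>"
    | (5) "r \<in> {\<delta>/2 + \<epsilon>..\<delta> - \<epsilon>}"
    | (6) s where "s \<in> {0..1}" "r = \<delta> - \<epsilon>/2 - s * (\<epsilon>/2)"
proof -
  consider "r \<in> {\<epsilon>/2..\<epsilon>}" | "r \<in> {\<epsilon>..\<delta>/2 - \<epsilon>}" | "r \<in> {\<delta>/2 - \<epsilon>..\<delta>/2}" | "r \<in> {\<delta>/2..\<delta>/2 + \<epsilon>}"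
    | "r \<in> {\<delta>/2 + \<epsilon>..\<delta> - \<epsilon>}" | "r \<in> {\<delta> - \<epsilon>..\<delta> - \<epsilon>/2}"
    using assms unfolding atLeastAtMost_iff by linarith
  then show ?thesis
  proof cases
    assume r: "r \<in> {\<epsilon>/2..\<epsilon>}"
    obtain s where "s \<in> {0..1}" "r = \<epsilon>/2 + s * (\<epsilon> - \<epsilon>/2)"
      by (rule interpolate[OF r]) (use \<epsilon> in auto)
    then show ?thesis using 1[of s] by simp
  next
    assume r: "r \<in> {\<delta>/2 - \<epsilon>..\<delta>/2}"
    obtain s where "s \<in> {0..1}" "r = \<delta>/2 - s * (\<delta>/2 - (\<delta>/2 - \<epsilon>))"
      by (rule interpolate'[OF r]) (use \<epsilon> in auto)
    then show ?thesis using 3[of s] by simp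
  next
    assume r: "r \<in> {\<delta>/2..\<delta>/2 + \<epsilon>}"
    obtain s where "s \<in> {0..1}" "r = \<delta>/2 + s * (\<delta>/2 + \<epsilon> - \<delta>/2)"
      by (rule interpolate[OF r]) (use \<epsilon> in auto)
    then show ?thesis using 4[of s] by simp
  next
    assume r: "r \<in> {\<delta> - \<epsilon>..\<delta> - \<epsilon>/2}"
    obtain s where "s \<in> {0..1}" "r = \<delta> - \<epsilon>/2 - s * (\<delta> - \<epsilon>/2 - (\<delta> - \<epsilon>))"
      by (rule interpolate'[OF r]) (use \<epsilon> in auto)
    then show ?thesis using 6[of s] by simp
  qed (use 2 5 in auto)
qed

end

text \<open>Between \<open>\<epsilon>/2\<close> and \<open>\<delta> - \<epsilon>/2\<close> the graphs of \<open>f1'\<close> and \<open>f2'\<close> are polygons: \<open>m\<close> and \<open>n, n'\<close> are the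
  heights of their horizontal edges, and \<open>b, \<sigma>\<close> and \<open>b', \<sigma>'\<close> are the values of \<open>f2, f2'\<close> at the two ends.\<close>

locale profile_shape = profile +
  fixes m n n' \<sigma> \<sigma>' b b' :: real
  assumes m: "m * (\<delta> - 3/2 * \<epsilon>) = 2" "m > 0" "m * \<epsilon> \<le> 4/17"
    and f11: "\<And>s. s \<in> {0..1} \<Longrightarrow> f1' (\<epsilon>/2 + s * (\<epsilon>/2)) = m * s \<and> f1 (\<epsilon>/2 + s * (\<epsilon>/2)) = -1 + m * \<epsilon> * s\<^sup>2 / 4"
    and f12: "\<And>r. r \<in> {\<epsilon>..\<delta> - \<epsilon>} \<Longrightarrow> f1' r = m \<and> f1 r = m * (r - \<delta>/2)"
    and f13: "\<And>s. s \<in> {0..1} \<Longrightarrow> f1' (\<delta> - \<epsilon>/2 - s * (\<epsilon>/2)) = m * s \<and> f1 (\<delta> - \<epsilon>/2 - s * (\<epsilon>/2)) = 1 - m * \<epsilon> * s\<^sup>2 / 4"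
    and n: "n \<le> -23" "23/9 \<le> n' * \<delta>/3" "- (n * \<epsilon>) \<le> 16/15 * C" "n' * \<epsilon> \<le> 4/15 * (4 * C + 1/8)"
    "-(n * (\<delta>/2 - \<epsilon>)) \<ge> 3"
    and signs: "\<sigma> < 0" "\<sigma>' > 0" "b < 0" "0 < b'" "b' \<le> 1/8"
    and f21: "\<And>s. s \<in> {0..1} \<Longrightarrow> f2' (\<epsilon>/2 + s * (\<epsilon>/2)) = (1 - s) * \<sigma> + s * n \<and>
      f2 (\<epsilon>/2 + s * (\<epsilon>/2)) = b + ((2 - s) * \<sigma> + s * n) / 2 * (s * (\<epsilon>/2))"
    and f22: "\<And>r. r \<in> {\<epsilon>..\<delta>/2 - \<epsilon>} \<Longrightarrow> f2' r = n \<and> f2 r = f2 \<epsilon> + n * (r - \<epsilon>)"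
    and f23: "\<And>s. s \<in> {0..1} \<Longrightarrow> f2' (\<delta>/2 - s * \<epsilon>) = n * s \<and> f2 (\<delta>/2 - s * \<epsilon>) = -4 * C - n * \<epsilon> * s\<^sup>2 / 2"
    and f24: "\<And>s. s \<in> {0..1} \<Longrightarrow> f2' (\<delta>/2 + s * \<epsilon>) = n' * s \<and> f2 (\<delta>/2 + s * \<epsilon>) = -4 * C + n' * \<epsilon> * s\<^sup>2 / 2"
    and f25: "\<And>r. r \<in> {\<delta>/2 + \<epsilon>..\<delta> - \<epsilon>} \<Longrightarrow> f2' r = n' \<and> f2 r = -4 * C + n' * \<epsilon> / 2 + n' * (r - \<delta>/2 - \<epsilon>)"
    and f26: "\<And>s. s \<in> {0..1} \<Longrightarrow> f2' (\<delta> - \<epsilon>/2 - s * (\<epsilon>/2)) = (1 - s) * \<sigma>' + s * n' \<and>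
      f2 (\<delta> - \<epsilon>/2 - s * (\<epsilon>/2)) = b' - ((2 - s) * \<sigma>' + s * n') / 2 * (s * (\<epsilon>/2))"
begin

section \<open>Sign inequalities for the profile\<close>

lemma f1'_nonneg:
  assumes "r \<in> {0..\<delta>}"
  shows "0 \<le> f1' r"
proof -
  consider "r \<in> {0..\<epsilon>/2}" | "r \<in> {\<delta> - \<epsilon>/2..\<delta>}" | "r \<in> {\<epsilon>/2..\<epsilon>}" | "r \<in> {\<epsilon>..\<delta> - \<epsilon>}" | "r \<in> {\<delta> - \<epsilon>..\<delta> - \<epsilon>/2}"
    using assms unfolding atLeastAtMost_iff by linarith
  then show ?thesis
  proof cases
    case 3
    then obtain s where "s \<in> {0..1}" "r = \<epsilon>/2 + s * (\<epsilon> - \<epsilon>/2)" by (rule interpolate) (use \<epsilon> in auto)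
    then show ?thesis using m(2) f11 by simp
  next
    case 5
    then obtain s where "s \<in> {0..1}" "r = \<delta> - \<epsilon>/2 - s * (\<delta> - \<epsilon>/2 - (\<delta> - \<epsilon>))" by (rule interpolate') (use \<epsilon> in auto)
    then show ?thesis using m(2) f13 by simp
  qed (use m(2) f12 f'_inner f'_outer in auto)
qed

text \<open>On the pieces next to the two collars \<open>f1\<close> is close to -1 or 1 and the
  product f1 f2' dominates. On both sides of \<delta>/2 this product is nonnegative and f2 + r is
  negative. On the two long edges both functions are affine and the expression is computed
  exactly.\<close>

lemma contact_inequality_pos:
  assumes r: "r \<in> {\<epsilon>/2..\<delta> - \<epsilon>/2}"
  shows "0 < f1 r * f2' r - f1' r * (f2 r + r)"
proof -
  have n': "0 < n'" using n(2) \<delta>(1) zero_less_mult_pos2[of n' \<delta>] by simp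
  have sq: "0 \<le> s\<^sup>2" "s\<^sup>2 \<le> 1" "0 \<le> s" "s \<le> 1" if "s \<in> {0..1}" for s :: real
    using that by (auto simp: power_le_one)
  have sw: "(1 - s) * x + s * y > 0" if "s \<in> {0..1}" "x > 0" "y > 0" for s x y :: real
  proof (cases "s = 0")
    case False
    then have "0 < s * y" "0 \<le> (1 - s) * x" using that by auto
    then show ?thesis by linarith
  qed (use that in simp)
  have r3: "r \<le> 1/3" using r \<delta> \<epsilon> by auto
  show ?thesis
    using r
  proof (cases rule: regions)
    case (1 s)
    \<comment> \<open>Here f1 <= -16/17, and since f2 <= 0 the subtracted term is at most s m
      \<epsilon> <= 4/17 s. Both it and the part s n of f2' are linear in \<open>s\<close>, so n <=
      -23 suffices; the part (1 - s) \<sigma> keeps the inequality strict at s = 0.\<close>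
    have "m * \<epsilon> * s\<^sup>2 \<le> 4/17 * 1" using m sq[OF 1(1)] \<epsilon> by (intro mult_mono) auto
    then have f1: "f1 r \<le> - 16/17" using f11[OF 1(1)] 1(2) by simp
    have "(2 - s) * \<sigma> + s * n \<le> 0" using mult_nonneg_nonpos[of "2 - s" \<sigma>] mult_nonneg_nonpos[of s n] sq[OF 1(1)] signs n by linarith
    then have "((2 - s) * \<sigma> + s * n) / 2 * (s * (\<epsilon>/2)) \<le> 0" using sq[OF 1(1)] \<epsilon> by (intro mult_nonpos_nonneg) auto
    then have "f2 r \<le> 0" unfolding 1(2) f21[OF 1(1), THEN conjunct2] using signs(3) by linarith
    moreover have r\<epsilon>: "r \<le> \<epsilon>" using 1(2) mult_right_mono[of s 1 "\<epsilon>/2"] sq(4)[OF 1(1)] \<epsilon>(1) by linarith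
    ultimately have "m * s * (f2 r + r) \<le> m * s * \<epsilon>" using m sq[OF 1(1)] by (intro mult_left_mono) auto
    also have "m * s * \<epsilon> = s * (m * \<epsilon>)" by simp
    also have "\<dots> \<le> s * (4/17)" using m sq[OF 1(1)] by (intro mult_left_mono) auto
    finally have i1: "m * s * (f2 r + r) \<le> s * (4/17)" .
    have f2': "f2' r = - ((1 - s) * (- \<sigma>) + s * (- n))" using f21[OF 1(1)] 1(2) by simp
    have "0 \<le> (1 - s) * (- \<sigma>) + s * (- n)" using sq[OF 1(1)] signs n by (intro add_nonneg_nonneg mult_nonneg_nonneg) auto
    then have "16/17 * ((1 - s) * (- \<sigma>) + s * (- n)) \<le> - f1 r * ((1 - s) * (- \<sigma>) + s * (- n))"
      using f1 by (intro mult_right_mono) auto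
    then have "16/17 * ((1 - s) * (- \<sigma>) + s * (- n)) \<le> f1 r * f2' r"
      unfolding f2' by (simp only: mult_minus_left mult_minus_right)
    moreover have "0 < (1 - s) * (16/17 * (- \<sigma>)) + s * (16/17 * (- n) - 4/17)" by (intro sw[OF 1(1)]) (use signs n in simp_all)
    moreover have "f1' r * (f2 r + r) \<le> s * (4/17)" using i1 f11[OF 1(1)] 1(2) by simp
    moreover have "16/17 * ((1 - s) * (- \<sigma>) + s * (- n))
        = ((1 - s) * (16/17 * (- \<sigma>)) + s * (16/17 * (- n) - 4/17)) + s * (4/17)"
      by (simp add: field_simps)
    ultimately show ?thesis by linarith
  next
    case 2
    have e: "f1' r = m" "f1 r = m * (r - \<delta>/2)" "f2' r = n" "f2 r = f2 \<epsilon> + n * (r - \<epsilon>)"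
      using f12[of r] f22[OF 2] 2 \<epsilon> \<epsilon>_bounds by auto
    have "f2 \<epsilon> = b + (\<sigma> + n) * \<epsilon> / 4" using f21[of 1] by simp
    moreover have "(\<sigma> + n) * \<epsilon> < 0" using signs n \<epsilon> by (intro mult_neg_pos) auto
    ultimately have "f2 \<epsilon> < 0" using signs by simp
    moreover have "r \<le> 1/3" using r \<delta> \<epsilon> by auto
    \<comment> \<open>The terms \<open>m * n * r\<close> from f1 f2' and from f1' f2 cancel, and
      \<open>m\<close> times this quantity remains. The same cancellation occurs on the other long
      edge.\<close>
    ultimately have "0 < - (n * (\<delta>/2 - \<epsilon>)) - f2 \<epsilon> - r" using n(5) by linarith
    from mult_pos_pos[OF m(2) this] show ?thesis unfolding e by (simp add: algebra_simps)
  next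
    case (3 s)
    have w: "0 \<le> s * \<epsilon>" "s * \<epsilon> \<le> 1 * \<epsilon>" using sq[OF 3(1)] \<epsilon> by (auto intro!: mult_right_mono)
    have "\<delta>/2 - w \<in> {\<epsilon>..\<delta> - \<epsilon>} \<and> \<delta>/2 - w - \<delta>/2 \<le> 0" if "0 \<le> w" "w \<le> 1 * \<epsilon>" for w
      using that \<epsilon>_bounds by auto
    from this[OF w] have rr: "r \<in> {\<epsilon>..\<delta> - \<epsilon>}" "r - \<delta>/2 \<le> 0" unfolding 3(2) by blast+
    have e: "f1' r = m" "f1 r = m * (r - \<delta>/2)" "f2' r = n * s" "f2 r = -4 * C - n * \<epsilon> * s\<^sup>2 / 2"
      using f12[OF rr(1)] f23[OF 3(1)] 3 by auto
    have "(- (n * \<epsilon>)) * s\<^sup>2 \<le> (16/15 * C) * 1"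
      using n sq[OF 3(1)] C \<epsilon> by (intro mult_mono) auto
    then have "f2 r + r < 0" using C r3 e(4) unfolding mult_minus_left by linarith
    then have "0 < - (m * (f2 r + r))" using m by (simp add: mult_pos_neg)
    moreover have "0 \<le> m * (r - \<delta>/2) * (n * s)"
      using rr(2) m n sq[OF 3(1)] by (intro mult_nonpos_nonpos mult_nonneg_nonpos mult_nonpos_nonneg) auto
    ultimately show ?thesis unfolding e(1-3) by linarith
  next
    case (4 s)
    have w: "0 \<le> s * \<epsilon>" "s * \<epsilon> \<le> 1 * \<epsilon>" using sq[OF 4(1)] \<epsilon> by (auto intro!: mult_right_mono)
    have "\<delta>/2 + w \<in> {\<epsilon>..\<delta> - \<epsilon>} \<and> \<delta>/2 + w - \<delta>/2 \<ge> 0" if "0 \<le> w" "w \<le> 1 * \<epsilon>" for w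
      using that \<epsilon>_bounds by auto
    from this[OF w] have rr: "r \<in> {\<epsilon>..\<delta> - \<epsilon>}" "r - \<delta>/2 \<ge> 0" unfolding 4(2) by blast+
    have e: "f1' r = m" "f1 r = m * (r - \<delta>/2)" "f2' r = n' * s" "f2 r = -4 * C + n' * \<epsilon> * s\<^sup>2 / 2"
      using f12[OF rr(1)] f24[OF 4(1)] 4 by auto
    have X: "(n' * \<epsilon>) * s\<^sup>2 \<le> (4/15 * (4 * C + 1/8)) * 1"
      by (rule mult_mono[OF n(4) sq(2)[OF 4(1)]]) (use C in simp_all)
    have "- 4 * C + X / 2 + r < 0" if "X \<le> (4/15 * (4 * C + 1/8)) * 1" for X
      using that C r3 by (simp add: field_simps)
    from this[OF X] have "f2 r + r < 0" unfolding e .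
    then have "0 < - (m * (f2 r + r))" using m by (simp add: mult_pos_neg)
    moreover have "0 \<le> m * (r - \<delta>/2) * (n' * s)"
      using rr(2) m n' sq[OF 4(1)] by (intro mult_nonneg_nonneg) auto
    ultimately show ?thesis unfolding e(1-3) by linarith
  next
    case 5
    have e: "f1' r = m" "f1 r = m * (r - \<delta>/2)" "f2' r = n'" "f2 r = -4 * C + n' * \<epsilon> / 2 + n' * (r - \<delta>/2 - \<epsilon>)"
      using f12[of r] f25[OF 5] 5 \<epsilon> \<epsilon>_bounds by auto
    have "0 \<le> n' * \<epsilon>" using n' \<epsilon> by simp
    then have "0 < 4 * C + n' * \<epsilon> / 2 - r" using C r3 by linarith
    from mult_pos_pos[OF m(2) this] show ?thesis unfolding e by (simp add: algebra_simps)
  next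
    case (6 s)
    have "m * \<epsilon> * s\<^sup>2 \<le> 4/17 * 1" using m sq[OF 6(1)] \<epsilon> by (intro mult_mono) auto
    then have f1: "16/17 \<le> f1 r" using f13[OF 6(1)] 6(2) by simp
    have "0 \<le> (2 - s) * \<sigma>' + s * n'" using sq[OF 6(1)] signs n' by (intro add_nonneg_nonneg mult_nonneg_nonneg) auto
    then have "0 \<le> ((2 - s) * \<sigma>' + s * n') / 2 * (s * (\<epsilon>/2))" using sq[OF 6(1)] \<epsilon> by (intro mult_nonneg_nonneg) auto
    moreover have "f2 r = b' - ((2 - s) * \<sigma>' + s * n') / 2 * (s * (\<epsilon>/2))"
      using f26[OF 6(1)] unfolding 6(2) by blast
    \<comment> \<open>The bound is 1/8 + 1/3, from \<open>b'\<close> and from r <= 1/3.\<close>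
    ultimately have "f2 r + r \<le> 11/24" using signs(5) r3 by linarith
    then have "m * s * (f2 r + r) \<le> m * s * (11/24)" using m sq[OF 6(1)] by (intro mult_left_mono) auto
    then have "m * s * (f2 r + r) \<le> s * (m * (11/24))" by (simp only: mult_ac)
    moreover have "f1' r = m * s" using f13[OF 6(1)] unfolding 6(2) by blast
    ultimately have i1: "f1' r * (f2 r + r) \<le> s * (m * (11/24))" by simp
    have "0 \<le> (1 - s) * \<sigma>' + s * n'" using sq[OF 6(1)] signs n' by (intro add_nonneg_nonneg mult_nonneg_nonneg) auto
    then have "16/17 * ((1 - s) * \<sigma>' + s * n') \<le> f1 r * ((1 - s) * \<sigma>' + s * n')"
      using f1 by (intro mult_right_mono) auto
    moreover have "f2' r = (1 - s) * \<sigma>' + s * n'" using f26[OF 6(1)] unfolding 6(2) by blast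
    ultimately have i2: "16/17 * ((1 - s) * \<sigma>' + s * n') \<le> f1 r * f2' r" by simp
    \<comment> \<open>Close to the outer collar f2 + r is positive and must be beaten by the slope
      of \<open>f2\<close>: m \<delta> <= 40/17, whereas n' \<delta> >= 23/3.\<close>
    have "m * (17/20 * \<delta>) \<le> m * (\<delta> - 3/2 * \<epsilon>)" using m(2) \<epsilon>_bounds by (intro mult_left_mono) auto
    then have "m * \<delta> \<le> 40/17" using m(1) by simp
    then have "m * \<delta> < n' * \<delta>" using n(2) by linarith
    then have "m < n'" using \<delta>(1) by simp
    then have "0 < 16/17 * n' - m * (11/24)" using m(2) by linarith
    then have "0 < (1 - s) * (16/17 * \<sigma>') + s * (16/17 * n' - m * (11/24))"
      by (intro sw[OF 6(1)]) (use signs in simp_all)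
    moreover have "16/17 * ((1 - s) * \<sigma>' + s * n')
        = ((1 - s) * (16/17 * \<sigma>') + s * (16/17 * n' - m * (11/24))) + s * (m * (11/24))"
      by (simp add: field_simps)
    ultimately show ?thesis using i1 i2 by linarith
  qed
qed

lemma f2_neg_left:
  assumes "0 < r" "r \<le> \<delta>/2"
  shows "f2 r < 0"
proof -
  have neg1: "f2 (\<epsilon>/2 + s * (\<epsilon>/2)) < 0" if s: "s \<in> {0..1}" for s
  proof -
    have "(2 - s) * \<sigma> + s * n \<le> 0" using mult_nonneg_nonpos[of "2 - s" \<sigma>] mult_nonneg_nonpos[of s n] s signs n(1) by auto
    then have "((2 - s) * \<sigma> + s * n) / 2 * (s * (\<epsilon>/2)) \<le> 0" using s \<epsilon> by (intro mult_nonpos_nonneg) auto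
    then show ?thesis unfolding f21[OF s, THEN conjunct2] using signs(3) by linarith
  qed
  consider "r \<in> {0<..\<epsilon>/2}" | "r \<in> {\<epsilon>/2..\<epsilon>}" | "r \<in> {\<epsilon>..\<delta>/2 - \<epsilon>}" | "r \<in> {\<delta>/2 - \<epsilon>..\<delta>/2}"
    using assms unfolding atLeastAtMost_iff greaterThanAtMost_iff by linarith
  then show ?thesis
  proof cases
    case 1
    then have "f2 r = - (r\<^sup>2 / (1 - r\<^sup>2))" "r\<^sup>2 < 1"
      using f_inner(2)[of r] power_strict_mono[of r 1 2] \<delta> \<epsilon> by auto
    then show ?thesis using assms by simp
  next
    case 2
    obtain s where "s \<in> {0..1}" "r = \<epsilon>/2 + s * (\<epsilon> - \<epsilon>/2)" by (rule interpolate[OF 2]) (use \<epsilon> in auto)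
    then show ?thesis using neg1[of s] by simp
  next
    case 3
    have "f2 \<epsilon> < 0" using neg1[of 1] by simp
    moreover have "n * (r - \<epsilon>) \<le> 0" using n(1) 3 by (intro mult_nonpos_nonneg) auto
    ultimately show ?thesis using f22[OF 3] by simp
  next
    case 4
    obtain s where s: "s \<in> {0..1}" "r = \<delta>/2 - s * (\<delta>/2 - (\<delta>/2 - \<epsilon>))" by (rule interpolate'[OF 4]) (use \<epsilon> in auto)
    have "s\<^sup>2 \<le> 1" using s(1) by (simp add: power_le_one)
    have X: "(- (n * \<epsilon>)) * s\<^sup>2 \<le> (16/15 * C) * 1"
      by (rule mult_mono[OF n(3) \<open>s\<^sup>2 \<le> 1\<close>]) (use C in simp_all)
    have "- 4 * C + X / 2 < 0" if "X \<le> (16/15 * C) * 1" for X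
      using that C by (simp add: field_simps)
    from this[OF X] show ?thesis using f23[OF s(1)] s(2) by simp
  qed
qed

lemma f12_pos_right:
  assumes "\<delta>/2 < r" "r \<le> \<delta> - \<epsilon>/2"
  shows "0 < f1 r" "0 < f2' r"
proof -
  have n': "0 < n'" using n(2) \<delta>(1) zero_less_mult_pos2[of n' \<delta>] by simp
  consider "r \<in> {\<delta>/2..\<delta>/2 + \<epsilon>}" | "r \<in> {\<delta>/2 + \<epsilon>..\<delta> - \<epsilon>}" | "r \<in> {\<delta> - \<epsilon>..\<delta> - \<epsilon>/2}"
    using assms unfolding atLeastAtMost_iff by linarith
  then have "0 < f1 r \<and> 0 < f2' r"
  proof cases
    case 1
    obtain s where s: "s \<in> {0..1}" "r = \<delta>/2 + s * (\<delta>/2 + \<epsilon> - \<delta>/2)" by (rule interpolate[OF 1]) (use \<epsilon> in auto)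
    then have "s > 0" using assms(1) by (cases "s = 0") auto
    have "r \<in> {\<epsilon>..\<delta> - \<epsilon>}" using 1 \<epsilon> \<epsilon>_bounds by auto
    then have "f1 r = m * (r - \<delta>/2)" using f12 by blast
    moreover have "f2' r = n' * s" using f24[OF s(1)] s(2) by simp
    ultimately show ?thesis using \<open>s > 0\<close> assms(1) m(2) n' by simp
  next
    case 2
    then have "r \<in> {\<epsilon>..\<delta> - \<epsilon>}" using \<epsilon> \<epsilon>_bounds by auto
    then have "f1 r = m * (r - \<delta>/2)" using f12 by blast
    moreover have "f2' r = n'" using f25[OF 2] by blast
    ultimately show ?thesis using assms(1) m(2) n' by simp
  next
    case 3
    obtain s where s: "s \<in> {0..1}" "r = \<delta> - \<epsilon>/2 - s * (\<delta> - \<epsilon>/2 - (\<delta> - \<epsilon>))" by (rule interpolate'[OF 3]) (use \<epsilon> in auto)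
    then have r: "r = \<delta> - \<epsilon>/2 - s * (\<epsilon>/2)" by simp
    have "s\<^sup>2 \<le> 1" using s(1) by (simp add: power_le_one)
    have "m * \<epsilon> * s\<^sup>2 \<le> 4/17 * 1"
      by (rule mult_mono[OF m(3) \<open>s\<^sup>2 \<le> 1\<close>]) simp_all
    moreover have "0 < (1 - s) * \<sigma>' + s * n'"
    proof (cases "s = 0")
      case False
      then have "0 < s * n'" "0 \<le> (1 - s) * \<sigma>'" using s(1) signs n' by auto
      then show ?thesis by linarith
    qed (use signs in simp)
    moreover have "f1 r = 1 - m * \<epsilon> * s\<^sup>2 / 4" "f2' r = (1 - s) * \<sigma>' + s * n'"
      using f13[OF s(1)] f26[OF s(1)] unfolding r by blast+
    ultimately show ?thesis by simp
  qed
  then show "0 < f1 r" "0 < f2' r" by blast+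
qed

end

context profile
begin

interpretation shape: profile_shape \<delta> \<epsilon> C f1 f2 f1' f2'
  "f1' \<epsilon>" "f2' \<epsilon>" "f2' (\<delta> - \<epsilon>)" "f2' (\<epsilon>/2)" "f2' (\<delta> - \<epsilon>/2)" "f2 (\<epsilon>/2)" "f2 (\<delta> - \<epsilon>/2)"
  by unfold_locales (fact f1_shape f2_shape)+

lemmas f1'_nonneg = shape.f1'_nonneg
  and f2_neg_left = shape.f2_neg_left
  and f12_pos_right = shape.f12_pos_right

lemma contact_inequality:
  obtains c where "c > 0" "\<And>r. r \<in> {\<epsilon>/2..\<delta> - \<epsilon>/2} \<Longrightarrow> c \<le> f1 r * f2' r - f1' r * (f2 r + r)"
proof -
  let ?I = "{\<epsilon>/2..\<delta> - \<epsilon>/2}" and ?P = "\<lambda>r. f1 r * f2' r - f1' r * (f2 r + r)"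
  have sub: "?I \<subseteq> {0..\<delta>}" using \<epsilon> by auto
  have "continuous_on ?I ?P"
    by (intro continuous_intros continuous_on_subset[OF f_continuous(1) sub] continuous_on_subset[OF f_continuous(2) sub]
        continuous_on_subset[OF f'_continuous(1) sub] continuous_on_subset[OF f'_continuous(2) sub])
  moreover have "?I \<noteq> {}" using \<epsilon>_bounds \<epsilon> by auto
  ultimately obtain r0 where "r0 \<in> ?I" "\<And>r. r \<in> ?I \<Longrightarrow> ?P r0 \<le> ?P r"
    using continuous_attains_inf[of ?I ?P] by auto
  then show ?thesis using that[of "?P r0"] shape.contact_inequality_pos by blast
qed

lemma quadratic_left:
  assumes "\<delta>/2 < r0" "r0 \<le> \<delta> - \<epsilon>/2"
  obtains x a0 a1 a2 b0 b1 b2 where "\<delta>/2 \<le> x" "x < r0"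
    "\<And>r. r \<in> {x..r0} \<Longrightarrow> f1 r = a0 + a1 * r + a2 * r\<^sup>2"
    "\<And>r. r \<in> {x..r0} \<Longrightarrow> f2 r = b0 + b1 * r + b2 * r\<^sup>2"
proof -
  \<comment> \<open>The largest corner of either profile strictly below \<open>r0\<close>. As
    \<open>r0\<close> may itself be a corner, the polynomials are claimed only on its left; this is
    enough because the disk ends at \<open>r0\<close>.\<close>
  define x where "x = (if r0 \<le> \<delta>/2 + \<epsilon> then \<delta>/2 else if r0 \<le> \<delta> - \<epsilon> then \<delta>/2 + \<epsilon> else \<delta> - \<epsilon>)"
  have x: "\<delta>/2 \<le> x" "x < r0" "{x<..<r0} \<inter> f1_breaks = {}" "{x<..<r0} \<inter> f2_breaks = {}" "\<epsilon>/2 \<le> x"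
    using assms \<epsilon> \<epsilon>_bounds unfolding x_def f1_breaks_def f2_breaks_def by (auto split: if_splits)
  have quad: "\<exists>a0 a1 a2. \<forall>r\<in>{x..r0}. f r = a0 + a1 * r + a2 * r\<^sup>2"
    if "\<forall>r\<in>{x..r0}. h r = m * r + k" "\<forall>r\<in>{x..r0}. f r = f x + (h x + h r) / 2 * (r - x)" for f h :: "real \<Rightarrow> real" and m k
  proof (intro exI ballI)
    fix r assume r: "r \<in> {x..r0}"
    have "x \<in> {x..r0}" using x by auto
    then have "f r = f x + (m * x + k + (m * r + k)) / 2 * (r - x)" using that r by metis
    also have "\<dots> = (f x - (m * x + 2 * k) / 2 * x) + ((m * x + 2 * k) / 2 - m * x / 2) * r + (m / 2) * r\<^sup>2"
      by (simp add: field_simps power2_eq_square)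
    finally show "f r = (f x - (m * x + 2 * k) / 2 * x) + ((m * x + 2 * k) / 2 - m * x / 2) * r + (m / 2) * r\<^sup>2" .
  qed
  obtain m k where 1: "\<forall>r\<in>{x..r0}. f1' r = m * r + k" "\<forall>r\<in>{x..r0}. f1 r = f1 x + (f1' x + f1' r) / 2 * (r - x)"
    by (rule f1_piece[OF x(5,2) assms(2) x(3)], rule that, assumption+)
  obtain m' k' where 2: "\<forall>r\<in>{x..r0}. f2' r = m' * r + k'" "\<forall>r\<in>{x..r0}. f2 r = f2 x + (f2' x + f2' r) / 2 * (r - x)"
    by (rule f2_piece[OF x(5,2) assms(2) x(4)], rule that, assumption+)
  obtain a0 a1 a2 where "\<forall>r\<in>{x..r0}. f1 r = a0 + a1 * r + a2 * r\<^sup>2" using quad[OF 1] by blast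
  moreover obtain b0 b1 b2 where "\<forall>r\<in>{x..r0}. f2 r = b0 + b1 * r + b2 * r\<^sup>2" using quad[OF 2] by blast
  ultimately show ?thesis using that[OF x(1,2)] by blast
qed

lemma f2_zero:
  obtains r0 where "\<delta>/2 < r0" "r0 < \<delta> - \<epsilon>/2" "f2 r0 = 0" "\<And>r. 0 < r \<Longrightarrow> r < r0 \<Longrightarrow> f2 r < 0"
proof -
  have sub: "{\<delta>/2..\<delta> - \<epsilon>/2} \<subseteq> {0..\<delta>}" using \<delta> \<epsilon> by auto
  have "0 < (\<delta> - \<epsilon>/2)\<^sup>2 / (1 - (\<delta> - \<epsilon>/2)\<^sup>2)"
    using \<delta> \<epsilon> power_strict_mono[of "\<delta> - \<epsilon>/2" 1 2] by simp
  then have e: "0 < f2 (\<delta> - \<epsilon>/2)" using f_outer(2)[of "\<delta> - \<epsilon>/2"] \<epsilon> by simp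
  have n: "f2 (\<delta>/2) < 0" using f2_neg_left[of "\<delta>/2"] \<delta> by simp
  have "\<exists>r0\<ge>\<delta>/2. r0 \<le> \<delta> - \<epsilon>/2 \<and> f2 r0 = 0"
    by (rule IVT') (use e n \<epsilon> continuous_on_subset[OF f_continuous(2) sub] in auto)
  then obtain r0 where r0: "\<delta>/2 \<le> r0" "r0 \<le> \<delta> - \<epsilon>/2" "f2 r0 = 0" by blast
  have ne: "\<delta>/2 < r0" "r0 < \<delta> - \<epsilon>/2" using r0 e n by (auto simp: less_le)
  have "f2 r < 0" if "0 < r" "r < r0" for r
  proof (cases "r \<le> \<delta>/2")
    case False
    have "f2 r < f2 r0"
    proof (rule DERIV_pos_imp_increasing_open[OF that(2)])
      show "\<exists>y. (f2 has_real_derivative y) (at x) \<and> 0 < y" if "r < x" "x < r0" for x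
        using f_deriv_at(2)[of x] f12_pos_right(2)[of x] that False ne \<delta> \<epsilon> by auto
      show "continuous_on {r..r0} f2"
        by (rule continuous_on_subset[OF f_continuous(2)]) (use False ne \<delta> \<epsilon> in auto)
    qed
    then show ?thesis using r0 by simp
  qed (use f2_neg_left that in auto)
  then show ?thesis using that ne r0(3) by blast
qed

end

section \<open>The twisted form on the disk\<close>

text \<open>The real trace, which plays the role of the divergence: \<open>cross2 (b z) v\<close> is
  the contraction of the area form dx dy with the field \<open>b\<close>, and its exterior
  derivative is the trace of the derivative of \<open>b\<close> times dx dy.\<close>

definition trc :: "(complex \<Rightarrow> complex) \<Rightarrow> real" where
  "trc L = Re (L 1) + Im (L \<i>)"

lemma linear_complex_expand:
  assumes "linear (L :: complex \<Rightarrow> 'b::real_vector)"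
  shows "L v = Re v *\<^sub>R L 1 + Im v *\<^sub>R L \<i>"
proof -
  have "v = Re v *\<^sub>R 1 + Im v *\<^sub>R \<i>" by (simp add: complex_eq_iff)
  then have "L v = L (Re v *\<^sub>R 1 + Im v *\<^sub>R \<i>)" by simp
  then show ?thesis using assms by (simp add: linear_add linear_scale)
qed

lemma trc_cross2:
  assumes "linear L"
  shows "cross2 (L v) w - cross2 (L w) v = trc L * cross2 v w"
  unfolding linear_complex_expand[OF assms, of v] linear_complex_expand[OF assms, of w]
  by (simp add: trc_def cross2_def algebra_simps)

text \<open>The first summand is complex antilinear in \<open>v\<close> and therefore traceless. In
  the second one, cyclicity of the trace brings the multiplications by c and its conjugate
  together.\<close>

lemma trc_conj:
  assumes "linear L"
  shows "trc (\<lambda>v. cnj (d * v) * b + cnj c * L (c * v)) = (cmod c)\<^sup>2 * trc L"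
proof -
  have e: "L c = Re c *\<^sub>R L 1 + Im c *\<^sub>R L \<i>" "L (c * \<i>) = (- Im c) *\<^sub>R L 1 + Re c *\<^sub>R L \<i>"
    using linear_complex_expand[OF assms, of c] linear_complex_expand[OF assms, of "c * \<i>"] by simp_all
  show ?thesis
    unfolding trc_def mult_1_right e cmod_power2 by (simp add: algebra_simps power2_eq_square)
qed

lemma trc_add: "trc (\<lambda>v. L v + M v) = trc L + trc M"
  by (simp add: trc_def)

text \<open>The disk part of \<open>prim_form\<close> is \<open>cross2 (radial z) v\<close>.\<close>

definition radial :: "complex \<Rightarrow> complex" where
  "radial z = (1 / (1 - (cmod z)\<^sup>2)) *\<^sub>R z"

lemma has_derivative_norm_sq:
  "((\<lambda>z. (cmod z)\<^sup>2) has_derivative (\<lambda>v. 2 * (z \<bullet> v))) (at z)"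
  unfolding power2_norm_eq_inner
  by (auto intro!: derivative_eq_intros simp: inner_commute)

lemma radial_has_derivative:
  assumes "z \<in> unit_disk"
  shows "(radial has_derivative (\<lambda>v. (1 / (1 - (cmod z)\<^sup>2)) *\<^sub>R v
      + (2 * (z \<bullet> v) / (1 - (cmod z)\<^sup>2)\<^sup>2) *\<^sub>R z)) (at z)"
proof -
  have pos: "1 - (cmod z)\<^sup>2 \<noteq> 0" using assms by (simp add: unit_disk_def abs_square_eq_1)
  have "((\<lambda>z. inverse (1 - (cmod z)\<^sup>2)) has_derivative
      (\<lambda>v. - (inverse (1 - (cmod z)\<^sup>2) * (0 - 2 * (z \<bullet> v)) * inverse (1 - (cmod z)\<^sup>2)))) (at z)"
    by (intro Deriv.has_derivative_inverse has_derivative_diff has_derivative_const has_derivative_norm_sq pos)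
  from has_derivative_scaleR[OF this has_derivative_ident]
  have D: "(radial has_derivative (\<lambda>v. (1 / (1 - (cmod z)\<^sup>2)) *\<^sub>R v
      + (- (1 / (1 - (cmod z)\<^sup>2) * (0 - 2 * (z \<bullet> v)) * (1 / (1 - (cmod z)\<^sup>2)))) *\<^sub>R z)) (at z)"
    unfolding radial_def[abs_def] inverse_eq_divide .
  have "- (1 / (1 - (cmod z)\<^sup>2) * (0 - 2 * (z \<bullet> v)) * (1 / (1 - (cmod z)\<^sup>2))) = 2 * (z \<bullet> v) / (1 - (cmod z)\<^sup>2)\<^sup>2" for v
    using pos by (simp add: power2_eq_square)
  then show ?thesis using D by (simp only:)
qed

text \<open>In terms of forms: \<open>prim_form\<close> is a primitive of the hyperbolic area
  form.\<close>

lemma trc_radial: "z \<in> unit_disk \<Longrightarrow>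
    trc (\<lambda>v. (1 / (1 - (cmod z)\<^sup>2)) *\<^sub>R v + (2 * (z \<bullet> v) / (1 - (cmod z)\<^sup>2)\<^sup>2) *\<^sub>R z) = 2 / (1 - (cmod z)\<^sup>2)\<^sup>2"
proof -
  assume z: "z \<in> unit_disk"
  define w where "w = 1 - (cmod z)\<^sup>2"
  have w: "w \<noteq> 0" using z by (simp add: w_def unit_disk_def abs_square_eq_1)
  have "trc (\<lambda>v. (1 / w) *\<^sub>R v + (2 * (z \<bullet> v) / w\<^sup>2) *\<^sub>R z) = 2 / w + 2 * ((Re z)\<^sup>2 + (Im z)\<^sup>2) / w\<^sup>2"
    using w by (simp add: trc_def inner_complex_def field_simps power2_eq_square)
  also have "(Re z)\<^sup>2 + (Im z)\<^sup>2 = 1 - w" by (simp add: w_def cmod_power2)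
  also have "2 / w + 2 * (1 - w) / w\<^sup>2 = 2 / w\<^sup>2" using w by (simp add: field_simps power2_eq_square)
  finally show ?thesis by (simp add: w_def)
qed

lemma Ck_on_radial: "Ck_on k unit_disk radial"
proof -
  have sq: "Ck_on k unit_disk (\<lambda>z. z \<bullet> z)"
    by (intro Ck_on_inner Ck_on_bounded_linear_apply bounded_linear_ident open_unit_disk)
  have "Ck_on k unit_disk (\<lambda>z. inverse (1 - z \<bullet> z))"
    by (rule Ck_on_compose[OF open_unit_disk _ Ck_on_diff[OF open_unit_disk Ck_on_const sq] Ck_on_inverse_pos])
       (auto simp: unit_disk_def power2_norm_eq_inner[symmetric] abs_square_less_1)
  then have "Ck_on k unit_disk (\<lambda>z. inverse (1 - z \<bullet> z) *\<^sub>R z)"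
    by (rule Ck_on_scaleR[OF open_unit_disk _ Ck_on_bounded_linear_apply[OF bounded_linear_ident]])
  then show ?thesis
    unfolding radial_def[abs_def] power2_norm_eq_inner inverse_eq_divide .
qed

locale lutz_twist = hyperbolic_surface G p\<Sigma> \<Sigma> \<omega>\<Sigma> + profile \<delta> \<epsilon> C f1 f2 f1' f2'
  for G and p\<Sigma> :: "complex \<Rightarrow> 'a::topological_space" and \<Sigma> \<omega>\<Sigma> \<delta> \<epsilon> C f1 f2 f1' f2' +
  assumes disjoint: "\<forall>g\<in>G - {\<one>\<^bsub>BijGroup unit_disk\<^esub>}. g ` ball 0 \<delta> \<inter> ball 0 \<delta> = {}"
begin

text \<open>All 1-forms below are invariant under translation in \<open>t\<close>; functions \<open>a\<close> and \<open>b\<close> on the disk encode the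
  form with the value \<open>a z * \<tau> + cross2 (b z) v\<close> on the tangent vector \<open>(\<tau>, v)\<close> at \<open>(t, z)\<close>.\<close>

definition A0 :: "complex \<Rightarrow> real" where "A0 w = f1 (cmod w) - 1"

definition B0 :: "complex \<Rightarrow> complex" where
  "B0 w = (f2 (cmod w) / (cmod w)\<^sup>2) *\<^sub>R w - radial w"

definition in_tube :: "complex \<Rightarrow> bool" where
  "in_tube z \<longleftrightarrow> (\<exists>g\<in>G. cmod (g z) < \<delta>)"

text \<open>By \<open>tube_unique\<close> there is only one candidate at each point of a tube, so
  the choice is harmless. It replaces the sum over \<open>G\<close> by its only nonzero
  term.\<close>

definition centre :: "complex \<Rightarrow> complex \<Rightarrow> complex" where
  "centre z = (SOME g. g \<in> G \<and> cmod (g z) < \<delta>)"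

definition etaA :: "complex \<Rightarrow> real" where
  "etaA z = (if in_tube z then A0 (centre z z) else 0)"

text \<open>Pulling back multiplies \<open>v\<close> by the complex derivative, and
  \<open>cross2_mult_right\<close> moves this factor to the other argument as its conjugate.\<close>

definition etaB :: "complex \<Rightarrow> complex" where
  "etaB z = (if in_tube z then cnj (deriv (centre z) z) * B0 (centre z z) else 0)"

lemma ball_\<delta>: "ball 0 \<delta> \<subseteq> unit_disk"
  using \<delta> by (auto simp: unit_disk_def)

text \<open>Otherwise g composed with the inverse of h would be a nontrivial element of
  \<open>G\<close> that maps the point h(z) of the ball into the ball.\<close>

lemma tube_unique:
  assumes "g \<in> G" "h \<in> G" "z \<in> unit_disk" "cmod (g z) < \<delta>" "cmod (h z) < \<delta>"
  shows "g = h"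
proof -
  obtain h' where h': "h' \<in> G" "\<And>x. x \<in> unit_disk \<Longrightarrow> h' (h x) = x" using G_inverse[OF assms(2)] by metis
  define k where "k = compose unit_disk g h'"
  have k: "k \<in> G" using G_compose assms(1) h'(1) by (simp add: k_def)
  have kh: "k (h x) = g x" if "x \<in> unit_disk" for x
    using that G_maps[OF assms(2) that] h'(2) by (simp add: k_def compose_def)
  have "g z \<in> k ` ball 0 \<delta> \<inter> ball 0 \<delta>"
    using assms(4,5) kh[OF assms(3)] by (auto intro!: image_eqI[of _ k "h z"])
  then have "k = \<one>\<^bsub>BijGroup unit_disk\<^esub>" using disjoint k by blast
  then have "k x = x" if "x \<in> unit_disk" for x using that by (simp add: BijGroup_def)
  then show ?thesis using kh G_maps[OF assms(2)] assms(1,2) by (intro G_eqI) auto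
qed

lemma centre_eq:
  assumes "g \<in> G" "z \<in> unit_disk" "cmod (g z) < \<delta>"
  shows "in_tube z" "centre z = g"
proof -
  show "in_tube z" using assms by (auto simp: in_tube_def)
  have "centre z \<in> G \<and> cmod (centre z z) < \<delta>"
    unfolding centre_def by (rule someI[of _ g]) (use assms in auto)
  then show "centre z = g" using tube_unique assms by blast
qed

lemma eta_in:
  assumes "g \<in> G" "z \<in> unit_disk" "cmod (g z) < \<delta>"
  shows "etaA z = A0 (g z)" "etaB z = cnj (deriv g z) * B0 (g z)"
  using centre_eq[OF assms] by (simp_all add: etaA_def etaB_def)

lemma eta_out: "\<not> in_tube z \<Longrightarrow> etaA z = 0" "\<not> in_tube z \<Longrightarrow> etaB z = 0"
  by (simp_all add: etaA_def etaB_def)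

text \<open>On the outer collar the model form equals \<open>prim_form\<close>. Hence the support of
  the twist keeps away from the edge of the tube, and the extension by 0 loses no
  regularity.\<close>

lemma AB0_outer:
  assumes "\<delta> - \<epsilon>/2 \<le> cmod w" "cmod w < \<delta>"
  shows "A0 w = 0" "B0 w = 0"
  using assms f_outer[of "cmod w"] \<epsilon> \<delta> by (auto simp: A0_def B0_def radial_def scaleR_left_diff_distrib[symmetric])

text \<open>Near the core the model form is the negative of \<open>prim_form\<close>, so their
  difference is -2 times \<open>prim_form\<close>, which is smooth across the origin where the polar
  formula is singular.\<close>

lemma AB0_inner:
  assumes "cmod w \<le> \<epsilon>/2"
  shows "A0 w = -2" "B0 w = (-2) *\<^sub>R radial w"
proof -
  show "A0 w = -2" using f_inner(1)[of "cmod w"] assms by (simp add: A0_def)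
  show "B0 w = (-2) *\<^sub>R radial w"
  proof (cases "w = 0")
    case False
    then have "f2 (cmod w) / (cmod w)\<^sup>2 = - (1 / (1 - (cmod w)\<^sup>2))"
      using f_inner(2)[of "cmod w"] assms by simp
    then show ?thesis by (simp add: B0_def radial_def complex_eq_iff)
  qed (simp add: B0_def radial_def)
qed

lemma tube_open:
  assumes "g \<in> G" "z \<in> unit_disk" "cmod (g z) < \<delta>"
  obtains W where "open W" "z \<in> W" "W \<subseteq> unit_disk" "\<And>w. w \<in> W \<Longrightarrow> cmod (g w) < \<delta>"
proof -
  have "\<forall>\<^sub>F w in nhds z. g w \<in> ball 0 \<delta>"
    using G_isCont[OF assms(1,2)] assms(3) unfolding isCont_def
    by (metis tendsto_at_iff_tendsto_nhds topological_tendstoD open_ball mem_ball_0)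
  then obtain W where "open W" "z \<in> W" "\<And>w. w \<in> W \<Longrightarrow> g w \<in> ball 0 \<delta>"
    unfolding eventually_nhds by blast
  then show ?thesis using assms(2) by (intro that[of "W \<inter> unit_disk"]) auto
qed

text \<open>Infinitely many translates could a priori accumulate at \<open>z\<close>. The image of
  the slightly smaller closed disk in the surface is compact, hence closed since the surface is
  Hausdorff, so the union of its translates is closed in the disk. Off this union the twist
  vanishes, even in the outer collars of the tubes.\<close>

lemma not_tube_open:
  assumes "z \<in> unit_disk" "\<not> in_tube z"
  obtains W where "open W" "z \<in> W" "W \<subseteq> unit_disk" "\<And>w. w \<in> W \<Longrightarrow> etaA w = 0 \<and> etaB w = 0"
proof -
  let ?K = "cball 0 (\<delta> - \<epsilon>/2) :: complex set"
  have K: "?K \<subseteq> unit_disk" using \<delta> \<epsilon> by (auto simp: unit_disk_def)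
  have cont: "continuous_on unit_disk p\<Sigma>" using covering_space_imp_continuous[OF covering_p\<Sigma>] .
  have im: "p\<Sigma> ` unit_disk = \<Sigma>" using covering_space_imp_surjective[OF covering_p\<Sigma>] .
  have "compact (p\<Sigma> ` ?K)" using cont K by (intro compact_continuous_image) (auto intro: continuous_on_subset)
  then have "compactin (top_of_set \<Sigma>) (p\<Sigma> ` ?K)" using K im by (auto simp: compactin_subtopology)
  then have "closedin (top_of_set \<Sigma>) (p\<Sigma> ` ?K)" using compactin_imp_closedin Hausdorff_\<Sigma> by blast
  moreover have "continuous_map (top_of_set unit_disk) (top_of_set \<Sigma>) p\<Sigma>"
    using cont im by (auto simp: continuous_map_in_subtopology)
  ultimately have "closedin (top_of_set unit_disk) {w \<in> topspace (top_of_set unit_disk). p\<Sigma> w \<in> p\<Sigma> ` ?K}"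
    by (intro closedin_continuous_map_preimage)
  then have "closedin (top_of_set unit_disk) {w \<in> unit_disk. p\<Sigma> w \<in> p\<Sigma> ` ?K}"
    by (simp only: topspace_euclidean_subtopology)
  then have "openin (top_of_set unit_disk) (unit_disk - {w \<in> unit_disk. p\<Sigma> w \<in> p\<Sigma> ` ?K})"
    by (simp add: openin_diff)
  then have op: "open (unit_disk - {w \<in> unit_disk. p\<Sigma> w \<in> p\<Sigma> ` ?K})"
    using openin_open_eq[OF open_unit_disk] by blast
  show ?thesis
  proof (rule that[OF op])
    show "z \<in> unit_disk - {w \<in> unit_disk. p\<Sigma> w \<in> p\<Sigma> ` ?K}"
    proof -
      have "p\<Sigma> z \<notin> p\<Sigma> ` ?K"
      proof
        assume "p\<Sigma> z \<in> p\<Sigma> ` ?K"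
        then obtain w where w: "w \<in> ?K" "p\<Sigma> z = p\<Sigma> w" by blast
        then obtain g where "g \<in> G" "w = g z" using p\<Sigma>_eq_iff[OF assms(1), of w] K by blast
        then show False using assms(2) w(1) \<epsilon> by (auto simp: in_tube_def)
      qed
      then show ?thesis using assms(1) by blast
    qed
    fix w assume w: "w \<in> unit_disk - {w \<in> unit_disk. p\<Sigma> w \<in> p\<Sigma> ` ?K}"
    show "etaA w = 0 \<and> etaB w = 0"
    proof (cases "in_tube w")
      case True
      then obtain g where g: "g \<in> G" "cmod (g w) < \<delta>" unfolding in_tube_def by blast
      have "p\<Sigma> (g w) = p\<Sigma> w" using p\<Sigma>_G g(1) w by blast
      then have "g w \<notin> ?K" using w by (metis (mono_tags, lifting) DiffD1 DiffD2 imageI mem_Collect_eq)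
      then have "\<delta> - \<epsilon>/2 \<le> cmod (g w)" by simp
      then show ?thesis using eta_in[OF g(1) _ g(2)] AB0_outer g(2) w by simp
    qed (simp add: eta_out)
  qed blast
qed

lemma Ck_on_A0_B0: "Ck_on 1 (ball 0 \<delta>) A0" "Ck_on 1 (ball 0 \<delta>) B0"
proof -
  let ?N = "ball 0 \<delta> - {0 :: complex}"
  have N: "open ?N" "?N \<subseteq> unit_disk" "0 \<notin> ?N" using ball_\<delta> by auto
  have T: "open {0<..<\<delta>}" by simp
  have im: "norm ` ?N \<subseteq> {0<..<\<delta>}" by auto
  have c: "continuous_on {0<..<\<delta>} f1'" "continuous_on {0<..<\<delta>} f2'"
    using f'_continuous continuous_on_subset[of _ _ "{0<..<\<delta>}"] by (metis greaterThanLessThan_subseteq_atLeastAtMost_iff order_refl)+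
  have f1: "Ck_on 1 {0<..<\<delta>} f1" by (rule Ck_on_real1[OF T f_deriv_at(1) c(1)]) simp_all
  have f2: "Ck_on 1 {0<..<\<delta>} f2" by (rule Ck_on_real1[OF T f_deriv_at(2) c(2)]) simp_all
  note f = f1 f2
  have fn: "Ck_on 1 ?N (\<lambda>w. f1 (cmod w))" "Ck_on 1 ?N (\<lambda>w. f2 (cmod w))"
    using Ck_on_compose[OF N(1) T Ck_on_norm[OF N(1,3)] f(1) im] Ck_on_compose[OF N(1) T Ck_on_norm[OF N(1,3)] f(2) im] by auto
  have "Ck_on 1 ?N (\<lambda>w. (cmod w) powr (-2))"
    by (rule Ck_on_compose[OF N(1) _ Ck_on_norm[OF N(1,3)] Ck_on_powr]) auto
  then have inv: "Ck_on 1 ?N (\<lambda>w. inverse ((cmod w)\<^sup>2))"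
    by (rule Ck_on_cong[OF N(1)]) (auto simp: powr_minus powr_numeral)
  have R: "Ck_on 1 S radial" if "S \<subseteq> unit_disk" for S using Ck_on_subset[OF Ck_on_radial that] .
  have id: "Ck_on 1 ?N (\<lambda>w. w)" by (simp only: Ck_on_bounded_linear_apply[OF bounded_linear_ident])
  have A: "Ck_on 1 ?N A0" unfolding A0_def[abs_def] by (intro Ck_on_diff N(1) fn Ck_on_const)
  have B: "Ck_on 1 ?N B0" unfolding B0_def[abs_def] divide_inverse
    by (intro Ck_on_diff Ck_on_scaleR Ck_on_mult N(1) fn inv id R N(2))
  let ?I = "ball 0 (\<epsilon>/2) :: complex set"
  have I: "?I \<subseteq> unit_disk" "0 \<in> ?I" using \<epsilon> \<delta> by (auto simp: unit_disk_def)
  have A': "Ck_on 1 ?I A0"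
    by (rule Ck_on_cong[OF open_ball Ck_on_const[of 1 _ "-2"]]) (auto intro: AB0_inner)
  have B': "Ck_on 1 ?I B0"
    by (rule Ck_on_cong[OF open_ball Ck_on_scaleR[OF open_ball Ck_on_const[of 1 _ "-2"] R[OF I(1)]]]) (simp add: AB0_inner)
  show "Ck_on 1 (ball 0 \<delta>) A0"
  proof (rule Ck_on_local)
    fix x :: complex assume "x \<in> ball 0 \<delta>"
    then show "\<exists>N h. open N \<and> x \<in> N \<and> Ck_on 1 N h \<and> (\<forall>y\<in>N. A0 y = h y)"
    proof (cases "x = 0")
      case True
      then show ?thesis using A' I(2) by (intro exI[of _ ?I] exI[of _ A0]) simp
    next
      case False
      then show ?thesis using A N(1) \<open>x \<in> ball 0 \<delta>\<close> by (intro exI[of _ ?N] exI[of _ A0]) simp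
    qed
  qed
  show "Ck_on 1 (ball 0 \<delta>) B0"
  proof (rule Ck_on_local)
    fix x :: complex assume "x \<in> ball 0 \<delta>"
    then show "\<exists>N h. open N \<and> x \<in> N \<and> Ck_on 1 N h \<and> (\<forall>y\<in>N. B0 y = h y)"
    proof (cases "x = 0")
      case True
      then show ?thesis using B' I(2) by (intro exI[of _ ?I] exI[of _ B0]) simp
    next
      case False
      then show ?thesis using B N(1) \<open>x \<in> ball 0 \<delta>\<close> by (intro exI[of _ ?N] exI[of _ B0]) simp
    qed
  qed
qed

lemma Ck_on_eta: "Ck_on 1 unit_disk etaA" "Ck_on 1 unit_disk etaB"
proof -
  have "\<exists>N. open N \<and> z \<in> N \<and> (\<exists>h. Ck_on 1 N h \<and> (\<forall>y\<in>N. etaA y = h y)) \<and> (\<exists>h. Ck_on 1 N h \<and> (\<forall>y\<in>N. etaB y = h y))"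
    if z: "z \<in> unit_disk" for z
  proof (cases "in_tube z")
    case True
    then obtain g where g: "g \<in> G" "cmod (g z) < \<delta>" unfolding in_tube_def by blast
    obtain W where W: "open W" "z \<in> W" "W \<subseteq> unit_disk" "\<And>w. w \<in> W \<Longrightarrow> cmod (g w) < \<delta>"
      using tube_open[OF g(1) z g(2)] by blast
    have eq: "etaA w = A0 (g w)" "etaB w = cnj (deriv g w) * B0 (g w)" if "w \<in> W" for w
      using eta_in[OF g(1) _ W(4)] W(3) that by auto
    have "Ck_on 1 unit_disk g" using G_smooth[OF g(1)] by (simp only: smooth_on_def)
    then have gW: "Ck_on 1 W g" using Ck_on_subset W(3) by blast
    have im: "g ` W \<subseteq> ball 0 \<delta>" using W(4) by auto
    note c = Ck_on_compose[OF W(1) open_ball gW Ck_on_A0_B0(1) im] Ck_on_compose[OF W(1) open_ball gW Ck_on_A0_B0(2) im]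
    have "Ck_on 1 W (\<lambda>w. cnj (deriv g w))"
      by (rule Ck_on_bounded_linear[OF W(1) bounded_linear_cnj Ck_on_subset[OF Ck_on_deriv[OF g(1)] W(3)]])
    then have "Ck_on 1 W (\<lambda>w. cnj (deriv g w) * B0 (g w))" using Ck_on_mult[OF W(1) _ c(2)] by blast
    then show ?thesis using W(1,2) c(1) eq by blast
  next
    case False
    obtain W where W: "open W" "z \<in> W" "\<And>w. w \<in> W \<Longrightarrow> etaA w = 0 \<and> etaB w = 0"
      using not_tube_open[OF z False] by metis
    have "\<exists>h. Ck_on 1 W h \<and> (\<forall>y\<in>W. etaA y = h y)" "\<exists>h. Ck_on 1 W h \<and> (\<forall>y\<in>W. etaB y = h y)"
      by (rule exI[of _ "\<lambda>_. 0"]; simp add: W(3))+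
    then show ?thesis using W(1,2) by blast
  qed
  note local = this
  show "Ck_on 1 unit_disk etaA"
  proof (rule Ck_on_local)
    show "\<exists>N h. open N \<and> z \<in> N \<and> Ck_on 1 N h \<and> (\<forall>y\<in>N. etaA y = h y)" if "z \<in> unit_disk" for z
      using local[OF that] by blast
  qed
  show "Ck_on 1 unit_disk etaB"
  proof (rule Ck_on_local)
    show "\<exists>N h. open N \<and> z \<in> N \<and> Ck_on 1 N h \<and> (\<forall>y\<in>N. etaB y = h y)" if "z \<in> unit_disk" for z
      using local[OF that] by blast
  qed
qed

section \<open>Derivatives of the twist and their behaviour under the group\<close>

definition dA :: "complex \<Rightarrow> complex \<Rightarrow> real" where "dA z = frechet_derivative etaA (at z)"
definition dB :: "complex \<Rightarrow> complex \<Rightarrow> complex" where "dB z = frechet_derivative etaB (at z)"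

lemma eta_has_derivative:
  assumes "z \<in> unit_disk"
  shows "(etaA has_derivative dA z) (at z)" "(etaB has_derivative dB z) (at z)"
  unfolding dA_def dB_def using Ck_on_has_derivative[of 0 unit_disk] Ck_on_eta assms by auto

lemma dA_dB_continuous: "continuous_on unit_disk (\<lambda>z. dA z v)" "continuous_on unit_disk (\<lambda>z. dB z v)"
  unfolding dA_def dB_def using Ck_on_eta by auto

lemma dA_dB_linear:
  assumes "z \<in> unit_disk"
  shows "linear (dA z)" "linear (dB z)"
  using eta_has_derivative[OF assms] has_derivative_linear by blast+

text \<open>If g brings h(z) into the ball, then the composite of g and h brings z into it, and the
  chain rule matches the factors. Conversely a tube through z yields one through h(z), so both
  points lie in tubes or neither does.\<close>

lemma eta_invariant:
  assumes "h \<in> G" "z \<in> unit_disk"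
  shows "etaA z = etaA (h z)" "etaB z = cnj (deriv h z) * etaB (h z)"
proof -
  have hz: "h z \<in> unit_disk" using G_maps assms by blast
  have "etaA z = etaA (h z) \<and> etaB z = cnj (deriv h z) * etaB (h z)"
  proof (cases "in_tube (h z)")
    case True
    then obtain g where g: "g \<in> G" "cmod (g (h z)) < \<delta>" unfolding in_tube_def by blast
    define k where "k = compose unit_disk g h"
    have k: "k \<in> G" "\<And>x. x \<in> unit_disk \<Longrightarrow> k x = g (h x)"
      using G_compose g(1) assms(1) by (auto simp: k_def compose_def)
    have "(g \<circ> h has_field_derivative deriv g (h z) * deriv h z) (at z)"
      by (rule DERIV_chain[OF G_derivative(2)[OF g(1) hz] G_derivative(2)[OF assms]])
    then have "(k has_field_derivative deriv g (h z) * deriv h z) (at z)"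
      by (rule has_field_derivative_transform_within_open[OF _ open_unit_disk assms(2)]) (simp add: k(2))
    then have "deriv k z = deriv g (h z) * deriv h z" by (rule DERIV_imp_deriv)
    then show ?thesis
      using eta_in[OF k(1) assms(2)] eta_in[OF g(1) hz g(2)] k(2)[OF assms(2)] g(2) by simp
  next
    case False
    obtain h' where h': "h' \<in> G" "\<And>x. x \<in> unit_disk \<Longrightarrow> h' (h x) = x" using G_inverse[OF assms(1)] by metis
    have "\<not> in_tube z"
    proof
      assume "in_tube z"
      then obtain g where g: "g \<in> G" "cmod (g z) < \<delta>" unfolding in_tube_def by blast
      have "compose unit_disk g h' (h z) = g z" using hz h'(2)[OF assms(2)] by (simp add: compose_def)
      then have "in_tube (h z)" unfolding in_tube_def using G_compose[OF g(1) h'(1)] g(2) by metis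
      then show False using False by blast
    qed
    then show ?thesis using False by (simp add: eta_out)
  qed
  then show "etaA z = etaA (h z)" "etaB z = cnj (deriv h z) * etaB (h z)" by blast+
qed

lemma G_holomorphic: "h \<in> G \<Longrightarrow> h holomorphic_on unit_disk"
  by (meson G_derivative(2) holomorphic_onI field_differentiable_def field_differentiable_at_within)

text \<open>Since \<open>h\<close> is holomorphic, the term with its second derivative is complex
  antilinear in \<open>v\<close>; \<open>trc_conj\<close> removes it from the divergence.\<close>

lemma pullback_has_derivative:
  assumes "h \<in> G" "z \<in> unit_disk" "(B has_derivative L) (at (h z))"
  shows "((\<lambda>z. cnj (deriv h z) * B (h z)) has_derivative
    (\<lambda>v. cnj (deriv (deriv h) z * v) * B (h z) + cnj (deriv h z) * L (deriv h z * v))) (at z)"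
proof -
  have "(deriv h) holomorphic_on unit_disk" using G_holomorphic[OF assms(1)] holomorphic_deriv open_unit_disk by blast
  then have "(deriv h has_field_derivative deriv (deriv h) z) (at z)"
    using holomorphic_derivI[OF _ open_unit_disk assms(2)] by blast
  then have 1: "((\<lambda>z. cnj (deriv h z)) has_derivative (\<lambda>v. cnj (deriv (deriv h) z * v))) (at z)"
    unfolding has_field_derivative_def by (rule bounded_linear.has_derivative[OF bounded_linear_cnj])
  have 2: "((\<lambda>z. B (h z)) has_derivative (\<lambda>v. L (deriv h z * v))) (at z)"
    by (rule has_derivative_compose[where f = h and g = B and g' = L, OF _ assms(3)]) (use G_derivative(2)[OF assms(1,2)] in \<open>simp add: has_field_derivative_def\<close>)
  show ?thesis using has_derivative_mult[OF 1 2] by (simp add: add.commute)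
qed

lemma dA_invariant:
  assumes "h \<in> G" "z \<in> unit_disk"
  shows "dA z v = dA (h z) (deriv h z * v)"
proof -
  have "((\<lambda>z. etaA (h z)) has_derivative (\<lambda>v. dA (h z) (deriv h z * v))) (at z)"
    by (rule has_derivative_compose[where f = h and g = etaA and g' = "dA (h z)", OF _ eta_has_derivative(1)[OF G_maps[OF assms]]])
       (use G_derivative(2)[OF assms] in \<open>simp add: has_field_derivative_def\<close>)
  then have "(etaA has_derivative (\<lambda>v. dA (h z) (deriv h z * v))) (at z)"
    by (rule has_derivative_transform_within_open[OF _ open_unit_disk assms(2)]) (use eta_invariant assms(1) in metis)
  then show ?thesis using has_derivative_unique[OF eta_has_derivative(1)[OF assms(2)]] by metis
qed

text \<open>The dx dy coefficient of the differential of \<open>\<alpha>L\<close>: the contribution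
  of the twist plus the hyperbolic area density.\<close>

definition curl :: "complex \<Rightarrow> real" where
  "curl z = trc (dB z) + 2 / (1 - (cmod z)\<^sup>2)\<^sup>2"

lemma metric_factor:
  assumes "h \<in> G" "z \<in> unit_disk"
  shows "2 / (1 - (cmod z)\<^sup>2)\<^sup>2 = (cmod (deriv h z))\<^sup>2 * (2 / (1 - (cmod (h z))\<^sup>2)\<^sup>2)"
proof -
  have "1 - (cmod z)\<^sup>2 \<noteq> 0" "1 - (cmod (h z))\<^sup>2 \<noteq> 0" using unit_disk_pos assms G_maps by force+
  then show ?thesis using G_derivative(3)[OF assms] by (simp add: field_simps)
qed

lemma trc_dB_pullback:
  assumes "h \<in> G" "z \<in> unit_disk" "(B has_derivative L) (at (h z))"
    "open W" "z \<in> W" "\<And>w. w \<in> W \<Longrightarrow> etaB w = cnj (deriv h w) * B (h w)"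
  shows "trc (dB z) = (cmod (deriv h z))\<^sup>2 * trc L"
proof -
  have "(etaB has_derivative
      (\<lambda>v. cnj (deriv (deriv h) z * v) * B (h z) + cnj (deriv h z) * L (deriv h z * v))) (at z)"
    by (rule has_derivative_transform_within_open[OF pullback_has_derivative[OF assms(1-3)] assms(4,5)]) (simp add: assms(6))
  then have "dB z = (\<lambda>v. cnj (deriv (deriv h) z * v) * B (h z) + cnj (deriv h z) * L (deriv h z * v))"
    using has_derivative_unique[OF eta_has_derivative(2)[OF assms(2)]] by blast
  then show ?thesis using trc_conj[OF has_derivative_linear[OF assms(3)]] by simp
qed

lemma curl_invariant:
  assumes "h \<in> G" "z \<in> unit_disk"
  shows "curl z = (cmod (deriv h z))\<^sup>2 * curl (h z)"
  unfolding curl_def metric_factor[OF assms]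
    trc_dB_pullback[OF assms eta_has_derivative(2)[OF G_maps[OF assms]] open_unit_disk assms(2) eta_invariant(2)[OF assms(1)], simplified]
  by (simp add: algebra_simps)

definition lamA :: "complex \<Rightarrow> real" where "lamA z = 1 + etaA z"
definition lamB :: "complex \<Rightarrow> complex" where "lamB z = radial z + etaB z"

lemma lam_has_derivative:
  assumes "z \<in> unit_disk"
  shows "(lamA has_derivative dA z) (at z)"
    and "\<exists>L. (lamB has_derivative L) (at z) \<and> trc L = curl z"
proof -
  show "(lamA has_derivative dA z) (at z)"
    unfolding lamA_def[abs_def]
    using has_derivative_add[OF has_derivative_const eta_has_derivative(1)[OF assms]] by simp
  show "\<exists>L. (lamB has_derivative L) (at z) \<and> trc L = curl z"
    unfolding lamB_def[abs_def]
  proof (intro exI conjI)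
    show "((\<lambda>z. radial z + etaB z) has_derivative (\<lambda>v. ((1 / (1 - (cmod z)\<^sup>2)) *\<^sub>R v
        + (2 * (z \<bullet> v) / (1 - (cmod z)\<^sup>2)\<^sup>2) *\<^sub>R z) + dB z v)) (at z)"
      by (rule has_derivative_add[OF radial_has_derivative[OF assms] eta_has_derivative(2)[OF assms]])
    show "trc (\<lambda>v. ((1 / (1 - (cmod z)\<^sup>2)) *\<^sub>R v + (2 * (z \<bullet> v) / (1 - (cmod z)\<^sup>2)\<^sup>2) *\<^sub>R z) + dB z v) = curl z"
      using trc_add[of "\<lambda>v. (1 / (1 - (cmod z)\<^sup>2)) *\<^sub>R v + (2 * (z \<bullet> v) / (1 - (cmod z)\<^sup>2)\<^sup>2) *\<^sub>R z" "dB z"]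
      by (simp only: trc_radial[OF assms] curl_def add.commute)
  qed
qed

text \<open>The density of the wedge product of \<open>\<alpha>L\<close> with its differential,
  relative to dt times the hyperbolic area; for \<open>prim_form\<close> alone it is 1. It is also
  the value of \<open>\<alpha>L\<close> on the kernel field, so one lower bound serves both
  conditions.\<close>

definition contact_density :: "complex \<Rightarrow> real" where
  "contact_density z = (1 - (cmod z)\<^sup>2)\<^sup>2 / 2 * (lamA z * curl z - dA z (lamB z))"

section \<open>The lower bound for the contact density\<close>

lemma norm_has_derivative: "w \<noteq> 0 \<Longrightarrow> (cmod has_derivative (\<lambda>u. (w \<bullet> u) / cmod w)) (at w)"
  using has_derivative_norm[of w] by (simp add: sgn_div_norm inner_commute divide_inverse mult.commute)

lemma A0_has_derivative:
  assumes "0 < cmod w" "cmod w < \<delta>"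
  shows "(A0 has_derivative (\<lambda>u. f1' (cmod w) * ((w \<bullet> u) / cmod w))) (at w)"
proof -
  have "(f1 has_derivative (\<lambda>x. f1' (cmod w) * x)) (at (cmod w))"
    using f_deriv_at(1)[OF assms] by (simp add: has_field_derivative_def)
  from has_derivative_compose[OF norm_has_derivative this] assms
  have "((\<lambda>w. f1 (cmod w)) has_derivative (\<lambda>u. f1' (cmod w) * ((w \<bullet> u) / cmod w))) (at w)" by simp
  from has_derivative_diff[OF this has_derivative_const[of 1]] show ?thesis unfolding A0_def[abs_def] by simp
qed

text \<open>A radial field k(r) w has divergence 2 k + r k'; for k = f2 / r^2 this is f2' /
  r.\<close>

lemma B0_has_derivative:
  assumes "0 < cmod w" "cmod w < \<delta>"
  obtains L where "(B0 has_derivative L) (at w)" "trc L = f2' (cmod w) / cmod w - 2 / (1 - (cmod w)\<^sup>2)\<^sup>2"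
proof -
  define r where "r = cmod w"
  have r: "0 < r" "r < \<delta>" using assms by (simp_all add: r_def)
  have wD: "w \<in> unit_disk" using assms ball_\<delta> by auto
  define k' where "k' = (f2' r * r\<^sup>2 - f2 r * (2 * r)) / (r\<^sup>2 * r\<^sup>2)"
  have "((\<lambda>r. f2 r / r\<^sup>2) has_real_derivative k') (at r)"
    unfolding k'_def using r by (intro DERIV_divide f_deriv_at) (auto intro!: derivative_eq_intros)
  then have "((\<lambda>r. f2 r / r\<^sup>2) has_derivative (\<lambda>x. k' * x)) (at (cmod w))"
    by (simp add: has_field_derivative_def r_def)
  from has_derivative_compose[OF norm_has_derivative this] r
  have "((\<lambda>w. f2 (cmod w) / (cmod w)\<^sup>2) has_derivative (\<lambda>u. k' * ((w \<bullet> u) / r))) (at w)" by (auto simp: r_def)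
  from has_derivative_scaleR[OF this has_derivative_ident]
  have "((\<lambda>w. (f2 (cmod w) / (cmod w)\<^sup>2) *\<^sub>R w) has_derivative
      (\<lambda>u. (f2 r / r\<^sup>2) *\<^sub>R u + (k' * ((w \<bullet> u) / r)) *\<^sub>R w)) (at w)" by (simp add: r_def)
  from has_derivative_diff[OF this radial_has_derivative[OF wD]]
  have D: "(B0 has_derivative (\<lambda>u. ((f2 r / r\<^sup>2) *\<^sub>R u + (k' * ((w \<bullet> u) / r)) *\<^sub>R w)
      - ((1 / (1 - (cmod w)\<^sup>2)) *\<^sub>R u + (2 * (w \<bullet> u) / (1 - (cmod w)\<^sup>2)\<^sup>2) *\<^sub>R w))) (at w)"
    unfolding B0_def[abs_def] .
  have "trc (\<lambda>u. (f2 r / r\<^sup>2) *\<^sub>R u + (k' * ((w \<bullet> u) / r)) *\<^sub>R w)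
      = 2 * (f2 r / r\<^sup>2) + k' / r * ((Re w)\<^sup>2 + (Im w)\<^sup>2)"
    by (simp add: trc_def inner_complex_def algebra_simps power2_eq_square add_divide_distrib)
  also have "(Re w)\<^sup>2 + (Im w)\<^sup>2 = r\<^sup>2" by (simp add: r_def cmod_power2)
  also have "2 * (f2 r / r\<^sup>2) + k' / r * r\<^sup>2 = f2' r / r"
    using r unfolding k'_def by (simp add: field_simps power2_eq_square)
  finally have t: "trc (\<lambda>u. (f2 r / r\<^sup>2) *\<^sub>R u + (k' * ((w \<bullet> u) / r)) *\<^sub>R w) = f2' r / r" .
  have "trc (\<lambda>u. ((f2 r / r\<^sup>2) *\<^sub>R u + (k' * ((w \<bullet> u) / r)) *\<^sub>R w)
      - ((1 / (1 - (cmod w)\<^sup>2)) *\<^sub>R u + (2 * (w \<bullet> u) / (1 - (cmod w)\<^sup>2)\<^sup>2) *\<^sub>R w))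
    = f2' r / r - 2 / (1 - (cmod w)\<^sup>2)\<^sup>2"
    using t trc_radial[OF wD] unfolding trc_def minus_complex.sel by linarith
  then show ?thesis using that[OF D] by (simp add: r_def)
qed

text \<open>Under \<open>g\<close> every term scales by the squared modulus of its derivative,
  except \<open>radial z\<close> in \<open>lamB\<close>. This exception is estimated, so the
  conclusion is an inequality and contains f2 + r instead of f2.\<close>

lemma contact_density_tube:
  assumes "g \<in> G" "z \<in> unit_disk" and r: "r = cmod (g z)" "0 < r" "r < \<delta>"
  shows "(1 - r\<^sup>2)\<^sup>2 / (2 * r) * (f1 r * f2' r - f1' r * (f2 r + r)) \<le> contact_density z"
proof -
  define w d k where "w = g z" and "d = deriv g z" and "k = (cmod d)\<^sup>2"
  have w: "0 < cmod w" "cmod w < \<delta>" "cmod w = r" using r by (simp_all add: w_def)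
  have gz: "cmod (g z) < \<delta>" using r by simp
  have r1: "r < 1" "0 < 1 - r\<^sup>2" using r \<delta> power_strict_mono[of r 1 2] by auto
  define n where "n = 1 - (cmod z)\<^sup>2"
  have n: "0 < n" using unit_disk_pos[OF assms(2)] by (simp add: n_def)
  have dn: "cmod d * n = 1 - r\<^sup>2" using G_cmod_deriv[OF assms(1,2)] by (simp add: d_def n_def r)
  obtain W where W: "open W" "z \<in> W" "W \<subseteq> unit_disk" "\<And>w. w \<in> W \<Longrightarrow> cmod (g w) < \<delta>"
    using tube_open[OF assms(1,2) gz] by blast
  have "((\<lambda>z. A0 (g z)) has_derivative (\<lambda>v. f1' (cmod w) * ((w \<bullet> (d * v)) / cmod w))) (at z)"
    unfolding w_def d_def
    by (rule has_derivative_compose[where f = g and g = A0, OF _ A0_has_derivative])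
       (use G_derivative(2)[OF assms(1,2)] w(1,2)[unfolded w_def] in \<open>simp_all add: has_field_derivative_def\<close>)
  then have "(etaA has_derivative (\<lambda>v. f1' (cmod w) * ((w \<bullet> (d * v)) / cmod w))) (at z)"
    by (rule has_derivative_transform_within_open[OF _ W(1,2)]) (use eta_in(1)[OF assms(1)] W(3,4) in auto)
  then have dA: "dA z v = f1' r * ((w \<bullet> (d * v)) / r)" for v
    using has_derivative_unique[OF eta_has_derivative(1)[OF assms(2)]] w by metis
  obtain L where L: "(B0 has_derivative L) (at (g z))" "trc L = f2' r / r - 2 / (1 - r\<^sup>2)\<^sup>2"
    using B0_has_derivative[OF w(1,2)] w(3) unfolding w_def by metis
  have "trc (dB z) = k * (f2' r / r - 2 / (1 - r\<^sup>2)\<^sup>2)"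
    using trc_dB_pullback[OF assms(1,2) L(1) W(1,2)] eta_in(2)[OF assms(1)] W(3,4) L(2) by (auto simp: k_def d_def)
  then have curl: "curl z = k * (f2' r / r)"
    unfolding curl_def metric_factor[OF assms(1,2)] by (simp add: k_def d_def r(1)[symmetric] algebra_simps)
  have lamA: "lamA z = f1 r" using eta_in(1)[OF assms(1,2) gz] by (simp add: lamA_def A0_def r)
  have "w \<bullet> (d * lamB z) = w \<bullet> (d * radial z) + w \<bullet> ((d * cnj d) * B0 w)"
    using eta_in(2)[OF assms(1,2) gz] by (simp add: lamB_def w_def d_def ring_distribs inner_add_right mult.assoc)
  also have "d * cnj d = of_real k" unfolding k_def by (rule complex_norm_square[symmetric])
  also have "w \<bullet> (of_real k * B0 w) = k * (w \<bullet> B0 w)"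
    unfolding scaleR_conv_of_real[symmetric] by (rule inner_scaleR_right)
  also have "w \<bullet> B0 w = f2 r - r\<^sup>2 / (1 - r\<^sup>2)"
    using w by (simp add: B0_def radial_def inner_diff_right power2_norm_eq_inner[symmetric])
  finally have wB: "w \<bullet> (d * lamB z) = w \<bullet> (d * radial z) + k * (f2 r - r\<^sup>2 / (1 - r\<^sup>2))" .
  \<comment> \<open>The norm of \<open>radial z\<close> is |z| / n < 1 / n, a bound that does not
    depend on the tube. It turns the term into at most k r / (1 - r^2); subtracting k r^2 / (1 -
    r^2) leaves k r / (1 + r) <= k r.\<close>
  have "w \<bullet> (d * radial z) \<le> cmod w * cmod (d * radial z)" by (rule norm_cauchy_schwarz)
  also have "cmod (d * radial z) = cmod d * (cmod z / n)"
    using n by (simp add: norm_mult radial_def n_def)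
  also have "cmod w * (cmod d * (cmod z / n)) \<le> cmod w * (cmod d * (1 / n))"
    using n assms(2) by (intro mult_left_mono divide_right_mono) (auto simp: unit_disk_def)
  also have "1 / n = cmod d / (1 - r\<^sup>2)" using dn n r1 by (auto simp: field_simps)
  also have "cmod w * (cmod d * (cmod d / (1 - r\<^sup>2))) = k * (r / (1 - r\<^sup>2))"
    by (simp add: w(3) k_def power2_eq_square)
  finally have "w \<bullet> (d * lamB z) \<le> k * (f2 r + (r / (1 - r\<^sup>2) - r\<^sup>2 / (1 - r\<^sup>2)))"
    unfolding wB by (simp add: algebra_simps)
  also have "r / (1 - r\<^sup>2) - r\<^sup>2 / (1 - r\<^sup>2) = r / (1 + r)"
  proof -
    have "1 - r\<^sup>2 = (1 + r) * (1 - r)" by (simp add: algebra_simps power2_eq_square)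
    moreover have "r - r\<^sup>2 = r * (1 - r)" by (simp add: algebra_simps power2_eq_square)
    ultimately show ?thesis using r1 by (simp add: diff_divide_distrib[symmetric])
  qed
  also have "k * (f2 r + r / (1 + r)) \<le> k * (f2 r + r)"
  proof (intro mult_left_mono add_left_mono)
    have "r / (1 + r) \<le> r / 1" by (rule divide_left_mono) (use r(2) in auto)
    then show "r / (1 + r) \<le> r" by simp
  qed (simp add: k_def)
  finally have "f1' r / r * (w \<bullet> (d * lamB z)) \<le> f1' r / r * (k * (f2 r + r))"
    using f1'_nonneg[of r] r by (intro mult_left_mono) auto
  then have "dA z (lamB z) \<le> f1' r / r * (k * (f2 r + r))" unfolding dA by simp
  then have "f1 r * (k * (f2' r / r)) - f1' r / r * (k * (f2 r + r)) \<le> lamA z * curl z - dA z (lamB z)"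
    unfolding curl lamA by linarith
  then have "n\<^sup>2 / 2 * (f1 r * (k * (f2' r / r)) - f1' r / r * (k * (f2 r + r))) \<le> contact_density z"
    unfolding contact_density_def n_def[symmetric] by (intro mult_left_mono) auto
  moreover have "n\<^sup>2 / 2 * (f1 r * (k * (f2' r / r)) - f1' r / r * (k * (f2 r + r)))
      = (k * n\<^sup>2) / (2 * r) * (f1 r * f2' r - f1' r * (f2 r + r))"
    using r by (simp add: field_simps)
  moreover have "k * n\<^sup>2 = (1 - r\<^sup>2)\<^sup>2" unfolding k_def dn[symmetric] by (simp add: power_mult_distrib)
  ultimately show ?thesis by (simp only:)
qed

text \<open>The polar formulas exclude r = 0, so the core is treated separately. There the twist is
  -2 times the pullback of \<open>prim_form\<close>, which reverses the signs of both
  \<open>lamA\<close> and \<open>curl\<close>, and their product is the one of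
  \<open>prim_form\<close>.\<close>

lemma contact_density_origin:
  assumes "g \<in> G" "z \<in> unit_disk" "g z = 0"
  shows "contact_density z = 1"
proof -
  have e: "0 < \<epsilon>/2" "\<epsilon>/2 < \<delta>" using \<epsilon> by auto
  have "\<forall>\<^sub>F w in nhds z. g w \<in> ball 0 (\<epsilon>/2)"
    using G_isCont[OF assms(1,2)] assms(3) e unfolding isCont_def
    by (metis tendsto_at_iff_tendsto_nhds topological_tendstoD open_ball centre_in_ball)
  then obtain W' where W': "open W'" "z \<in> W'" "\<And>w. w \<in> W' \<Longrightarrow> g w \<in> ball 0 (\<epsilon>/2)"
    unfolding eventually_nhds by blast
  define W where "W = W' \<inter> unit_disk"
  have W: "open W" "z \<in> W" "\<And>w. w \<in> W \<Longrightarrow> w \<in> unit_disk \<and> cmod (g w) < \<epsilon>/2"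
    using W' assms(2) by (auto simp: W_def)
  have A: "etaA w = -2" "etaB w = cnj (deriv g w) * ((-2) *\<^sub>R radial (g w))" if "w \<in> W" for w
    using eta_in[OF assms(1), of w] W(3)[OF that] e AB0_inner[of "g w"] by auto
  have "((\<lambda>w. -2) has_derivative (\<lambda>v. 0)) (at z)" by (rule has_derivative_const)
  then have "(etaA has_derivative (\<lambda>v. 0)) (at z)"
    by (rule has_derivative_transform_within_open[OF _ W(1,2)]) (simp add: A)
  then have dA: "dA z = (\<lambda>v. 0)" using has_derivative_unique[OF eta_has_derivative(1)[OF assms(2)]] by blast
  have g0: "g z \<in> unit_disk" using assms(3) by (simp add: unit_disk_def)
  have "trc (dB z) = (cmod (deriv g z))\<^sup>2 * trc (\<lambda>v. (-2) *\<^sub>R ((1 / (1 - (cmod (g z))\<^sup>2)) *\<^sub>R v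
      + (2 * (g z \<bullet> v) / (1 - (cmod (g z))\<^sup>2)\<^sup>2) *\<^sub>R g z))"
    by (rule trc_dB_pullback[OF assms(1,2) has_derivative_scaleR_right[OF radial_has_derivative[OF g0]] W(1,2) A(2)])
  also have "\<dots> = (cmod (deriv g z))\<^sup>2 * (-4)" by (simp add: trc_def assms(3))
  finally have "curl z = (cmod (deriv g z))\<^sup>2 * (-2)"
    unfolding curl_def metric_factor[OF assms(1,2)] by (simp add: assms(3))
  moreover have "(cmod (deriv g z))\<^sup>2 * (1 - (cmod z)\<^sup>2)\<^sup>2 = 1"
    using G_derivative(3)[OF assms(1,2)] assms(3) by simp
  ultimately show ?thesis
    using A(1)[OF W(2)] unfolding contact_density_def dA lamA_def by (simp add: mult.commute)
qed

lemma contact_density_bound: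
  obtains c where "c > 0" "\<And>z. z \<in> unit_disk \<Longrightarrow> c \<le> contact_density z"
proof -
  obtain c where c: "c > 0" "\<And>r. r \<in> {\<epsilon>/2..\<delta> - \<epsilon>/2} \<Longrightarrow> c \<le> f1 r * f2' r - f1' r * (f2 r + r)"
    using contact_inequality by blast
  have "min c 1 \<le> contact_density z" if z: "z \<in> unit_disk" for z
  proof (cases "in_tube z")
    case True
    then obtain g where g: "g \<in> G" "cmod (g z) < \<delta>" unfolding in_tube_def by blast
    define r where "r = cmod (g z)"
    show ?thesis
    proof (cases "r = 0")
      case True
      then show ?thesis using contact_density_origin[OF g(1) z] by (simp add: r_def)
    next
      case False
      then have r: "0 < r" "r < \<delta>" "r < 1" using g(2) \<delta> by (auto simp: r_def)
      have r2: "r\<^sup>2 < 1" using r power_strict_mono[of r 1 2] by simp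
      note bound = contact_density_tube[OF g(1) z r_def r(1,2)]
      \<comment> \<open>In both collars f1' vanishes and the lower bound evaluates to exactly 1; in
        between \<open>contact_inequality\<close> applies.\<close>
      consider "r \<le> \<epsilon>/2" | "\<delta> - \<epsilon>/2 \<le> r" | "r \<in> {\<epsilon>/2..\<delta> - \<epsilon>/2}" by fastforce
      then show ?thesis
      proof cases
        case 1
        then have "f1 r = -1" "f1' r = 0" "f2' r = - (2 * r / (1 - r\<^sup>2)\<^sup>2)"
          using f_inner f'_inner r(1) by auto
        then show ?thesis using bound r r2 by simp
      next
        case 2
        then have "f1 r = 1" "f1' r = 0" "f2' r = 2 * r / (1 - r\<^sup>2)\<^sup>2"
          using f_outer f'_outer r(2) by auto
        then show ?thesis using bound r r2 by simp
      next
        case 3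
        \<comment> \<open>The factor (1 - r^2)^2 / (2 r) is at least 1, since (8/9)^2 > 2/3 >= 2
          r.\<close>
        have "r\<^sup>2 \<le> (1/3)\<^sup>2" using r \<delta> by (intro power_mono) auto
        then have "(8/9)\<^sup>2 \<le> (1 - r\<^sup>2)\<^sup>2" by (intro power_mono) (auto simp: power2_eq_square)
        then have "2 * r \<le> (1 - r\<^sup>2)\<^sup>2" using r \<delta> by (simp add: power2_eq_square)
        then have "1 \<le> (1 - r\<^sup>2)\<^sup>2 / (2 * r)" using r by simp
        then have "1 * c \<le> (1 - r\<^sup>2)\<^sup>2 / (2 * r) * (f1 r * f2' r - f1' r * (f2 r + r))"
          using c(1) c(2)[OF 3] by (intro mult_mono) auto
        then show ?thesis using bound by linarith
      qed
    qed
  next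
    case False
    obtain W where W: "open W" "z \<in> W" "\<And>w. w \<in> W \<Longrightarrow> etaA w = 0 \<and> etaB w = 0"
      using not_tube_open[OF z False] by metis
    have A: "(etaA has_derivative (\<lambda>v. 0)) (at z)"
      by (rule has_derivative_transform_within_open[OF has_derivative_const[of 0] W(1,2)]) (simp add: W(3))
    have B: "(etaB has_derivative (\<lambda>v. 0)) (at z)"
      by (rule has_derivative_transform_within_open[OF has_derivative_const[of 0] W(1,2)]) (simp add: W(3))
    have "dA z = (\<lambda>v. 0)" "dB z = (\<lambda>v. 0)"
      using has_derivative_unique[OF eta_has_derivative(1)[OF z] A] has_derivative_unique[OF eta_has_derivative(2)[OF z] B] by blast+
    then show ?thesis
      using unit_disk_pos[OF z] W(3)[OF W(2)] by (simp add: contact_density_def lamA_def curl_def trc_def)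
  qed
  then show ?thesis using c(1) by (intro that[of "min c 1"]) auto
qed

end

section \<open>Charts of the cylinder and of its quotient\<close>

context hyperbolic_surface
begin

lemma in_atlas_chart:
  assumes "x \<in> (\<Union>c\<in>prod_atlas circle_atlas B. snd c ` fst c)"
  shows "\<exists>d. d \<in> prod_atlas circle_atlas B \<and> x \<in> snd d ` fst d"
  using assms by blast

lemma continuous_p\<Sigma>: "continuous_on unit_disk p\<Sigma>"
  using covering_space_imp_continuous[OF covering_p\<Sigma>] .

lemma p\<Sigma>_image: "p\<Sigma> ` unit_disk = \<Sigma>"
  using covering_space_imp_surjective[OF covering_p\<Sigma>] .

lemma smooth_manifold_M: "smooth_manifold (sphere 0 1 \<times> \<Sigma>) (M_atlas p\<Sigma>)"
  by (rule smooth_manifold_prod_atlas[OF lifts_p\<Sigma>(2) order_refl Hausdorff_\<Sigma> second_countable_\<Sigma>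
        continuous_p\<Sigma> p\<Sigma>_open_map surface_atlas_cover])

lemma smooth_manifold_cyl: "smooth_manifold cyl cyl_atlas"
proof (rule smooth_manifold_prod_atlas[OF lifts_id disk_atlas_subset])
  show "Hausdorff_space (top_of_set unit_disk)" by (simp add: Hausdorff_space_subtopology)
  show "openin (top_of_set unit_disk) (id ` W)" if "open W" "W \<subseteq> unit_disk" for W
    using that openin_open_eq[OF open_unit_disk] by simp
qed (auto intro: second_countable_top_of_set)

lemma M_cover: "(\<Union>c\<in>M_atlas p\<Sigma>. snd c ` fst c) = sphere 0 1 \<times> \<Sigma>"
  using smooth_manifold_M unfolding smooth_manifold_def by blast

lemma cyl_cover: "(\<Union>c\<in>cyl_atlas. snd c ` fst c) = cyl"
  using smooth_manifold_cyl unfolding smooth_manifold_def by blast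

lemma cyl_chartE:
  assumes "c \<in> cyl_atlas"
  obtains U where "c = (U \<times> unit_disk, map_prod cis id)" "open U" "inj_on cis U"
  using prod_atlasE[OF assms disk_atlas_subset] by (metis Pair_inject singletonD)

lemma M_chartE:
  assumes "d \<in> M_atlas p\<Sigma>"
  obtains U V where "d = (U \<times> V, map_prod cis p\<Sigma>)" "open U" "inj_on cis U" "open V" "V \<subseteq> unit_disk" "inj_on p\<Sigma> V"
  using prod_atlasE[OF assms order_refl] by metis

lemma cyl_image: "c \<in> cyl_atlas \<Longrightarrow> u \<in> fst c \<Longrightarrow> snd c u = (cis (fst u), snd u) \<and> snd u \<in> unit_disk"
  by (erule cyl_chartE) (auto simp: map_prod_def split_beta)

lemma M_image: "d \<in> M_atlas p\<Sigma> \<Longrightarrow> u \<in> fst d \<Longrightarrow> snd d u = (cis (fst u), p\<Sigma> (snd u)) \<and> snd u \<in> unit_disk"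
  by (erule M_chartE) (auto simp: map_prod_def split_beta)

lemma target_chart_some:
  assumes "\<exists>d. d \<in> B \<and> F (snd c u) \<in> snd d ` fst d" "u \<in> fst c"
  shows "target_chart F B c u \<in> B \<and> u \<in> rep_dom F c (target_chart F B c u)"
proof -
  have "target_chart F B c u \<in> B \<and> F (snd c u) \<in> snd (target_chart F B c u) ` fst (target_chart F B c u)"
    unfolding target_chart_def by (rule someI_ex[OF assms(1)])
  then show ?thesis using assms(2) by (simp add: rep_dom_def)
qed

lemma M_rep:
  assumes "c \<in> M_atlas p\<Sigma>" "d \<in> M_atlas p\<Sigma>" "(t, z) \<in> rep_dom id c d"
  obtains k g where "g \<in> G" "z \<in> unit_disk" "(t + k, g z) \<in> fst d" "local_rep id c d (t, z) = (t + k, g z)"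
    "D_rep id c d (t, z) = (\<lambda>(\<tau>, v). (\<tau>, deriv g z * v))"
  by (rule rep_derivE[OF lifts_p\<Sigma>(2) assms(1) order_refl assms(2) order_refl, unfolded map_prod.id, OF assms(3)])
     (rule that, assumption+)

lemma p_rep:
  assumes "c \<in> cyl_atlas" "d \<in> M_atlas p\<Sigma>" "(t, z) \<in> rep_dom (map_prod id p\<Sigma>) c d"
  obtains k g where "g \<in> G" "z \<in> unit_disk" "(t + k, g z) \<in> fst d" "local_rep (map_prod id p\<Sigma>) c d (t, z) = (t + k, g z)"
    "D_rep (map_prod id p\<Sigma>) c d (t, z) = (\<lambda>(\<tau>, v). (\<tau>, deriv g z * v))"
  by (rule rep_derivE[OF lifts_p\<Sigma>(1) assms(1) disk_atlas_subset assms(2) order_refl assms(3)])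
     (rule that, assumption+)

lemma deriv_cong_unit_disk:
  assumes "\<And>x. x \<in> unit_disk \<Longrightarrow> f x = g x" "z \<in> unit_disk"
  shows "deriv f z = deriv g z"
proof (rule deriv_cong_ev[OF _ refl])
  show "\<forall>\<^sub>F x in nhds z. f x = g x"
    unfolding eventually_nhds using assms by (intro exI[of _ unit_disk]) simp
qed

lemma cyl_rep:
  assumes "c \<in> cyl_atlas" "d \<in> cyl_atlas" "g \<in> G" "(t, z) \<in> rep_dom (map_prod id g) c d"
  obtains k where "z \<in> unit_disk" "(t + k, g z) \<in> fst d" "local_rep (map_prod id g) c d (t, z) = (t + k, g z)"
    "D_rep (map_prod id g) c d (t, z) = (\<lambda>(\<tau>, v). (\<tau>, deriv g z * v))"
proof -
  obtain k h where h: "h \<in> G" "(t + k, h z) \<in> fst d" "local_rep (map_prod id g) c d (t, z) = (t + k, h z)"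
    "D_rep (map_prod id g) c d (t, z) = (\<lambda>(\<tau>, v). (\<tau>, deriv h z * v))" "z \<in> unit_disk"
    "\<And>x. x \<in> unit_disk \<Longrightarrow> g (id x) = id (h x)"
    by (rule rep_derivE[OF lifts_G[OF assms(3)] assms(1) disk_atlas_subset assms(2) disk_atlas_subset assms(4)])
       (rule that, assumption+)
  \<comment> \<open>The general computation only promises some element of \<open>G\<close> lying
    over \<open>g\<close>; for q = \<open>id\<close> the fibres are points, so it must be
    \<open>g\<close>.\<close>
  have "h = g" using h(6) by (intro G_eqI[OF h(1) assms(3)]) simp
  then show ?thesis using that[of k] h by simp
qed

lemma cyl_transition:
  assumes "c \<in> cyl_atlas" "d \<in> cyl_atlas" "(t, z) \<in> rep_dom id c d"
  obtains k where "z \<in> unit_disk" "(t + k, z) \<in> fst d" "local_rep id c d (t, z) = (t + k, z)"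
    "D_rep id c d (t, z) = (\<lambda>v. v)"
proof -
  obtain k h where h: "h \<in> G" "(t + k, h z) \<in> fst d" "local_rep id c d (t, z) = (t + k, h z)"
    "D_rep id c d (t, z) = (\<lambda>(\<tau>, v). (\<tau>, deriv h z * v))" "z \<in> unit_disk"
    "\<And>x. x \<in> unit_disk \<Longrightarrow> id (id x) = id (h x)"
    by (rule rep_derivE[OF lifts_id assms(1) disk_atlas_subset assms(2) disk_atlas_subset, unfolded map_prod.id, OF assms(3)])
       (rule that, assumption+)
  have "deriv h z = deriv (\<lambda>x. x) z" by (rule deriv_cong_unit_disk[OF _ h(5)]) (use h(6) in simp)
  then have "deriv h z = 1" by simp
  then show ?thesis using that[of k] h by (simp add: split_beta')
qed

lemma p_in_chart:
  assumes "c \<in> cyl_atlas" "u \<in> fst c"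
  shows "\<exists>d. d \<in> M_atlas p\<Sigma> \<and> map_prod id p\<Sigma> (snd c u) \<in> snd d ` fst d"
proof (rule in_atlas_chart)
  show "map_prod id p\<Sigma> (snd c u) \<in> (\<Union>d\<in>M_atlas p\<Sigma>. snd d ` fst d)"
    unfolding M_cover using cyl_image[OF assms] p\<Sigma>_image by auto
qed

lemma G_in_chart:
  assumes "c \<in> cyl_atlas" "u \<in> fst c" "g \<in> G"
  shows "\<exists>d. d \<in> cyl_atlas \<and> map_prod id g (snd c u) \<in> snd d ` fst d"
proof (rule in_atlas_chart)
  show "map_prod id g (snd c u) \<in> (\<Union>d\<in>cyl_atlas. snd d ` fst d)"
    unfolding cyl_cover using cyl_image[OF assms(1,2)] G_maps[OF assms(3)] by auto
qed

lemma oriented_M: "oriented_3_manifold (sphere 0 1 \<times> \<Sigma>) (M_atlas p\<Sigma>)"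
  unfolding oriented_3_manifold_def
proof (intro conjI ballI smooth_manifold_M)
  fix c d u assume cd: "c \<in> M_atlas p\<Sigma>" "d \<in> M_atlas p\<Sigma>" "u \<in> rep_dom id c d"
  obtain t z where u: "u = (t, z)" by (cases u)
  obtain k g where g: "g \<in> G" "z \<in> unit_disk" "D_rep id c d (t, z) = (\<lambda>(\<tau>, v). (\<tau>, deriv g z * v))"
    by (rule M_rep[OF cd(1,2) cd(3)[unfolded u]])
  have "cross2 (deriv g z * 1) (deriv g z * \<i>) > 0"
    unfolding cross2_mult_mult using G_derivative(4)[OF g(1,2)] by (simp add: cross2_def)
  then show "vol3 (D_rep id c d u E1) (D_rep id c d u E2) (D_rep id c d u E3) > 0"
    unfolding u g(3) by (simp add: vol3_def wedge12_def)
qed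

lemma map_prod_homeo_image: "map_prod id p\<Sigma> ` cyl = sphere 0 1 \<times> \<Sigma>"
  using p\<Sigma>_image by (simp add: map_prod_surj_on)

lemma smooth_covering_p: "smooth_covering cyl cyl_atlas (map_prod id p\<Sigma>) (sphere 0 1 \<times> \<Sigma>) (M_atlas p\<Sigma>)"
  unfolding smooth_covering_def smooth_map_def
proof (intro conjI ballI)
  show cov: "covering_space cyl (map_prod id p\<Sigma>) (sphere 0 1 \<times> \<Sigma>)"
    by (rule covering_space_circle_Times[OF covering_p\<Sigma>])
  show "continuous_on cyl (map_prod id p\<Sigma>)" using covering_space_imp_continuous[OF cov] .
  show "map_prod id p\<Sigma> ` cyl \<subseteq> sphere 0 1 \<times> \<Sigma>" using map_prod_homeo_image by simp
  fix c d assume cd: "c \<in> cyl_atlas" "d \<in> M_atlas p\<Sigma>"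
  show "smooth_on (rep_dom (map_prod id p\<Sigma>) c d) (local_rep (map_prod id p\<Sigma>) c d)"
    by (rule smooth_on_rep[OF lifts_p\<Sigma>(1) cd(1) disk_atlas_subset cd(2) order_refl])
  fix u assume u: "u \<in> rep_dom (map_prod id p\<Sigma>) c d"
  obtain t z where tz: "u = (t, z)" by (cases u)
  obtain k g where g: "g \<in> G" "z \<in> unit_disk" "D_rep (map_prod id p\<Sigma>) c d (t, z) = (\<lambda>(\<tau>, v). (\<tau>, deriv g z * v))"
    by (rule p_rep[OF cd u[unfolded tz]])
  have nz: "deriv g z \<noteq> 0" using G_derivative(4)[OF g(1,2)] .
  show "bij (D_rep (map_prod id p\<Sigma>) c d u)"
    unfolding tz g(3)
    by (rule bij_betw_byWitness[where f' = "\<lambda>(\<tau>, v). (\<tau>, v / deriv g z)"]) (use nz in auto)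
qed

lemma snd_rep:
  assumes "d \<in> M_atlas p\<Sigma>" "u \<in> fst d" "(V, p\<Sigma>) \<in> surface_atlas p\<Sigma>" "p\<Sigma> (snd u) \<in> p\<Sigma> ` V"
  obtains g where "g \<in> G" "local_rep snd d (V, p\<Sigma>) u = g (snd u)" "g (snd u) \<in> V"
    "D_rep snd d (V, p\<Sigma>) u = (\<lambda>v. deriv g (snd u) * snd v)"
proof -
  have V: "open V" "inj_on p\<Sigma> V" "V \<subseteq> unit_disk" using assms(3) by (auto simp: covering_atlas_def)
  have z: "snd u \<in> unit_disk" using M_image[OF assms(1,2)] by blast
  obtain w where w: "w \<in> V" "p\<Sigma> (snd u) = p\<Sigma> w" using assms(4) by blast
  then obtain g where g: "g \<in> G" "w = g (snd u)" using p\<Sigma>_eq_iff[OF z] V(3) by blast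
  obtain W where W: "open W" "snd u \<in> W" "W \<subseteq> unit_disk" "\<And>x. x \<in> W \<Longrightarrow> g x \<in> V \<and> inv_into V p\<Sigma> (p\<Sigma> x) = g x"
    using inv_into_lift[OF V(1,2) open_unit_disk z G_isCont[OF g(1) z], of p\<Sigma>] p\<Sigma>_G[OF g(1)] w(1) g(2) by metis
  have rep: "local_rep snd d (V, p\<Sigma>) x = g (snd x)" if "x \<in> UNIV \<times> W" for x
  proof -
    obtain U V' where "d = (U \<times> V', map_prod cis p\<Sigma>)" using M_chartE[OF assms(1)] by metis
    then show ?thesis using W(4)[of "snd x"] that by (auto simp: local_rep_def)
  qed
  have "((\<lambda>x. g (snd x)) has_derivative (\<lambda>v. deriv g (snd u) * snd v)) (at u)"
    by (rule has_derivative_compose[where f = snd and g = g and g' = "\<lambda>v. deriv g (snd u) * v",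
          OF has_derivative_snd[OF has_derivative_ident]])
       (use G_derivative(2)[OF g(1) z] in \<open>simp add: has_field_derivative_def\<close>)
  then have "(local_rep snd d (V, p\<Sigma>) has_derivative (\<lambda>v. deriv g (snd u) * snd v)) (at u)"
    by (rule has_derivative_transform_within_open[OF _ open_Times[OF open_UNIV W(1)]])
       (use W(2) rep in \<open>auto simp: mem_Times_iff\<close>)
  then have "D_rep snd d (V, p\<Sigma>) u = (\<lambda>v. deriv g (snd u) * snd v)" by (rule frechet_derivativeI)
  moreover have "u \<in> UNIV \<times> W" using W(2) by (simp add: mem_Times_iff)
  ultimately show ?thesis using that[OF g(1)] rep w(1) g(2) by blast
qed

text \<open>The selected chart of the surface may use another sheet of the covering. The element
  \<open>g\<close> that connects the sheets disappears by \<open>area_invariant\<close>.\<close>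

lemma pull2_area:
  assumes "d \<in> M_atlas p\<Sigma>" "u \<in> fst d"
  shows "pull2 snd (surface_atlas p\<Sigma>) \<omega>\<Sigma> d u v w = 2 / (1 - (cmod (snd u))\<^sup>2)\<^sup>2 * cross2 (snd v) (snd w)"
proof -
  have z: "snd u \<in> unit_disk" "snd d u = (cis (fst u), p\<Sigma> (snd u))" using M_image[OF assms] by blast+
  have "p\<Sigma> (snd u) \<in> (\<Union>c\<in>surface_atlas p\<Sigma>. snd c ` fst c)"
    unfolding surface_atlas_cover using z p\<Sigma>_image by blast
  then have "\<exists>e. e \<in> surface_atlas p\<Sigma> \<and> snd (snd d u) \<in> snd e ` fst e"
    unfolding z(2) snd_conv by blast
  from target_chart_some[of "surface_atlas p\<Sigma>" snd d u, OF this assms(2)]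
  have e: "target_chart snd (surface_atlas p\<Sigma>) d u \<in> surface_atlas p\<Sigma>"
    "u \<in> rep_dom snd d (target_chart snd (surface_atlas p\<Sigma>) d u)" by blast+
  then obtain V where V: "target_chart snd (surface_atlas p\<Sigma>) d u = (V, p\<Sigma>)" by (auto simp: covering_atlas_def)
  have VA: "(V, p\<Sigma>) \<in> surface_atlas p\<Sigma>" "p\<Sigma> (snd u) \<in> p\<Sigma> ` V"
    using e z unfolding V by (auto simp: rep_dom_def)
  obtain g where g: "g \<in> G" "local_rep snd d (V, p\<Sigma>) u = g (snd u)" "g (snd u) \<in> V"
    "D_rep snd d (V, p\<Sigma>) u = (\<lambda>v. deriv g (snd u) * snd v)"
    using snd_rep[OF assms VA] by metis
  have "pull2 snd (surface_atlas p\<Sigma>) \<omega>\<Sigma> d u v w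
      = \<omega>\<Sigma> (V, p\<Sigma>) (g (snd u)) (deriv g (snd u) * snd v) (deriv g (snd u) * snd w)"
    by (simp only: pull2_def Let_def V g(2,4))
  also have "\<dots> = hyp_area undefined (g (snd u)) (deriv g (snd u) * snd v) (deriv g (snd u) * snd w)"
    by (rule area_chart[OF VA(1) g(3)])
  also have "\<dots> = hyp_area undefined (snd u) (snd v) (snd w)"
    using area_invariant[OF g(1) z(1)] by (simp only: G_derivative(1)[OF g(1) z(1)])
  finally show ?thesis by (simp add: hyp_area_def)
qed

text \<open>The hyperbolic metric is invariant under \<open>G\<close>, so a formula without
  reference to the chart defines a tensor field on the quotient, and its pullback is given by the
  same formula.\<close>

definition gM :: "(R3, 'b) field2" where
  "gM = (\<lambda>c u v w. fst v * fst w + hyp_metric (snd u) (snd v) (snd w))"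

lemma gM_invariant:
  assumes "g \<in> G" "z \<in> unit_disk"
  shows "hyp_metric (g z) (deriv g z * v) (deriv g z * w) = hyp_metric z v w"
  using G_isometry[OF assms, of v w] unfolding G_derivative(1)[OF assms] .

lemma bilinear_hyp_metric: "bilinear (\<lambda>v w. fst v * fst w + hyp_metric z (snd v) (snd w) :: real)"
  unfolding bilinear_def hyp_metric_def
  by (auto intro!: linearI simp: algebra_simps inner_add_left inner_add_right add_divide_distrib)

lemma Riemannian_gM: "Riemannian_metric (M_atlas p\<Sigma>) gM"
  unfolding Riemannian_metric_def tensor2_def
proof (intro conjI ballI allI impI)
  fix c d u v w assume cd: "c \<in> M_atlas p\<Sigma>" "d \<in> M_atlas p\<Sigma>" "u \<in> rep_dom id c d"
  obtain t z where u: "u = (t, z)" by (cases u)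
  obtain k g where g: "g \<in> G" "z \<in> unit_disk" "local_rep id c d (t, z) = (t + k, g z)"
    "D_rep id c d (t, z) = (\<lambda>(\<tau>, v). (\<tau>, deriv g z * v))"
    by (rule M_rep[OF cd(1,2) cd(3)[unfolded u]])
  show "gM c u v w = gM d (local_rep id c d u) (D_rep id c d u v) (D_rep id c d u w)"
    unfolding u g(3,4) gM_def by (simp add: split_beta gM_invariant[OF g(1,2)])
next
  fix c assume c: "c \<in> M_atlas p\<Sigma>"
  obtain U V where UV: "c = (U \<times> V, map_prod cis p\<Sigma>)" "open U" "open V" "V \<subseteq> unit_disk"
    using M_chartE[OF c] by metis
  have op: "open (U \<times> V)" using UV by (simp add: open_Times)
  show "smooth_on (fst c) (\<lambda>u. gM c u v w)" for v w :: R3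
    unfolding smooth_on_def
  proof
    fix k
    have s: "Ck_on k (U \<times> V) (snd :: R3 \<Rightarrow> complex)" by (rule Ck_on_bounded_linear_apply[OF bounded_linear_snd])
    have "Ck_on k (U \<times> V) (\<lambda>u. inverse (1 - snd u \<bullet> snd u))"
      by (rule Ck_on_compose[OF op _ Ck_on_diff[OF op Ck_on_const Ck_on_inner[OF op s s]] Ck_on_inverse_pos])
         (use UV(4) in \<open>auto simp: unit_disk_def power2_norm_eq_inner[symmetric] abs_square_less_1\<close>)
    then have "Ck_on k (U \<times> V) (\<lambda>u. fst v * fst w + (snd v \<bullet> snd w) * (inverse (1 - snd u \<bullet> snd u) * inverse (1 - snd u \<bullet> snd u)))"
      by (intro Ck_on_add Ck_on_mult op Ck_on_const)
    then show "Ck_on k (fst c) (\<lambda>u. gM c u v w)"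
      unfolding UV(1) fst_conv
    proof (rule Ck_on_cong[OF op])
      show "gM (U \<times> V, map_prod cis p\<Sigma>) u v w = fst v * fst w + (snd v \<bullet> snd w) * (inverse (1 - snd u \<bullet> snd u) * inverse (1 - snd u \<bullet> snd u))" for u
        unfolding gM_def hyp_metric_def power2_norm_eq_inner by (simp add: divide_inverse power2_eq_square)
    qed
  qed
  fix u assume u: "u \<in> fst c"
  show "bilinear (gM c u)" unfolding gM_def by (rule bilinear_hyp_metric)
  show "gM c u v w = gM c u w v" for v w by (simp add: gM_def hyp_metric_def inner_commute mult.commute)
  show "gM c u v v > 0" if "v \<noteq> 0" for v
  proof -
    have pos: "0 < (1 - (cmod (snd u))\<^sup>2)\<^sup>2" using unit_disk_pos M_image[OF c u] by (intro zero_less_power) blast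
    show ?thesis
    proof (cases "snd v = 0")
      case True
      then have "fst v \<noteq> 0" using that by (auto simp: prod_eq_iff)
      then show ?thesis using True by (simp add: gM_def hyp_metric_def flip: power2_eq_square)
    next
      case False
      then have "0 < hyp_metric (snd u) (snd v) (snd v)" using pos by (simp add: hyp_metric_def)
      then show ?thesis unfolding gM_def by (smt (verit) zero_le_square)
    qed
  qed
qed

lemma pull2_gM:
  assumes "c \<in> cyl_atlas" "u \<in> fst c"
  shows "pull2 (map_prod id p\<Sigma>) (M_atlas p\<Sigma>) gM c u v w = fst v * fst w + hyp_metric (snd u) (snd v) (snd w)"
proof -
  obtain t z where u: "u = (t, z)" by (cases u)
  define d where "d = target_chart (map_prod id p\<Sigma>) (M_atlas p\<Sigma>) c u"
  have d: "d \<in> M_atlas p\<Sigma>" "(t, z) \<in> rep_dom (map_prod id p\<Sigma>) c d"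
    using target_chart_some[of "M_atlas p\<Sigma>" "map_prod id p\<Sigma>" c u, OF p_in_chart[OF assms] assms(2)] unfolding d_def u by blast+
  obtain k g where g: "g \<in> G" "z \<in> unit_disk" "local_rep (map_prod id p\<Sigma>) c d (t, z) = (t + k, g z)"
    "D_rep (map_prod id p\<Sigma>) c d (t, z) = (\<lambda>(\<tau>, v). (\<tau>, deriv g z * v))"
    by (rule p_rep[OF assms(1) d])
  show ?thesis
    unfolding pull2_def Let_def d_def[symmetric] unfolding u g(3,4) gM_def
    by (simp add: split_beta gM_invariant[OF g(1,2)])
qed

end

section \<open>The virtual contact structure\<close>

lemma continuous_on_mult_support:
  fixes \<phi> h :: "'e::euclidean_space \<Rightarrow> real"
  assumes "continuous_on UNIV \<phi>" "compact K" "\<And>u. u \<notin> K \<Longrightarrow> \<phi> u = 0" "open S" "K \<subseteq> S" "continuous_on S h"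
  shows "continuous_on UNIV (\<lambda>u. \<phi> u * h u)"
proof -
  have "continuous_on S (\<lambda>u. \<phi> u * h u)"
    using assms(1,6) by (intro continuous_on_mult) (auto intro: continuous_on_subset)
  moreover have "continuous_on (- K) (\<lambda>u. \<phi> u * h u)"
    by (rule continuous_on_eq[OF continuous_on_const[of _ 0]]) (simp add: assms(3))
  moreover have "open (- K)" using assms(2) by (simp add: compact_imp_closed open_Compl)
  ultimately have "continuous_on (S \<union> - K) (\<lambda>u. \<phi> u * h u)" using assms(4) by (intro continuous_on_open_Un)
  moreover have "S \<union> - K = UNIV" using assms(5) by blast
  ultimately show ?thesis by simp
qed

lemma frechet_derivative_support:
  fixes \<phi> :: "'e::euclidean_space \<Rightarrow> real"
  assumes "compact K" "\<And>u. u \<notin> K \<Longrightarrow> \<phi> u = 0" "u \<notin> K"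
  shows "frechet_derivative \<phi> (at u) v = 0"
proof -
  have "frechet_derivative \<phi> (at u) = frechet_derivative (\<lambda>_. 0) (at u)"
    by (rule frechet_derivative_cong_open[of "- K"]) (use assms in \<open>auto simp: compact_imp_closed open_Compl\<close>)
  then show ?thesis by simp
qed

lemma has_derivative_line:
  assumes "(f has_derivative D) (at x)"
  shows "((\<lambda>s. f (x + s *\<^sub>R v)) has_real_derivative D v) (at 0)"
proof -
  have "((\<lambda>s. x + s *\<^sub>R v) has_derivative (\<lambda>s. s *\<^sub>R v)) (at 0)"
    by (auto intro!: derivative_eq_intros)
  moreover have "(f has_derivative D) (at (x + 0 *\<^sub>R v))" using assms by simp
  ultimately have "((\<lambda>s. f (x + s *\<^sub>R v)) has_derivative (\<lambda>s. D (s *\<^sub>R v))) (at 0)"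
    by (rule has_derivative_compose)
  then show ?thesis
    using has_derivative_linear[OF assms]
    by (simp add: has_field_derivative_def linear_cmul mult.commute[of _ "D v"])
qed

lemma has_derivative_mult_support:
  fixes \<phi> h :: "'e::euclidean_space \<Rightarrow> real"
  assumes "Ck_on (Suc 0) UNIV \<phi>" "compact K" "\<And>u. u \<notin> K \<Longrightarrow> \<phi> u = 0" "K \<subseteq> S"
    "\<And>u. u \<in> S \<Longrightarrow> (h has_derivative D u) (at u)"
  shows "((\<lambda>s. \<phi> (u + s *\<^sub>R v) * h (u + s *\<^sub>R v)) has_real_derivative
      frechet_derivative \<phi> (at u) v * h u + \<phi> u * D u v) (at 0)"
proof (cases "u \<in> S")
  case True
  have "((\<lambda>s. \<phi> (u + s *\<^sub>R v)) has_real_derivative frechet_derivative \<phi> (at u) v) (at 0)"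
    by (intro has_derivative_line Ck_on_has_derivative[OF assms(1)]) simp
  moreover have "((\<lambda>s. h (u + s *\<^sub>R v)) has_real_derivative D u v) (at 0)"
    by (intro has_derivative_line assms(5) True)
  ultimately have "((\<lambda>s. \<phi> (u + s *\<^sub>R v) * h (u + s *\<^sub>R v)) has_real_derivative
      frechet_derivative \<phi> (at u) v * h (u + 0 *\<^sub>R v) + D u v * \<phi> (u + 0 *\<^sub>R v)) (at 0)"
    by (rule DERIV_mult)
  then show ?thesis by (simp add: mult.commute)
next
  case False
  then have uK: "u \<notin> K" using assms(4) by blast
  have "open ((\<lambda>s. u + s *\<^sub>R v) -` (- K))"
    by (intro open_vimage) (auto simp: assms(2) compact_imp_closed open_Compl intro!: continuous_intros)
  then have "((\<lambda>s. \<phi> (u + s *\<^sub>R v) * h (u + s *\<^sub>R v)) has_real_derivative 0) (at 0)"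
    by (intro has_field_derivative_transform_within_open[OF DERIV_const[of 0]]) (use uK assms(3) in auto)
  then show ?thesis using frechet_derivative_support[OF assms(2,3) uK] assms(3)[OF uK] by simp
qed

lemma conorm_le:
  assumes "\<And>v. g c u v v \<le> 1 \<Longrightarrow> \<bar>a c u v\<bar> \<le> C" "g c u 0 0 \<le> 1"
  shows "conorm g a c u \<le> C"
  unfolding conorm_def by (rule cSup_least) (use assms in auto)

context lutz_twist
begin

text \<open>Coordinate expressions without the chart argument: as all charts restrict (t, z) |->
  (cis t, q z), invariance under \<open>G\<close> makes one formula valid on the cylinder and on the
  quotient.\<close>

definition etaE :: "R3 \<Rightarrow> R3 \<Rightarrow> real" where
  "etaE u v = etaA (snd u) * fst v + cross2 (etaB (snd u)) (snd v)"

definition lamE :: "R3 \<Rightarrow> R3 \<Rightarrow> real" where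
  "lamE u v = lamA (snd u) * fst v + cross2 (lamB (snd u)) (snd v)"

definition omE :: "R3 \<Rightarrow> R3 \<Rightarrow> R3 \<Rightarrow> real" where
  "omE u v w = dA (snd u) (snd v) * fst w - dA (snd u) (snd w) * fst v + curl (snd u) * cross2 (snd v) (snd w)"

lemma eta_loc_eq:
  assumes "cmod (snd u) < \<delta>"
  shows "eta_loc \<delta> f1 f2 c u v = A0 (snd u) * fst v + cross2 (B0 (snd u)) (snd v)"
  using assms
  by (simp add: eta_loc_def twist_form_def prim_form_def dphi_def A0_def B0_def radial_def cross2_diff_left
      cross2_scaleR_left split_beta left_diff_distrib)

lemma pull1_eta_loc:
  assumes "c \<in> cyl_atlas" "u \<in> fst c" "g \<in> G"
  shows "pull1 (map_prod id g) cyl_atlas (eta_loc \<delta> f1 f2) c u v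
    = (if cmod (g (snd u)) < \<delta> then etaE u v else 0)"
proof -
  obtain t z where u: "u = (t, z)" by (cases u)
  define d where "d = target_chart (map_prod id g) cyl_atlas c u"
  have d: "d \<in> cyl_atlas" "(t, z) \<in> rep_dom (map_prod id g) c d"
    using target_chart_some[of cyl_atlas "map_prod id g" c u, OF G_in_chart[OF assms] assms(2)] unfolding d_def u by blast+
  obtain k where k: "z \<in> unit_disk" "local_rep (map_prod id g) c d (t, z) = (t + k, g z)"
    "D_rep (map_prod id g) c d (t, z) = (\<lambda>(\<tau>, v). (\<tau>, deriv g z * v))"
    by (rule cyl_rep[OF assms(1) d(1) assms(3) d(2)]) (rule that, assumption+)
  have "pull1 (map_prod id g) cyl_atlas (eta_loc \<delta> f1 f2) c u v
    = eta_loc \<delta> f1 f2 d (t + k, g z) (fst v, deriv g z * snd v)"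
    unfolding pull1_def Let_def d_def[symmetric] unfolding u k(2,3) by (simp add: split_beta)
  also have "\<dots> = (if cmod (g (snd u)) < \<delta> then etaE u v else 0)"
  proof (cases "cmod (g z) < \<delta>")
    case True
    then show ?thesis
      by (simp add: eta_loc_eq u etaE_def eta_in[OF assms(3) k(1) True] cross2_mult_right)
  qed (simp add: eta_loc_def u)
  finally show ?thesis .
qed

lemma eta_eq:
  assumes "c \<in> cyl_atlas" "u \<in> fst c"
  shows "eta G \<delta> f1 f2 c u v = etaE u v"
proof (cases "in_tube (snd u)")
  case True
  then obtain g where g: "g \<in> G" "cmod (g (snd u)) < \<delta>" unfolding in_tube_def by blast
  have z: "snd u \<in> unit_disk" using cyl_image[OF assms] by blast
  have "eta G \<delta> f1 f2 c u v = (\<Sum>\<^sub>\<infinity>h\<in>{g}. etaE u v)"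
    unfolding eta_def
  proof (rule infsum_cong_neutral)
    show "pull1 (map_prod id h) cyl_atlas (eta_loc \<delta> f1 f2) c u v = 0" if "h \<in> G - {g}" for h
      using that tube_unique[OF g(1) _ z g(2), of h] by (auto simp: pull1_eta_loc[OF assms])
    show "pull1 (map_prod id h) cyl_atlas (eta_loc \<delta> f1 f2) c u v = etaE u v" if "h \<in> G \<inter> {g}" for h
      using that g by (auto simp: pull1_eta_loc[OF assms])
  qed (use g in auto)
  then show ?thesis by simp
next
  case False
  then have "pull1 (map_prod id h) cyl_atlas (eta_loc \<delta> f1 f2) c u v = 0" if "h \<in> G" for h
    using that unfolding pull1_eta_loc[OF assms that] in_tube_def by auto
  then have "eta G \<delta> f1 f2 c u v = 0" unfolding eta_def by (rule infsum_0)
  then show ?thesis using False by (simp add: etaE_def eta_out)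
qed

section \<open>Descent to the quotient and exterior derivatives\<close>

lemma etaE_invariant:
  assumes "g \<in> G" "z \<in> unit_disk"
  shows "etaE (s, g z) (\<tau>, deriv g z * v) = etaE (t, z) (\<tau>, v)"
  by (simp add: etaE_def eta_invariant(1)[OF assms] eta_invariant(2)[OF assms] cross2_mult_right)

lemma linear_etaE: "linear (etaE u)" "linear (lamE u)"
  unfolding etaE_def[abs_def] lamE_def[abs_def] by (rule linearI; simp add: cross2_def algebra_simps)+

lemma form1_etaE: "form1 (M_atlas p\<Sigma>) (\<lambda>c. etaE)"
  unfolding form1_def
proof (intro conjI ballI allI linear_etaE)
  fix c d u v assume cd: "c \<in> M_atlas p\<Sigma>" "d \<in> M_atlas p\<Sigma>" "u \<in> rep_dom id c d"
  obtain t z where u: "u = (t, z)" by (cases u)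
  obtain k g where g: "g \<in> G" "z \<in> unit_disk" "local_rep id c d (t, z) = (t + k, g z)"
    "D_rep id c d (t, z) = (\<lambda>(\<tau>, v). (\<tau>, deriv g z * v))"
    by (rule M_rep[OF cd(1,2) cd(3)[unfolded u]])
  show "etaE u v = etaE (local_rep id c d u) (D_rep id c d u v)"
    unfolding u g(3,4) using etaE_invariant[OF g(1,2), of "t + k" "fst v" "snd v" t] by (simp add: split_beta)
qed

lemma p_target:
  assumes "c \<in> cyl_atlas" "u \<in> fst c"
  shows "target_chart (map_prod id p\<Sigma>) (M_atlas p\<Sigma>) c u \<in> M_atlas p\<Sigma>"
    "u \<in> rep_dom (map_prod id p\<Sigma>) c (target_chart (map_prod id p\<Sigma>) (M_atlas p\<Sigma>) c u)"
  using target_chart_some[of "M_atlas p\<Sigma>" "map_prod id p\<Sigma>" c u, OF p_in_chart[OF assms] assms(2)] by blast+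

lemma pull1_etaE:
  assumes "c \<in> cyl_atlas" "u \<in> fst c"
  shows "pull1 (map_prod id p\<Sigma>) (M_atlas p\<Sigma>) (\<lambda>c. etaE) c u v = etaE u v"
proof -
  obtain t z where u: "u = (t, z)" by (cases u)
  define d where "d = target_chart (map_prod id p\<Sigma>) (M_atlas p\<Sigma>) c u"
  have d: "d \<in> M_atlas p\<Sigma>" "(t, z) \<in> rep_dom (map_prod id p\<Sigma>) c d"
    using p_target[OF assms] unfolding d_def u by blast+
  obtain k g where g: "g \<in> G" "z \<in> unit_disk" "local_rep (map_prod id p\<Sigma>) c d (t, z) = (t + k, g z)"
    "D_rep (map_prod id p\<Sigma>) c d (t, z) = (\<lambda>(\<tau>, v). (\<tau>, deriv g z * v))"
    by (rule p_rep[OF assms(1) d])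
  show ?thesis
    unfolding pull1_def Let_def d_def[symmetric] unfolding u g(3,4)
    using etaE_invariant[OF g(1,2), of "t + k" "fst v" "snd v" t] by (simp add: split_beta)
qed

abbreviation \<eta>M :: "(R3, complex \<times> 'a) field1" where
  "\<eta>M \<equiv> descend1 (map_prod id p\<Sigma>) cyl_atlas (M_atlas p\<Sigma>) (eta G \<delta> f1 f2)"

lemma descend_eta:
  "form1 (M_atlas p\<Sigma>) \<eta>M \<and> field1_eq cyl_atlas (pull1 (map_prod id p\<Sigma>) (M_atlas p\<Sigma>) \<eta>M) (eta G \<delta> f1 f2)"
  unfolding descend1_def
proof (rule someI[of _ "\<lambda>c. etaE"])
  show "form1 (M_atlas p\<Sigma>) (\<lambda>c. etaE) \<and>
      field1_eq cyl_atlas (pull1 (map_prod id p\<Sigma>) (M_atlas p\<Sigma>) (\<lambda>c. etaE)) (eta G \<delta> f1 f2)"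
    using form1_etaE pull1_etaE eta_eq by (simp add: field1_eq_def)
qed

text \<open>The form \<open>\<eta>M\<close> is obtained by a choice, so its values have to be
  recovered from its pullback. A chart of the quotient lifts to a chart of the cylinder with the
  same coordinates, in which the covering is the identity; hence the descended form is
  unique.\<close>

lemma \<eta>M_eq:
  assumes "d \<in> M_atlas p\<Sigma>" "u \<in> fst d"
  shows "\<eta>M d u v = etaE u v"
proof -
  obtain U V where d: "d = (U \<times> V, map_prod cis p\<Sigma>)" "open U" "inj_on cis U" "V \<subseteq> unit_disk"
    using M_chartE[OF assms(1)] by metis
  define c where "c = (U \<times> unit_disk, map_prod cis (id :: complex \<Rightarrow> complex))"
  have "(U, cis) \<in> circle_atlas" using d(2,3) by (auto simp: covering_atlas_def)
  then have c: "c \<in> cyl_atlas" unfolding c_def prod_atlas_def by blast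
  have uc: "u \<in> fst c" using assms(2) d by (auto simp: c_def)
  define e where "e = target_chart (map_prod id p\<Sigma>) (M_atlas p\<Sigma>) c u"
  have e: "e \<in> M_atlas p\<Sigma>" "u \<in> rep_dom (map_prod id p\<Sigma>) c e"
    using p_target[OF c uc] unfolding e_def by blast+
  have s: "map_prod id p\<Sigma> (snd c x) = id (snd d x)" for x by (cases x) (simp add: c_def d)
  have rep: "local_rep (map_prod id p\<Sigma>) c e = local_rep id d e" unfolding local_rep_def s ..
  have "u \<in> rep_dom id d e" using e(2) assms(2) unfolding rep_dom_def s by blast
  then have "\<eta>M d u v = \<eta>M e (local_rep id d e u) (D_rep id d e u v)"
    using descend_eta assms(1) e(1) unfolding form1_def by blast
  also have "\<dots> = pull1 (map_prod id p\<Sigma>) (M_atlas p\<Sigma>) \<eta>M c u v"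
    unfolding pull1_def Let_def e_def[symmetric] rep ..
  also have "\<dots> = eta G \<delta> f1 f2 c u v" using descend_eta c uc unfolding field1_eq_def by blast
  also have "\<dots> = etaE u v" by (rule eta_eq[OF c uc])
  finally show ?thesis .
qed

lemma has_derivative_snd_compose:
  "(f has_derivative D) (at (snd u)) \<Longrightarrow> ((\<lambda>x. f (snd x)) has_derivative (\<lambda>v. D (snd v))) (at u)"
  by (rule has_derivative_compose[where f = snd and g = f and g' = D, OF has_derivative_snd[OF has_derivative_ident]])

lemma form_has_derivative:
  assumes "(a has_derivative Da) (at (snd u))" "(b has_derivative Db) (at (snd u))"
  shows "((\<lambda>x. a (snd x) * fst w + cross2 (b (snd x)) (snd w)) has_derivative
      (\<lambda>v. Da (snd v) * fst w + cross2 (Db (snd v)) (snd w))) (at u)"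
proof (rule has_derivative_add)
  show "((\<lambda>x. a (snd x) * fst w) has_derivative (\<lambda>v. Da (snd v) * fst w)) (at u)"
    by (intro has_derivative_mult_left has_derivative_snd_compose assms)
  show "((\<lambda>x. cross2 (b (snd x)) (snd w)) has_derivative (\<lambda>v. cross2 (Db (snd v)) (snd w))) (at u)"
    by (rule bounded_linear.has_derivative[OF bounded_bilinear.bounded_linear_left[OF bounded_bilinear_cross2]])
       (rule has_derivative_snd_compose[OF assms(2)])
qed

text \<open>The differential of a dt plus the contraction of dx dy with b is da dt plus the
  divergence of b times dx dy.\<close>

lemma ext_d_form:
  assumes "open S" "u \<in> S" "\<And>x v. x \<in> S \<Longrightarrow> \<alpha> c x v = a (snd x) * fst v + cross2 (b (snd x)) (snd v)"
    "(a has_derivative Da) (at (snd u))" "(b has_derivative Db) (at (snd u))"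
  shows "ext_d \<alpha> c u v w = Da (snd v) * fst w - Da (snd w) * fst v + trc Db * cross2 (snd v) (snd w)"
proof -
  have "frechet_derivative (\<lambda>x. \<alpha> c x w) (at u)
      = frechet_derivative (\<lambda>x. a (snd x) * fst w + cross2 (b (snd x)) (snd w)) (at u)" for w
    by (rule frechet_derivative_cong_open[OF assms(1,2)]) (rule assms(3))
  then have "frechet_derivative (\<lambda>x. \<alpha> c x w) (at u) = (\<lambda>v. Da (snd v) * fst w + cross2 (Db (snd v)) (snd w))" for w
    using frechet_derivativeI[OF form_has_derivative[OF assms(4,5)]] by simp
  then show ?thesis
    using trc_cross2[OF has_derivative_linear[OF assms(5)], of "snd v" "snd w"] by (simp add: ext_d_def)
qed

lemma fst_M_open: "d \<in> M_atlas p\<Sigma> \<Longrightarrow> open (fst d) \<and> fst d \<subseteq> UNIV \<times> unit_disk"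
  by (erule M_chartE) (auto simp: open_Times)

lemma fst_cyl_open: "c \<in> cyl_atlas \<Longrightarrow> open (fst c) \<and> fst c \<subseteq> UNIV \<times> unit_disk"
  by (erule cyl_chartE) (auto simp: open_Times)

abbreviation \<omega>L :: "(R3, complex \<times> 'a) field2" where
  "\<omega>L \<equiv> \<lambda>c u v w. pull2 snd (surface_atlas p\<Sigma>) \<omega>\<Sigma> c u v w + ext_d \<eta>M c u v w"

lemma \<omega>L_eq:
  assumes "d \<in> M_atlas p\<Sigma>" "u \<in> fst d"
  shows "\<omega>L d u v w = omE u v w"
proof -
  have z: "snd u \<in> unit_disk" using M_image[OF assms] by blast
  have "ext_d \<eta>M d u v w = dA (snd u) (snd v) * fst w - dA (snd u) (snd w) * fst v
      + trc (dB (snd u)) * cross2 (snd v) (snd w)"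
    by (rule ext_d_form[where S = "fst d" and a = etaA and b = etaB])
       (use assms fst_M_open \<eta>M_eq eta_has_derivative[OF z] in \<open>auto simp: etaE_def\<close>)
  then show ?thesis
    unfolding pull2_area[OF assms] by (simp add: omE_def curl_def algebra_simps)
qed

lemma omE_invariant:
  assumes "g \<in> G" "z \<in> unit_disk"
  shows "omE (s, g z) (\<tau>, deriv g z * v) (\<sigma>, deriv g z * w) = omE (t, z) (\<tau>, v) (\<sigma>, w)"
  by (simp add: omE_def dA_invariant[OF assms] curl_invariant[OF assms] cross2_mult_mult)

abbreviation \<alpha>L :: "(R3, complex \<times> complex) field1" where
  "\<alpha>L \<equiv> \<lambda>c u v. prim_form c u v + eta G \<delta> f1 f2 c u v"

lemma \<alpha>L_eq:
  assumes "c \<in> cyl_atlas" "u \<in> fst c"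
  shows "\<alpha>L c u v = lamE u v"
  unfolding eta_eq[OF assms]
  by (simp add: lamE_def etaE_def lamA_def lamB_def prim_form_def radial_def split_beta cross2_add_left
      cross2_scaleR_left distrib_right)

lemma ext_d_\<alpha>L:
  assumes "c \<in> cyl_atlas" "u \<in> fst c"
  shows "ext_d \<alpha>L c u v w = omE u v w"
proof -
  have z: "snd u \<in> unit_disk" using cyl_image[OF assms] by blast
  obtain L where L: "(lamB has_derivative L) (at (snd u))" "trc L = curl (snd u)" using lam_has_derivative(2)[OF z] by blast
  have "ext_d \<alpha>L c u v w = dA (snd u) (snd v) * fst w - dA (snd u) (snd w) * fst v + trc L * cross2 (snd v) (snd w)"
  proof (rule ext_d_form[where S = "fst c" and a = lamA and b = lamB])
    show "\<alpha>L c x v = lamA (snd x) * fst v + cross2 (lamB (snd x)) (snd v)" if "x \<in> fst c" for x v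
      using \<alpha>L_eq[OF assms(1) that] by (simp add: lamE_def)
  qed (use assms fst_cyl_open lam_has_derivative(1)[OF z] L(1) in auto)
  then show ?thesis by (simp add: omE_def L(2))
qed

lemma form1_\<alpha>L: "form1 cyl_atlas \<alpha>L"
  unfolding form1_def
proof (intro conjI ballI allI)
  fix c u assume "c \<in> cyl_atlas" "u \<in> fst c"
  then have "\<alpha>L c u = lamE u" using \<alpha>L_eq by blast
  then show "linear (\<alpha>L c u)" using linear_etaE by simp
next
  fix c d u v assume cd: "c \<in> cyl_atlas" "d \<in> cyl_atlas" "u \<in> rep_dom id c d"
  obtain t z where u: "u = (t, z)" by (cases u)
  obtain k where k: "(t + k, z) \<in> fst d" "local_rep id c d (t, z) = (t + k, z)" "D_rep id c d (t, z) = (\<lambda>v. v)"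
    by (rule cyl_transition[OF cd(1,2) cd(3)[unfolded u]]) (rule that, assumption+)
  have "u \<in> fst c" using cd(3) by (simp add: rep_dom_def)
  then show "\<alpha>L c u v = \<alpha>L d (local_rep id c d u) (D_rep id c d u v)"
    using \<alpha>L_eq[OF cd(1), of u v] \<alpha>L_eq[OF cd(2) k(1), of v] unfolding u k(2,3) by (simp add: lamE_def)
qed

lemma Ck_on_lam: "Ck_on 1 unit_disk lamA" "Ck_on 1 unit_disk lamB"
  unfolding lamA_def[abs_def] lamB_def[abs_def]
  by (intro Ck_on_add open_unit_disk Ck_on_const Ck_on_eta Ck_on_radial)+

lemma C1_\<alpha>L: "C1_field1 cyl_atlas \<alpha>L"
  unfolding C1_field1_def
proof (intro ballI allI)
  fix c v assume c: "c \<in> cyl_atlas"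
  have op: "open (fst c)" "snd ` fst c \<subseteq> unit_disk" using fst_cyl_open[OF c] by auto
  have s: "Ck_on 1 (fst c) (snd :: R3 \<Rightarrow> complex)" by (rule Ck_on_bounded_linear_apply[OF bounded_linear_snd])
  note comp = Ck_on_compose[OF op(1) open_unit_disk s Ck_on_lam(1) op(2)] Ck_on_compose[OF op(1) open_unit_disk s Ck_on_lam(2) op(2)]
  have "Ck_on 1 (fst c) (\<lambda>u. lamE u v)"
    unfolding lamE_def
    by (intro Ck_on_add Ck_on_mult op(1) comp Ck_on_const Ck_on_bilinear[OF op(1) bounded_bilinear_cross2])
  then show "Ck_on 1 (fst c) (\<lambda>u. \<alpha>L c u v)"
    by (rule Ck_on_cong[OF op(1)]) (rule \<alpha>L_eq[OF c])
qed

lemma pull2_\<omega>L: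
  assumes "c \<in> cyl_atlas" "u \<in> fst c"
  shows "pull2 (map_prod id p\<Sigma>) (M_atlas p\<Sigma>) \<omega>L c u v w = omE u v w"
proof -
  obtain t z where u: "u = (t, z)" by (cases u)
  define d where "d = target_chart (map_prod id p\<Sigma>) (M_atlas p\<Sigma>) c u"
  have d: "d \<in> M_atlas p\<Sigma>" "(t, z) \<in> rep_dom (map_prod id p\<Sigma>) c d"
    using p_target[OF assms] unfolding d_def u by blast+
  obtain k g where g: "g \<in> G" "z \<in> unit_disk" "(t + k, g z) \<in> fst d" "local_rep (map_prod id p\<Sigma>) c d (t, z) = (t + k, g z)"
    "D_rep (map_prod id p\<Sigma>) c d (t, z) = (\<lambda>(\<tau>, v). (\<tau>, deriv g z * v))"
    by (rule p_rep[OF assms(1) d])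
  have "pull2 (map_prod id p\<Sigma>) (M_atlas p\<Sigma>) \<omega>L c u v w
      = \<omega>L d (t + k, g z) (fst v, deriv g z * snd v) (fst w, deriv g z * snd w)"
    unfolding pull2_def[of "map_prod id p\<Sigma>"] Let_def d_def[symmetric] unfolding u g(4,5) by (simp add: split_beta)
  also have "\<dots> = omE u v w"
    unfolding \<omega>L_eq[OF d(1) g(3)] u
    using omE_invariant[OF g(1,2), of "t + k" "fst v" "snd v" "fst w" "snd w" t] by simp
  finally show ?thesis .
qed

text \<open>The Hamiltonian field of \<open>etaA\<close>, dual to its differential under dx dy; see
  \<open>cross2_kerY\<close>.\<close>

definition kerY :: "complex \<Rightarrow> complex" where
  "kerY z = Complex (dA z \<i>) (- dA z 1)"

text \<open>The conformal factor cancels the scaling of \<open>curl\<close> and \<open>kerY\<close> under \<open>G\<close>, so that \<open>kerX\<close> is invariant.\<close>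

definition kerX :: "R3 \<Rightarrow> R3" where
  "kerX u = ((1 - (cmod (snd u))\<^sup>2)\<^sup>2 / 2) *\<^sub>R (curl (snd u), kerY (snd u))"

lemma cross2_kerY:
  assumes "z \<in> unit_disk"
  shows "cross2 (kerY z) v = dA z v"
  unfolding linear_complex_expand[OF dA_dB_linear(1)[OF assms], of v] by (simp add: kerY_def cross2_def)

text \<open>Sorted by the two components of \<open>w\<close>, so that the kernel of the form can be
  read off component by component.\<close>

lemma omE_cross2:
  assumes "snd u \<in> unit_disk"
  shows "omE u v w = fst w * cross2 (kerY (snd u)) (snd v)
    + cross2 (curl (snd u) *\<^sub>R snd v - fst v *\<^sub>R kerY (snd u)) (snd w)"
  unfolding omE_def cross2_kerY[OF assms, symmetric] by (simp add: cross2_def algebra_simps)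

lemma lamE_kerX:
  assumes "snd u \<in> unit_disk"
  shows "lamE u (kerX u) = contact_density (snd u)"
proof -
  have "cross2 (lamB (snd u)) (kerY (snd u)) = - dA (snd u) (lamB (snd u))"
    unfolding cross2_kerY[OF assms, symmetric] by (simp add: cross2_def)
  then show ?thesis
    unfolding lamE_def kerX_def contact_density_def
    by (simp add: cross2_scaleR_right algebra_simps)
qed

text \<open>If the differential of \<open>\<alpha>L\<close> vanished at a point, so would the
  contact density.\<close>

lemma ker_nonzero:
  assumes "z \<in> unit_disk"
  shows "curl z \<noteq> 0 \<or> kerY z \<noteq> 0"
proof (rule ccontr)
  assume "\<not> (curl z \<noteq> 0 \<or> kerY z \<noteq> 0)"
  then have "contact_density z = 0"
    using cross2_kerY[OF assms, of "lamB z"] by (simp add: contact_density_def cross2_def)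
  then show False using contact_density_bound assms by (metis not_le)
qed

lemma continuous_curl: "continuous_on unit_disk curl"
proof -
  have "1 - (cmod z)\<^sup>2 \<noteq> 0" if "z \<in> unit_disk" for z using unit_disk_pos[OF that] by simp
  then show ?thesis
    unfolding curl_def[abs_def] trc_def
    by (intro continuous_intros dA_dB_continuous) auto
qed

lemma continuous_kerY: "continuous_on unit_disk kerY"
  unfolding kerY_def[abs_def] by (intro continuous_intros dA_dB_continuous)

section \<open>The Hamiltonian structure and its kernel field\<close>

lemma bilinear_omE:
  assumes "snd u \<in> unit_disk"
  shows "bilinear (omE u)"
  unfolding omE_cross2[OF assms, abs_def] bilinear_def
  by (auto intro!: linearI simp: cross2_def algebra_simps)

lemma omE_alternating: "omE u v v = 0"
  by (simp add: omE_def)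

lemma form2_\<omega>L: "form2 (M_atlas p\<Sigma>) \<omega>L"
  unfolding form2_def tensor2_def
proof (intro conjI ballI allI)
  fix c u assume c: "c \<in> M_atlas p\<Sigma>" "u \<in> fst c"
  then have "\<omega>L c u = omE u" using \<omega>L_eq by blast
  then show "bilinear (\<omega>L c u)" using bilinear_omE M_image[OF c] by simp
  show "\<omega>L c u v v = 0" for v using \<omega>L_eq[OF c] omE_alternating by simp
next
  fix c d u v w assume cd: "c \<in> M_atlas p\<Sigma>" "d \<in> M_atlas p\<Sigma>" "u \<in> rep_dom id c d"
  obtain t z where u: "u = (t, z)" by (cases u)
  obtain k g where g: "g \<in> G" "z \<in> unit_disk" "(t + k, g z) \<in> fst d" "local_rep id c d (t, z) = (t + k, g z)"
    "D_rep id c d (t, z) = (\<lambda>(\<tau>, v). (\<tau>, deriv g z * v))"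
    by (rule M_rep[OF cd(1,2) cd(3)[unfolded u]])
  have "u \<in> fst c" using cd(3) by (simp add: rep_dom_def)
  then have "\<omega>L c u v w = omE (t, z) v w" using \<omega>L_eq[OF cd(1)] by (simp add: u)
  also have "\<dots> = omE (t + k, g z) (fst v, deriv g z * snd v) (fst w, deriv g z * snd w)"
    using omE_invariant[OF g(1,2), of "t + k" "fst v" "snd v" "fst w" "snd w" t] by simp
  also have "\<dots> = \<omega>L d (t + k, g z) (fst v, deriv g z * snd v) (fst w, deriv g z * snd w)"
    by (rule \<omega>L_eq[OF cd(2) g(3), symmetric])
  finally show "\<omega>L c u v w = \<omega>L d (local_rep id c d u) (D_rep id c d u v) (D_rep id c d u w)"
    unfolding u g(4,5) by (simp add: split_beta)
qed

lemma continuous_\<omega>L: "continuous_field2 (M_atlas p\<Sigma>) \<omega>L"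
  unfolding continuous_field2_def
proof (intro ballI allI)
  fix c v w assume c: "c \<in> M_atlas p\<Sigma>"
  have im: "snd ` fst c \<subseteq> unit_disk" using fst_M_open[OF c] by auto
  have "continuous_on (fst c) (\<lambda>u. omE u v w)"
    unfolding omE_def
    by (intro continuous_intros continuous_on_compose2[OF dA_dB_continuous(1) _ im]
        continuous_on_compose2[OF continuous_curl _ im])
  then show "continuous_on (fst c) (\<lambda>u. \<omega>L c u v w)"
    by (rule continuous_on_eq) (simp only: \<omega>L_eq[OF c])
qed

text \<open>The derivatives of \<open>etaA\<close> that occur in the form are shifted to the test
  function. The coefficient \<open>curl\<close> cannot be differentiated, but it meets only the
  t-derivative of the test function and is itself independent of t.\<close>

lemma closed_\<omega>L: "closed_form2 (M_atlas p\<Sigma>) \<omega>L"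
  unfolding closed_form2_def
proof (intro ballI allI impI, elim conjE)
  fix c \<phi> K assume c: "c \<in> M_atlas p\<Sigma>"
    and \<phi>: "smooth_on UNIV (\<phi> :: R3 \<Rightarrow> real)" and K: "compact K" "K \<subseteq> fst c" and "\<forall>u. u \<notin> K \<longrightarrow> \<phi> u = 0"
  then have \<phi>0: "\<And>u. u \<notin> K \<Longrightarrow> \<phi> u = 0" by blast
  let ?S = "UNIV \<times> unit_disk :: R3 set"
  have S: "open ?S" "K \<subseteq> ?S" "snd ` ?S \<subseteq> unit_disk" using K fst_M_open[OF c] by (auto simp: open_Times)
  define \<phi>' where "\<phi>' v u = frechet_derivative \<phi> (at u) v" for v u
  define \<phi>'' where "\<phi>'' v w u = frechet_derivative (\<phi>' v) (at u) w" for v w u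
  have Ck: "Ck_on k UNIV \<phi>" for k using \<phi> by (simp add: smooth_on_def)
  have Ck': "Ck_on k UNIV (\<phi>' v)" for k v
    using Ck[of "Suc k"] unfolding \<phi>'_def[abs_def] Ck_on.simps by blast
  have Ck'': "Ck_on k UNIV (\<phi>'' v w)" for k v w
    using Ck'[of "Suc k" v] unfolding \<phi>''_def[abs_def] Ck_on.simps by blast
  have \<phi>'0: "\<phi>' v u = 0" if "u \<notin> K" for v u
    unfolding \<phi>'_def by (rule frechet_derivative_support[OF K(1) \<phi>0 that])
  have \<phi>''0: "\<phi>'' v w u = 0" if "u \<notin> K" for v w u
    unfolding \<phi>''_def by (rule frechet_derivative_support[OF K(1) \<phi>'0 that])
  have sym: "\<phi>'' v w u = \<phi>'' w v u" for v w u
    unfolding \<phi>''_def \<phi>'_def[abs_def] by (rule symmetric_second_derivative[OF Ck])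
  note cont = Ck_on_continuous[OF Ck'] Ck_on_continuous[OF Ck'']
  have ch: "continuous_on ?S (\<lambda>u. curl (snd u))" "continuous_on ?S (\<lambda>u. etaA (snd u))"
    "continuous_on ?S (\<lambda>u. dA (snd u) v)" for v
    by (intro continuous_on_compose2[OF _ continuous_on_snd[OF continuous_on_id] S(3)] continuous_curl
        Ck_on_continuous[OF Ck_on_eta(1)] dA_dB_continuous)+
  define D1 where "D1 u = \<phi>' E1 u * curl (snd u)" for u
  \<comment> \<open>The term with the second derivative is added so that \<open>D2 v w\<close> is a
    total derivative along \<open>w\<close>, namely of the derivative of \<phi> along
    \<open>v\<close> times \<open>etaA\<close>. In the difference of D2 E2 E3 and D2 E3 E2 the added
    terms cancel by symmetry.\<close>
  define D2 where "D2 v w u = \<phi>'' v w u * etaA (snd u) + \<phi>' v u * dA (snd u) (snd w)" for v w u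
  have c1: "continuous_on UNIV D1"
    unfolding D1_def[abs_def] by (rule continuous_on_mult_support[OF cont(1) K(1) \<phi>'0 S(1,2) ch(1)])
  have c2: "continuous_on UNIV (D2 v w)" for v w
    unfolding D2_def[abs_def]
    by (intro continuous_on_add continuous_on_mult_support[OF cont(1) K(1) \<phi>'0 S(1,2) ch(3)]
        continuous_on_mult_support[OF cont(2) K(1) \<phi>''0 S(1,2) ch(2)])
  have i1: "(LINT u|lborel. D1 u) = 0"
  proof (rule integral_directional_derivative_eq_0[OF K(1), where W = "\<lambda>u. \<phi> u * curl (snd u)" and v = E1])
    show "continuous_on UNIV (\<lambda>u. \<phi> u * curl (snd u))"
      by (rule continuous_on_mult_support[OF Ck_on_continuous[OF Ck] K(1) \<phi>0 S(1,2) ch(1)])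
    show "((\<lambda>s. \<phi> (u + s *\<^sub>R E1) * curl (snd (u + s *\<^sub>R E1))) has_real_derivative D1 u) (at 0)" for u
    proof -
      have "((\<lambda>s. \<phi> (u + s *\<^sub>R E1)) has_real_derivative \<phi>' E1 u) (at 0)"
        unfolding \<phi>'_def by (intro has_derivative_line Ck_on_has_derivative[OF Ck]) simp
      from DERIV_cmult_right[OF this, of "curl (snd u)"] show ?thesis by (simp add: D1_def)
    qed
  qed (use c1 \<phi>0 in auto)
  have i2: "(LINT u|lborel. D2 v w u) = 0" for v w
  proof (rule integral_directional_derivative_eq_0[OF K(1), where W = "\<lambda>u. \<phi>' v u * etaA (snd u)" and v = w])
    show "continuous_on UNIV (\<lambda>u. \<phi>' v u * etaA (snd u))"
      by (rule continuous_on_mult_support[OF cont(1) K(1) \<phi>'0 S(1,2) ch(2)])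
    show "((\<lambda>s. \<phi>' v (u + s *\<^sub>R w) * etaA (snd (u + s *\<^sub>R w))) has_real_derivative D2 v w u) (at 0)" for u
      unfolding D2_def \<phi>''_def
      by (rule has_derivative_mult_support[where h = "\<lambda>u. etaA (snd u)" and D = "\<lambda>u w. dA (snd u) (snd w)", OF Ck' K(1) \<phi>'0 S(2)])
         (assumption, rule has_derivative_snd_compose[OF eta_has_derivative(1)], force)
  qed (use c2 \<phi>'0 in auto)
  have "wedge12 (frechet_derivative \<phi> (at u)) (\<omega>L c u) E1 E2 E3 = D1 u + (D2 E2 E3 u - D2 E3 E2 u)" for u
  proof (cases "u \<in> K")
    case True
    then have u: "u \<in> fst c" "snd u \<in> unit_disk" using K(2) M_image[OF c] by blast+
    have "dA (snd u) 0 = 0" using linear_0[OF dA_dB_linear(1)[OF u(2)]] .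
    then show ?thesis
      using sym[of E2 E3 u]
      by (simp add: wedge12_def \<omega>L_eq[OF c u(1)] D1_def D2_def omE_def cross2_def \<phi>'_def algebra_simps)
  next
    case False
    then show ?thesis
      using \<phi>'0[OF False] \<phi>''0[OF False] by (simp add: wedge12_def D1_def D2_def \<phi>'_def)
  qed
  moreover have "integrable lborel D1" "integrable lborel (D2 v w)" for v w
    using integrable_compact_support[OF K(1) c1] integrable_compact_support[OF K(1) c2] \<phi>'0 \<phi>''0
    by (simp_all add: D1_def D2_def)
  ultimately show "(LINT u|lborel. wedge12 (frechet_derivative \<phi> (at u)) (\<omega>L c u) E1 E2 E3) = 0"
    by (simp add: i1 i2)
qed

lemma Hamiltonian_\<omega>L: "Hamiltonian_structure (M_atlas p\<Sigma>) \<omega>L"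
  unfolding Hamiltonian_structure_def
proof (intro conjI ballI form2_\<omega>L continuous_\<omega>L closed_\<omega>L)
  fix c u assume c: "c \<in> M_atlas p\<Sigma>" "u \<in> fst c"
  have z: "snd u \<in> unit_disk" using M_image[OF c] by blast
  show "\<exists>v w. \<omega>L c u v w \<noteq> 0"
  proof (rule ccontr)
    assume "\<not> (\<exists>v w. \<omega>L c u v w \<noteq> 0)"
    then have 0: "omE u v w = 0" for v w using \<omega>L_eq[OF c, of v w] by metis
    have "curl (snd u) = 0" using 0[of E2 E3] by (simp add: omE_def cross2_def)
    moreover have "cross2 (kerY (snd u)) v = cross2 0 v" for v
      using 0[of "(0, v)" E1] omE_cross2[OF z, of "(0, v)" E1] by (simp add: cross2_def)
    then have "kerY (snd u) = 0" by (rule cross2_eqI)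
    ultimately show False using ker_nonzero[OF z] by blast
  qed
qed

lemma kerX_invariant:
  assumes "g \<in> G" "z \<in> unit_disk"
  shows "kerX (s, g z) = (fst (kerX (t, z)), deriv g z * snd (kerX (t, z)))"
proof -
  define d n m where "d = deriv g z" and "n = 1 - (cmod z)\<^sup>2" and "m = 1 - (cmod (g z))\<^sup>2"
  have m: "m\<^sup>2 = (cmod d)\<^sup>2 * n\<^sup>2" using G_derivative(3)[OF assms] by (simp add: d_def n_def m_def)
  have "cross2 (kerY z) v = cross2 (cnj d * kerY (g z)) v" for v
    unfolding cross2_mult_right[symmetric] cross2_kerY[OF assms(2)] cross2_kerY[OF G_maps[OF assms]] d_def
    by (rule dA_invariant[OF assms])
  then have Y: "kerY z = cnj d * kerY (g z)" by (rule cross2_eqI)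
  have "d * kerY z = (cmod d)\<^sup>2 *\<^sub>R kerY (g z)"
    unfolding Y mult.assoc[symmetric] complex_norm_square[symmetric] scaleR_conv_of_real ..
  moreover have "curl z = (cmod d)\<^sup>2 * curl (g z)" unfolding d_def by (rule curl_invariant[OF assms])
  ultimately show ?thesis
    unfolding kerX_def snd_conv n_def[symmetric] m_def[symmetric] d_def[symmetric] m by simp
qed

lemma kernel_kerX: "kernel_vfield (M_atlas p\<Sigma>) \<omega>L (\<lambda>c. kerX)"
  unfolding kernel_vfield_def vector_field_def continuous_vfield_def
proof (intro conjI ballI allI impI)
  fix c d u assume cd: "c \<in> M_atlas p\<Sigma>" "d \<in> M_atlas p\<Sigma>" "u \<in> rep_dom id c d"
  obtain t z where u: "u = (t, z)" by (cases u)
  obtain k g where g: "g \<in> G" "z \<in> unit_disk" "local_rep id c d (t, z) = (t + k, g z)"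
    "D_rep id c d (t, z) = (\<lambda>(\<tau>, v). (\<tau>, deriv g z * v))"
    by (rule M_rep[OF cd(1,2) cd(3)[unfolded u]])
  show "kerX (local_rep id c d u) = D_rep id c d u (kerX u)"
    unfolding u g(3,4) kerX_invariant[OF g(1,2), of "t + k" t] by (simp add: split_beta)
next
  fix c assume c: "c \<in> M_atlas p\<Sigma>"
  have im: "snd ` fst c \<subseteq> unit_disk" using fst_M_open[OF c] by auto
  show "continuous_on (fst c) kerX"
    unfolding kerX_def[abs_def]
    by (intro continuous_intros continuous_on_compose2[OF continuous_kerY _ im]
        continuous_on_compose2[OF continuous_curl _ im]) simp
  fix u assume u: "u \<in> fst c"
  have z: "snd u \<in> unit_disk" using M_image[OF c u] by blast
  define s q Y where "s = (1 - (cmod (snd u))\<^sup>2)\<^sup>2 / 2" and "q = curl (snd u)" and "Y = kerY (snd u)"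
  have s: "s > 0" using unit_disk_pos[OF z] by (simp add: s_def)
  have X: "kerX u = (s * q, s *\<^sub>R Y)" by (simp add: kerX_def s_def q_def Y_def)
  have qY: "q \<noteq> 0 \<or> Y \<noteq> 0" using ker_nonzero[OF z] by (simp add: q_def Y_def)
  have om: "\<omega>L c u v w = fst w * cross2 Y (snd v) + cross2 (q *\<^sub>R snd v - fst v *\<^sub>R Y) (snd w)" for v w
    using \<omega>L_eq[OF c u] omE_cross2[OF z] by (simp add: q_def Y_def)
  show "kerX u \<noteq> 0" using qY s by (auto simp: X prod_eq_iff)
  show "{v. \<forall>w. \<omega>L c u v w = 0} = span {kerX u}"
    unfolding span_singleton
  proof (intro subset_antisym subsetI)
    fix v assume "v \<in> {v. \<forall>w. \<omega>L c u v w = 0}"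
    then have 0: "fst w * cross2 Y (snd v) + cross2 (q *\<^sub>R snd v - fst v *\<^sub>R Y) (snd w) = 0" for w
      using om by simp
    have Yv: "cross2 Y (snd v) = 0" using 0[of "(1, 0)"] by (simp add: cross2_def)
    have "cross2 (q *\<^sub>R snd v - fst v *\<^sub>R Y) w = cross2 0 w" for w using 0[of "(0, w)"] by (simp add: cross2_def)
    then have "q *\<^sub>R snd v - fst v *\<^sub>R Y = 0" by (rule cross2_eqI)
    then have eq: "q *\<^sub>R snd v = fst v *\<^sub>R Y" by simp
    show "v \<in> range (\<lambda>k. k *\<^sub>R kerX u)"
    proof (cases "q = 0")
      case False
      have "snd v = (1 / q) *\<^sub>R (q *\<^sub>R snd v)" using False by simp
      then have "snd v = (fst v / q) *\<^sub>R Y" unfolding eq by simp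
      then have "v = (fst v / (s * q)) *\<^sub>R kerX u" using s False by (simp add: X prod_eq_iff)
      then show ?thesis by blast
    next
      case True
      then have "Y \<noteq> 0" using qY by blast
      then have "fst v = 0" using eq True by simp
      moreover have "snd v = ((Y \<bullet> snd v) / (Y \<bullet> Y)) *\<^sub>R Y" by (rule cross2_parallel[OF \<open>Y \<noteq> 0\<close> Yv])
      ultimately have "v = (((Y \<bullet> snd v) / (Y \<bullet> Y)) / s) *\<^sub>R kerX u" using s True by (simp add: X prod_eq_iff)
      then show ?thesis by blast
    qed
  next
    fix v assume "v \<in> range (\<lambda>k. k *\<^sub>R kerX u)"
    then obtain k where "v = k *\<^sub>R kerX u" by blast
    then show "v \<in> {v. \<forall>w. \<omega>L c u v w = 0}" unfolding om by (simp add: X cross2_def algebra_simps)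
  qed
  fix v w assume "\<omega>L c u v w > 0"
  \<comment> \<open>Contracting the volume form with \<open>kerX\<close> gives a positive multiple
    of the 2-form, which is the required orientation.\<close>
  moreover have "vol3 (kerX u) v w = s * \<omega>L c u v w"
    unfolding om X by (simp add: vol3_def wedge12_def cross2_def algebra_simps)
  ultimately show "vol3 (kerX u) v w > 0" using s by simp
qed

lemma lifted_kerX: "lifted_vfield (map_prod id p\<Sigma>) cyl_atlas (M_atlas p\<Sigma>) (\<lambda>c. kerX) (\<lambda>c. kerX)"
  unfolding lifted_vfield_def vector_field_def
proof (intro conjI ballI)
  fix c d u assume cd: "c \<in> cyl_atlas" "d \<in> cyl_atlas" "u \<in> rep_dom id c d"
  obtain t z where u: "u = (t, z)" by (cases u)
  obtain k where k: "local_rep id c d (t, z) = (t + k, z)" "D_rep id c d (t, z) = (\<lambda>v. v)"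
    by (rule cyl_transition[OF cd(1,2) cd(3)[unfolded u]]) (rule that, assumption+)
  show "kerX (local_rep id c d u) = D_rep id c d u (kerX u)"
    unfolding u k by (simp add: kerX_def)
next
  fix c d u assume cd: "c \<in> cyl_atlas" "d \<in> M_atlas p\<Sigma>" "u \<in> rep_dom (map_prod id p\<Sigma>) c d"
  obtain t z where u: "u = (t, z)" by (cases u)
  obtain k g where g: "g \<in> G" "z \<in> unit_disk" "local_rep (map_prod id p\<Sigma>) c d (t, z) = (t + k, g z)"
    "D_rep (map_prod id p\<Sigma>) c d (t, z) = (\<lambda>(\<tau>, v). (\<tau>, deriv g z * v))"
    by (rule p_rep[OF cd(1,2) cd(3)[unfolded u]])
  show "D_rep (map_prod id p\<Sigma>) c d u (kerX u) = kerX (local_rep (map_prod id p\<Sigma>) c d u)"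
    unfolding u g(3,4) kerX_invariant[OF g(1,2), of "t + k" t] by (simp add: split_beta)
qed

text \<open>The modulus of \<open>lamB\<close> times 1 - |z|^2 is its hyperbolic norm. For
  \<open>radial\<close> this norm is |z| < 1 on the whole noncompact disk. The twist is moved
  isometrically to the standard tube by \<open>G_cmod_deriv\<close>, where continuity of
  \<open>f1\<close> and \<open>f2\<close> on a compact interval bounds it.\<close>

lemma lam_bounded:
  obtains C' where "\<And>z. z \<in> unit_disk \<Longrightarrow> \<bar>lamA z\<bar> + cmod (lamB z) * (1 - (cmod z)\<^sup>2) \<le> C'"
proof -
  have bdd: "\<exists>b. \<forall>r\<in>{0..\<delta>}. \<bar>f r\<bar> \<le> b" if "continuous_on {0..\<delta>} f" for f :: "real \<Rightarrow> real"
    using compact_imp_bounded[OF compact_continuous_image[OF that compact_Icc]] by (simp add: bounded_iff)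
  obtain b1 b2 where b: "\<And>r. r \<in> {0..\<delta>} \<Longrightarrow> \<bar>f1 r\<bar> \<le> b1" "\<And>r. r \<in> {0..\<delta>} \<Longrightarrow> \<bar>f2 r\<bar> \<le> b2"
    using bdd[OF f_continuous(1)] bdd[OF f_continuous(2)] by blast
  \<comment> \<open>Near the core the norm of \<open>B0\<close> is 2 |w|; elsewhere |f2| / r is at
    most b2 / (\<epsilon>/2), and subtracting \<open>radial\<close> costs at most 1.\<close>
  define b3 where "b3 = 2 + b2 / (\<epsilon>/2)"
  have b2: "0 \<le> b2" using b(2)[of 0] \<delta> by (auto intro: order_trans[OF abs_ge_zero])
  have B0: "cmod (B0 w) * (1 - (cmod w)\<^sup>2) \<le> b3" if "cmod w < \<delta>" for w
  proof -
    have w: "cmod w < 1" "0 < 1 - (cmod w)\<^sup>2" using that \<delta> power_strict_mono[of "cmod w" 1 2] by auto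
    have rad: "cmod (radial w) * (1 - (cmod w)\<^sup>2) = cmod w" using w by (simp add: radial_def)
    show ?thesis
    proof (cases "cmod w \<le> \<epsilon>/2")
      case True
      have "cmod (B0 w) * (1 - (cmod w)\<^sup>2) = 2 * cmod w" unfolding AB0_inner(2)[OF True] using rad by simp
      then show ?thesis using w b2 \<epsilon> by (simp add: b3_def add_increasing2)
    next
      case False
      then have cw: "\<epsilon>/2 < cmod w" by simp
      have "cmod ((f2 (cmod w) / (cmod w)\<^sup>2) *\<^sub>R w) = \<bar>f2 (cmod w)\<bar> / cmod w"
        using cw \<epsilon> by (simp add: power2_eq_square)
      also have "\<dots> \<le> b2 / (\<epsilon>/2)"
        using b(2)[of "cmod w"] cw that \<epsilon> b2 by (intro frac_le) auto
      finally have "cmod (B0 w) \<le> b2 / (\<epsilon>/2) + cmod (radial w)"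
        unfolding B0_def using norm_triangle_ineq4 order_trans add_right_mono by metis
      then have "cmod (B0 w) * (1 - (cmod w)\<^sup>2) \<le> (b2 / (\<epsilon>/2) + cmod (radial w)) * (1 - (cmod w)\<^sup>2)"
        using w by (intro mult_right_mono) auto
      also have "\<dots> = b2 / (\<epsilon>/2) * (1 - (cmod w)\<^sup>2) + cmod w" using rad by (simp add: algebra_simps)
      also have "\<dots> \<le> b2 / (\<epsilon>/2) * 1 + 1" using w b2 \<epsilon> by (intro add_mono mult_left_mono) auto
      finally show ?thesis by (simp add: b3_def)
    qed
  qed
  have b1: "0 \<le> b1" using b(1)[of 0] \<delta> by (auto intro: order_trans[OF abs_ge_zero])
  have b3: "0 \<le> b3" using b2 \<epsilon> by (simp add: b3_def)
  show ?thesis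
  proof (rule that)
    fix z assume z: "z \<in> unit_disk"
    have n: "0 < 1 - (cmod z)\<^sup>2" "cmod z < 1" using unit_disk_pos[OF z] z by (auto simp: unit_disk_def)
    have rad: "cmod (radial z) * (1 - (cmod z)\<^sup>2) = cmod z" using n by (simp add: radial_def)
    have "\<bar>etaA z\<bar> \<le> b1 + 1 \<and> cmod (etaB z) * (1 - (cmod z)\<^sup>2) \<le> b3"
    proof (cases "in_tube z")
      case True
      then obtain g where g: "g \<in> G" "cmod (g z) < \<delta>" unfolding in_tube_def by blast
      have "cmod (etaB z) * (1 - (cmod z)\<^sup>2) = cmod (B0 (g z)) * (cmod (deriv g z) * (1 - (cmod z)\<^sup>2))"
        by (simp add: eta_in[OF g(1) z g(2)] norm_mult)
      also have "\<dots> \<le> b3" unfolding G_cmod_deriv[OF g(1) z] by (rule B0[OF g(2)])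
      finally show ?thesis using b(1)[of "cmod (g z)"] g(2) by (auto simp: eta_in[OF g(1) z g(2)] A0_def)
    qed (use b1 b3 in \<open>simp add: eta_out\<close>)
    moreover have "cmod (lamB z) * (1 - (cmod z)\<^sup>2) \<le> (cmod (radial z) + cmod (etaB z)) * (1 - (cmod z)\<^sup>2)"
      unfolding lamB_def using n by (intro mult_right_mono norm_triangle_ineq) auto
    moreover have "(cmod (radial z) + cmod (etaB z)) * (1 - (cmod z)\<^sup>2) = cmod z + cmod (etaB z) * (1 - (cmod z)\<^sup>2)"
      using rad by (simp add: algebra_simps)
    ultimately show "\<bar>lamA z\<bar> + cmod (lamB z) * (1 - (cmod z)\<^sup>2) \<le> (b1 + 2) + (1 + b3)"
      using n(2) unfolding lamA_def by linarith
  qed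
qed

lemma conorm_bounded:
  "\<exists>C'. \<forall>c\<in>cyl_atlas. \<forall>u\<in>fst c. conorm (pull2 (map_prod id p\<Sigma>) (M_atlas p\<Sigma>) gM) \<alpha>L c u \<le> C'"
proof -
  obtain C' where C': "\<And>z. z \<in> unit_disk \<Longrightarrow> \<bar>lamA z\<bar> + cmod (lamB z) * (1 - (cmod z)\<^sup>2) \<le> C'"
    using lam_bounded by blast
  show ?thesis
  proof (intro exI ballI conorm_le)
    fix c u v assume c: "c \<in> cyl_atlas" "u \<in> fst c"
      and "pull2 (map_prod id p\<Sigma>) (M_atlas p\<Sigma>) gM c u v v \<le> 1"
    then have g: "fst v * fst v + hyp_metric (snd u) (snd v) (snd v) \<le> 1" by (simp add: pull2_gM)
    have z: "snd u \<in> unit_disk" using cyl_image[OF c] by blast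
    define n where "n = 1 - (cmod (snd u))\<^sup>2"
    have n: "0 < n" using unit_disk_pos[OF z] by (simp add: n_def)
    have h: "hyp_metric (snd u) (snd v) (snd v) = (cmod (snd v) / n)\<^sup>2"
      by (simp add: hyp_metric_def n_def power2_norm_eq_inner power_divide)
    have "(fst v)\<^sup>2 \<le> 1" "(cmod (snd v) / n)\<^sup>2 \<le> 1"
      using g unfolding h power2_eq_square[symmetric] by (smt (verit) zero_le_power2)+
    then have "\<bar>fst v\<bar> \<le> 1" "cmod (snd v) / n \<le> 1" using n by (auto simp: abs_square_le_1 power_le_one_iff)
    then have v: "\<bar>fst v\<bar> \<le> 1" "cmod (snd v) \<le> n" using n by auto
    have "\<bar>lamE u v\<bar> \<le> \<bar>lamA (snd u) * fst v\<bar> + \<bar>cross2 (lamB (snd u)) (snd v)\<bar>"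
      unfolding lamE_def by (rule abs_triangle_ineq)
    also have "\<dots> \<le> \<bar>lamA (snd u)\<bar> * 1 + cmod (lamB (snd u)) * n"
      unfolding abs_mult
      using v by (intro add_mono mult_left_mono order_trans[OF abs_cross2_le]) auto
    also have "\<dots> \<le> C'" using C'[OF z] by (simp add: n_def)
    finally show "\<bar>\<alpha>L c u v\<bar> \<le> C'" using \<alpha>L_eq[OF c] by simp
  next
    fix c u assume "c \<in> cyl_atlas" "u \<in> fst c"
    then show "pull2 (map_prod id p\<Sigma>) (M_atlas p\<Sigma>) gM c u 0 0 \<le> 1"
      by (simp add: pull2_gM hyp_metric_def)
  qed
qed

lemma virtual_contact:
  "virtual_contact_structure cyl cyl_atlas (map_prod id p\<Sigma>) (sphere 0 1 \<times> \<Sigma>) (M_atlas p\<Sigma>) \<omega>L \<alpha>L"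
  unfolding virtual_contact_structure_def
proof (intro conjI oriented_M smooth_manifold_cyl smooth_covering_p Hamiltonian_\<omega>L form1_\<alpha>L C1_\<alpha>L)
  show "field2_eq cyl_atlas (ext_d \<alpha>L) (pull2 (map_prod id p\<Sigma>) (M_atlas p\<Sigma>) \<omega>L)"
    unfolding field2_eq_def using ext_d_\<alpha>L pull2_\<omega>L by simp
  show "\<exists>g C'. Riemannian_metric (M_atlas p\<Sigma>) g \<and>
      (\<forall>c\<in>cyl_atlas. \<forall>u\<in>fst c. conorm (pull2 (map_prod id p\<Sigma>) (M_atlas p\<Sigma>) g) \<alpha>L c u \<le> C')"
    using Riemannian_gM conorm_bounded by blast
  obtain b where b: "b > 0" "\<And>z. z \<in> unit_disk \<Longrightarrow> b \<le> contact_density z" using contact_density_bound by blast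
  have "b \<le> \<alpha>L c u (kerX u)" if "c \<in> cyl_atlas" "u \<in> fst c" for c u
    unfolding \<alpha>L_eq[OF that] using lamE_kerX b(2) cyl_image[OF that] by simp
  then show "\<exists>X X' \<epsilon>'. kernel_vfield (M_atlas p\<Sigma>) \<omega>L X \<and> lifted_vfield (map_prod id p\<Sigma>) cyl_atlas (M_atlas p\<Sigma>) X X' \<and>
      \<epsilon>' > 0 \<and> (\<forall>c\<in>cyl_atlas. \<forall>u\<in>fst c. \<alpha>L c u (X' c u) \<ge> \<epsilon>')"
    using kernel_kerX lifted_kerX b(1)
    by (intro exI[of _ "\<lambda>c. kerX"] exI[of _ b]) blast
qed

lemma contact_form_\<alpha>L: "contact_form cyl_atlas \<alpha>L"
  unfolding contact_form_def
proof (intro conjI ballI form1_\<alpha>L C1_\<alpha>L)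
  fix c u assume c: "c \<in> cyl_atlas" "u \<in> fst c"
  have z: "snd u \<in> unit_disk" using cyl_image[OF c] by blast
  have d0: "dA (snd u) 0 = 0" using linear_0[OF dA_dB_linear(1)[OF z]] .
  have "wedge12 (\<alpha>L c u) (ext_d \<alpha>L c u) E1 E2 E3 = lamA (snd u) * curl (snd u) - dA (snd u) (lamB (snd u))"
    unfolding linear_complex_expand[OF dA_dB_linear(1)[OF z], of "lamB (snd u)"]
    by (simp add: wedge12_def \<alpha>L_eq[OF c] ext_d_\<alpha>L[OF c] lamE_def omE_def cross2_def d0)
  moreover have "contact_density (snd u) > 0" using contact_density_bound z by (metis less_le_trans)
  ultimately have "wedge12 (\<alpha>L c u) (ext_d \<alpha>L c u) E1 E2 E3 \<noteq> 0"
    by (auto simp: contact_density_def)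
  then show "\<exists>v1 v2 v3. wedge12 (\<alpha>L c u) (ext_d \<alpha>L c u) v1 v2 v3 \<noteq> 0" by blast
qed

end

section \<open>The overtwisted disk\<close>

text \<open>Writing v = c z separates the radial part Re c from the angular part Im c;
  \<open>p\<close> and \<open>q\<close> are the coefficients of r dr and of r^2 d\<phi>. The kernel
  is spanned by the v with c proportional to \<open>Complex a b\<close>.\<close>

lemma kernel_polar:
  assumes "z \<noteq> 0" "p * a + q * b = 0" "a \<noteq> 0 \<or> b \<noteq> 0" "p \<noteq> 0 \<or> q \<noteq> 0"
  shows "{v. p * (z \<bullet> v) + q * cross2 z v = 0} = span {Complex a b * z}"
proof -
  have n: "z \<bullet> z > 0" using assms(1) by simp
  have "v \<in> range (\<lambda>k. k *\<^sub>R (Complex a b * z)) \<longleftrightarrow> p * (z \<bullet> v) + q * cross2 z v = 0" for v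
  proof -
    define c where "c = v / z"
    have v: "v = c * z" using assms(1) by (simp add: c_def)
    have "z \<bullet> v = Re c * (z \<bullet> z)" "cross2 z v = Im c * (z \<bullet> z)"
      unfolding v by (simp_all add: inner_complex_def cross2_def algebra_simps)
    then have "p * (z \<bullet> v) + q * cross2 z v = (p * Re c + q * Im c) * (z \<bullet> z)" by (simp add: algebra_simps)
    then have "p * (z \<bullet> v) + q * cross2 z v = 0 \<longleftrightarrow> p * Re c + q * Im c = 0" using n by simp
    also have "\<dots> \<longleftrightarrow> (\<exists>k. c = k *\<^sub>R Complex a b)"
    proof
      assume c: "p * Re c + q * Im c = 0"
      have "p * (Re c * b - Im c * a) = (p * Re c + q * Im c) * b - Im c * (p * a + q * b)"
        "q * (Re c * b - Im c * a) = Re c * (p * a + q * b) - (p * Re c + q * Im c) * a"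
        by (simp_all add: algebra_simps)
      then have "p * (Re c * b - Im c * a) = 0" "q * (Re c * b - Im c * a) = 0"
        unfolding c assms(2) by simp_all
      then have d: "Re c * b = Im c * a" using assms(4) by auto
      show "\<exists>k. c = k *\<^sub>R Complex a b"
      proof (cases "a = 0")
        case True
        then show ?thesis using d assms(3) by (intro exI[of _ "Im c / b"]) (auto simp: complex_eq_iff)
      next
        case False
        then show ?thesis using d by (intro exI[of _ "Re c / a"]) (auto simp: complex_eq_iff field_simps)
      qed
    next
      assume "\<exists>k. c = k *\<^sub>R Complex a b"
      then obtain k where "c = k *\<^sub>R Complex a b" ..
      then have "p * Re c + q * Im c = k * (p * a + q * b)" by (simp add: algebra_simps)
      then show "p * Re c + q * Im c = 0" using assms(2) by simp
    qed
    also have "\<dots> \<longleftrightarrow> v \<in> range (\<lambda>k. k *\<^sub>R (Complex a b * z))"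
      unfolding v using assms(1) by (auto simp: mult_scaleR_left[symmetric] simp del: mult_scaleR_left)
    finally show ?thesis ..
  qed
  then show ?thesis unfolding span_singleton by blast
qed

definition disk_graph :: "(complex \<Rightarrow> real) \<Rightarrow> real \<Rightarrow> complex \<Rightarrow> complex \<times> complex" where
  "disk_graph h m z = (cis (h z), m *\<^sub>R z)"

context hyperbolic_surface
begin

lemma disk_graph_rep:
  assumes "open U" "continuous_on U h" "c \<in> cyl_atlas" "z \<in> rep_dom (disk_graph h m) (U, id) c"
  obtains k W where "open W" "z \<in> W" "W \<subseteq> U"
    "\<And>x. x \<in> W \<Longrightarrow> (h x + k, m *\<^sub>R x) \<in> fst c \<and> local_rep (disk_graph h m) (U, id) c x = (h x + k, m *\<^sub>R x)"
proof -
  obtain V where c: "c = (V \<times> unit_disk, map_prod cis id)" "open V" "inj_on cis V"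
    using cyl_chartE[OF assms(3)] by metis
  have "z \<in> U" "disk_graph h m z \<in> map_prod cis id ` (V \<times> unit_disk)"
    using assms(4) unfolding rep_dom_def c(1) by auto
  then obtain t where t: "z \<in> U" "t \<in> V" "cis (h z) = cis t" "m *\<^sub>R z \<in> unit_disk"
    unfolding disk_graph_def by auto
  define k where "k = t - h z"
  have "cis t = cis (h z) * cis k" by (simp add: k_def cis_mult)
  then have k: "cis (h x + k) = cis (h x)" for x using t(3) by (simp add: cis_mult[symmetric])
  define W where "W = U \<inter> (\<lambda>x. h x + k) -` V \<inter> (\<lambda>x. m *\<^sub>R x) -` unit_disk"
  have "open (U \<inter> (\<lambda>x. h x + k) -` V)"
    by (intro continuous_open_preimage continuous_intros assms c(2))
  moreover have "open ((\<lambda>x. m *\<^sub>R x) -` unit_disk)"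
    by (intro open_vimage open_unit_disk continuous_intros)
  ultimately have W: "open W" unfolding W_def by (rule open_Int)
  have inj: "inj_on (map_prod cis (id :: complex \<Rightarrow> complex)) (V \<times> unit_disk)"
    by (intro map_prod_inj_on c(3)) simp
  show ?thesis
  proof (rule that[OF W])
    show "z \<in> W" using t by (simp add: W_def k_def)
    fix x assume "x \<in> W"
    then have x: "(h x + k, m *\<^sub>R x) \<in> V \<times> unit_disk" by (simp add: W_def)
    have "disk_graph h m (snd (U, id) x) = map_prod cis id (h x + k, m *\<^sub>R x)" by (simp add: disk_graph_def k)
    then show "(h x + k, m *\<^sub>R x) \<in> fst c \<and> local_rep (disk_graph h m) (U, id) c x = (h x + k, m *\<^sub>R x)"
      using x inv_into_f_f[OF inj x] unfolding local_rep_def c(1) by simp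
  qed (auto simp: W_def)
qed

lemma D_rep_disk_graph:
  assumes "open U" "continuous_on U h" "c \<in> cyl_atlas" "z \<in> rep_dom (disk_graph h m) (U, id) c"
    "(h has_derivative D) (at z)"
  obtains k where "(h z + k, m *\<^sub>R z) \<in> fst c" "local_rep (disk_graph h m) (U, id) c z = (h z + k, m *\<^sub>R z)"
    "D_rep (disk_graph h m) (U, id) c z = (\<lambda>v. (D v, m *\<^sub>R v))"
proof -
  obtain k W where W: "open W" "z \<in> W"
    "\<And>x. x \<in> W \<Longrightarrow> (h x + k, m *\<^sub>R x) \<in> fst c \<and> local_rep (disk_graph h m) (U, id) c x = (h x + k, m *\<^sub>R x)"
    using disk_graph_rep[OF assms(1-4)] by metis
  have "((\<lambda>x. (h x + k, m *\<^sub>R x)) has_derivative (\<lambda>v. (D v, m *\<^sub>R v))) (at z)"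
    by (auto intro!: derivative_eq_intros assms(5))
  then have "frechet_derivative (\<lambda>x. (h x + k, m *\<^sub>R x)) (at z) = (\<lambda>v. (D v, m *\<^sub>R v))"
    by (rule frechet_derivativeI)
  moreover have "D_rep (disk_graph h m) (U, id) c z = frechet_derivative (\<lambda>x. (h x + k, m *\<^sub>R x)) (at z)"
    by (rule frechet_derivative_cong_open[OF W(1,2)]) (use W(3) in blast)
  ultimately show ?thesis by (intro that[of k]) (use W(2,3) in simp_all)
qed

lemma smooth_map_disk_graph:
  assumes "open U" "smooth_on U h" "\<And>x. x \<in> U \<Longrightarrow> m *\<^sub>R x \<in> unit_disk"
  shows "smooth_map U {(U, id)} cyl cyl_atlas (disk_graph h m)"
  unfolding smooth_map_def
proof (intro conjI ballI)
  have h: "Ck_on k U h" for k using assms(2) by (simp add: smooth_on_def)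
  have cont: "continuous_on U h" by (rule Ck_on_continuous[OF h])
  show "continuous_on U (disk_graph h m)"
    unfolding disk_graph_def[abs_def]
    by (intro continuous_intros continuous_on_compose2[OF continuous_on_cis cont]) auto
  show "disk_graph h m ` U \<subseteq> cyl" using assms(3) by (auto simp: disk_graph_def)
  fix c d assume "c \<in> {(U, id :: complex \<Rightarrow> complex)}" and d: "d \<in> cyl_atlas"
  then have c: "c = (U, id)" by simp
  show "smooth_on (rep_dom (disk_graph h m) c d) (local_rep (disk_graph h m) c d)"
    unfolding c
  proof (rule smooth_on_local)
    fix z assume z: "z \<in> rep_dom (disk_graph h m) (U, id) d"
    obtain k W where W: "open W" "z \<in> W" "W \<subseteq> U"
      "\<And>x. x \<in> W \<Longrightarrow> (h x + k, m *\<^sub>R x) \<in> fst d \<and> local_rep (disk_graph h m) (U, id) d x = (h x + k, m *\<^sub>R x)"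
      using disk_graph_rep[OF assms(1) cont d z] by metis
    have lin: "bounded_linear (\<lambda>s::real. (s, 0 :: complex))" "bounded_linear (\<lambda>x. (0 :: real, m *\<^sub>R x))"
      by (intro bounded_linear_Pair bounded_linear_ident bounded_linear_zero bounded_linear_scaleR_right)+
    have "Ck_on n W (\<lambda>x. (h x + k, 0) + (0, m *\<^sub>R x))" for n
      by (intro Ck_on_add W(1) Ck_on_bounded_linear[OF W(1) lin(1)] Ck_on_bounded_linear_apply[OF lin(2)]
          Ck_on_const Ck_on_subset[OF h W(3)])
    then have "smooth_on W (\<lambda>x. (h x + k, m *\<^sub>R x))" by (simp add: smooth_on_def)
    then show "\<exists>N g. open N \<and> z \<in> N \<and> smooth_on N g \<and> (\<forall>y\<in>N. local_rep (disk_graph h m) (U, id) d y = g y)"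
      using W by blast
  qed
qed

end

context lutz_twist
begin

text \<open>On the standard tube the group element is the identity and the two copies of
  \<open>prim_form\<close> cancel, so \<open>\<alpha>L\<close> is exactly the model form
  there.\<close>

lemma lam_tube:
  assumes "cmod w < \<delta>"
  shows "lamA w = f1 (cmod w)" "lamB w = (f2 (cmod w) / (cmod w)\<^sup>2) *\<^sub>R w"
proof -
  have w: "w \<in> unit_disk" using assms ball_\<delta> by auto
  have "deriv (\<lambda>x\<in>unit_disk. x) w = deriv (\<lambda>x. x) w" by (rule deriv_cong_unit_disk[OF _ w]) simp
  then have "etaA w = A0 w" "etaB w = B0 w"
    using eta_in[OF G_one w] assms w by simp_all
  then show "lamA w = f1 (cmod w)" "lamB w = (f2 (cmod w) / (cmod w)\<^sup>2) *\<^sub>R w"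
    by (simp_all add: lamA_def lamB_def A0_def B0_def)
qed

lemma pull1_disk_graph:
  assumes "open U" "continuous_on U h" "z \<in> U" "(h has_derivative D) (at z)" "cmod (m *\<^sub>R z) < \<delta>"
  shows "pull1 (disk_graph h m) cyl_atlas \<alpha>L (U, id) z v
    = f1 (cmod (m *\<^sub>R z)) * D v + f2 (cmod (m *\<^sub>R z)) / (cmod (m *\<^sub>R z))\<^sup>2 * cross2 (m *\<^sub>R z) (m *\<^sub>R v)"
proof -
  define d where "d = target_chart (disk_graph h m) cyl_atlas (U, id) z"
  have "disk_graph h m z \<in> (\<Union>c\<in>cyl_atlas. snd c ` fst c)"
    unfolding cyl_cover using assms(5) ball_\<delta> by (auto simp: disk_graph_def)
  then have "\<exists>d. d \<in> cyl_atlas \<and> disk_graph h m (snd (U, id) z) \<in> snd d ` fst d" by (simp add: Bex_def)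
  from target_chart_some[of cyl_atlas "disk_graph h m" "(U, id)" z, OF this] assms(3)
  have d: "d \<in> cyl_atlas" "z \<in> rep_dom (disk_graph h m) (U, id) d" unfolding d_def by simp_all
  obtain k where k: "(h z + k, m *\<^sub>R z) \<in> fst d" "local_rep (disk_graph h m) (U, id) d z = (h z + k, m *\<^sub>R z)"
    "D_rep (disk_graph h m) (U, id) d z = (\<lambda>v. (D v, m *\<^sub>R v))"
    by (rule D_rep_disk_graph[OF assms(1,2) d assms(4)]) (rule that, assumption+)
  have "pull1 (disk_graph h m) cyl_atlas \<alpha>L (U, id) z v = \<alpha>L d (h z + k, m *\<^sub>R z) (D v, m *\<^sub>R v)"
    unfolding pull1_def[of "disk_graph h m"] Let_def d_def[symmetric] k(2,3) ..
  also have "\<dots> = lamE (h z + k, m *\<^sub>R z) (D v, m *\<^sub>R v)" by (rule \<alpha>L_eq[OF d(1) k(1)])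
  finally show ?thesis
    using lam_tube[OF assms(5)] by (simp only: lamE_def fst_conv snd_conv cross2_scaleR_left)
qed

lemma overtwisted:
  obtains F where "F \<subseteq> cyl" "overtwisted_disk cyl cyl_atlas \<alpha>L F"
proof -
  obtain r0 where r0: "\<delta>/2 < r0" "r0 < \<delta> - \<epsilon>/2" "f2 r0 = 0" "\<And>r. 0 < r \<Longrightarrow> r < r0 \<Longrightarrow> f2 r < 0"
    using f2_zero by blast
  obtain x a0 a1 a2 b0 b1 b2 where x: "\<delta>/2 \<le> x" "x < r0"
    and q1: "\<And>r. r \<in> {x..r0} \<Longrightarrow> f1 r = a0 + a1 * r + a2 * r\<^sup>2"
    and q2: "\<And>r. r \<in> {x..r0} \<Longrightarrow> f2 r = b0 + b1 * r + b2 * r\<^sup>2"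
    using quadratic_left[of r0] r0 by (metis less_imp_le)
  have pos: "0 < r0" "0 < x" "r0 < \<delta>" "\<delta> < 1" using r0 x \<delta> \<epsilon> by auto
  \<comment> \<open>With x < \<rho> the open region where \<open>h\<close> is constant and the
    region where \<open>f1\<close> and \<open>f2\<close> are polynomials overlap, so together they
    cover the punctured disk.\<close>
  define \<rho> where "\<rho> = (x + r0) / 2"
  have \<rho>: "x < \<rho>" "\<rho> < r0" "0 < \<rho>" using x pos by (auto simp: \<rho>_def)
  \<comment> \<open>The radius lies between 1 and \<delta> / r0: the embedding extends beyond the
    closed disk without leaving the tube.\<close>
  define U where "U = ball (0 :: complex) ((\<delta> / r0 + 1) / 2)"
  have "1 < (\<delta> / r0 + 1) / 2" using pos by (simp add: field_simps)
  then have U: "open U" "cball 0 1 \<subseteq> U" by (auto simp: U_def)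
  have rU: "r0 * cmod z < \<delta>" if "z \<in> U" for z
  proof -
    have "r0 * cmod z < r0 * ((\<delta> / r0 + 1) / 2)" using that pos by (simp add: U_def)
    also have "\<dots> = (\<delta> + r0) / 2" using pos by (simp add: field_simps)
    finally show ?thesis using pos by simp
  qed
  \<comment> \<open>Squaring the radii makes \<open>s\<close> a polynomial in the coordinates, so
    that the composition with the flat function is smooth at the origin too.\<close>
  define s where "s z = (r0 * cmod z)\<^sup>2 - \<rho>\<^sup>2" for z
  define h where "h z = flat 0 (s z)" for z
  define p where "p z = 2 * r0\<^sup>2 * f1 (r0 * cmod z) * flat 1 (s z)" for z
  define q where "q z = f2 (r0 * cmod z) / (cmod z)\<^sup>2" for z
  let ?\<Phi> = "disk_graph h r0"
  have s_eq: "s = (\<lambda>z. r0\<^sup>2 * (z \<bullet> z) - \<rho>\<^sup>2)" by (simp add: s_def power_mult_distrib power2_norm_eq_inner fun_eq_iff)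
  have Ck_s: "Ck_on k N s" if "open N" for k N
    unfolding s_eq
    by (intro Ck_on_diff Ck_on_mult Ck_on_inner Ck_on_const that Ck_on_bounded_linear_apply bounded_linear_ident)
  have Ck_flat: "Ck_on k N (\<lambda>z. flat n (s z))" if "open N" for k n N
    by (rule Ck_on_compose[OF that open_UNIV Ck_s[OF that] Ck_on_flat]) simp
  have smooth_h: "smooth_on U h" unfolding smooth_on_def h_def[abs_def] using Ck_flat[OF U(1)] by blast
  have cont_h: "continuous_on U h" unfolding h_def[abs_def] by (rule Ck_on_continuous[OF Ck_flat[OF U(1)]])
  have der_h: "(h has_derivative (\<lambda>v. flat 1 (s z) * (2 * r0\<^sup>2 * (z \<bullet> v)))) (at z)" for z
  proof -
    have "(s has_derivative (\<lambda>v. 2 * r0\<^sup>2 * (z \<bullet> v))) (at z)"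
      unfolding s_eq by (auto intro!: derivative_eq_intros simp: inner_commute algebra_simps)
    moreover have "(flat 0 has_derivative (\<lambda>y. flat 1 (s z) * y)) (at (s z))"
      using flat_has_derivative[of 0 "s z"] by (simp add: has_field_derivative_def)
    ultimately show ?thesis unfolding h_def[abs_def] by (rule has_derivative_compose)
  qed
  have \<beta>: "pull1 ?\<Phi> cyl_atlas \<alpha>L (U, id) z = (\<lambda>v. p z * (z \<bullet> v) + q z * cross2 z v)" if "z \<in> U" for z
  proof
    fix v
    have n: "cmod (r0 *\<^sub>R z) = r0 * cmod z" using pos by simp
    have d: "cmod (r0 *\<^sub>R z) < \<delta>" unfolding n by (rule rU[OF that])
    show "pull1 ?\<Phi> cyl_atlas \<alpha>L (U, id) z v = p z * (z \<bullet> v) + q z * cross2 z v"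
      unfolding pull1_disk_graph[OF U(1) cont_h that der_h d] n using pos
      by (simp add: p_def q_def cross2_scaleR_left cross2_scaleR_right power_mult_distrib power2_eq_square)
  qed
  have flat_0: "flat 1 (s z) = 0" if "r0 * cmod z \<le> \<rho>" for z
  proof -
    have "(r0 * cmod z)\<^sup>2 \<le> \<rho>\<^sup>2" using that pos by (intro power_mono) auto
    then show ?thesis by (simp add: s_def flat_def)
  qed
  have pq: "p z \<noteq> 0 \<or> q z \<noteq> 0" if z: "z \<noteq> 0" "cmod z \<le> 1" for z
  proof (cases "cmod z = 1")
    case True
    have "0 < f1 r0" using f12_pos_right(1)[of r0] r0 by simp
    moreover have "0 < flat 1 (r0\<^sup>2 - \<rho>\<^sup>2)" using \<rho> power_strict_mono[of \<rho> r0 2] by (intro flat_1_pos) simp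
    ultimately show ?thesis using True pos by (simp add: p_def s_def)
  next
    case False
    then have "f2 (r0 * cmod z) < 0" using z pos by (intro r0(4)) auto
    then show ?thesis using z by (simp add: q_def)
  qed
  have foliation: "\<exists>N (Z :: complex \<Rightarrow> complex). open N \<and> z0 \<in> N \<and> smooth_on N Z \<and>
      (\<forall>z\<in>N \<inter> cball 0 1. Z z \<noteq> 0 \<and> {v. p z * (z \<bullet> v) + q z * cross2 z v = 0} = span {Z z})"
    if z0: "z0 \<in> cball 0 1 - {0}" for z0
  proof (cases "r0 * cmod z0 < \<rho>")
    case True
    let ?N = "{z. 0 < cmod z} \<inter> {z. r0 * cmod z < \<rho>}"
    have N: "open ?N" by (intro open_Int open_Collect_less continuous_intros)
    have "z \<noteq> 0 \<and> {v. p z * (z \<bullet> v) + q z * cross2 z v = 0} = span {z}" if "z \<in> ?N \<inter> cball 0 1" for z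
    proof -
      have z: "z \<noteq> 0" "cmod z \<le> 1" "r0 * cmod z < \<rho>" using that by auto
      then have "p z = 0" using flat_0 by (simp add: p_def)
      then show ?thesis using kernel_polar[OF z(1), of "p z" 1 "q z" 0] pq[OF z(1,2)] z(1)
        by (simp add: one_complex.code[symmetric])
    qed
    then show ?thesis
      using True z0 N
      by (intro exI[of _ ?N] exI[of _ "\<lambda>z. z"])
         (auto simp: smooth_on_def intro: Ck_on_bounded_linear_apply bounded_linear_ident)
  next
    case False
    let ?N = "{z. x < r0 * cmod z}"
    \<comment> \<open>\<open>P\<close> and \<open>Q\<close> are \<open>p\<close> and
      \<open>q\<close> multiplied by |z|^2, with \<open>f1\<close> and \<open>f2\<close> replaced by
      their polynomials. The replacement is correct for |z| <= 1 only, but makes the spanning field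
      \<open>Z\<close> smooth across the boundary circle.\<close>
    define P where "P z = 2 * r0\<^sup>2 * (a0 + a1 * (r0 * cmod z) + a2 * (r0 * cmod z)\<^sup>2) * flat 1 (s z) * (z \<bullet> z)" for z
    define Q where "Q z = b0 + b1 * (r0 * cmod z) + b2 * (r0 * cmod z)\<^sup>2" for z
    define Z where "Z z = Q z *\<^sub>R z + (- P z) *\<^sub>R (\<i> * z)" for z
    have N: "open ?N" by (intro open_Collect_less continuous_intros)
    have N0: "0 \<notin> ?N" using pos by simp
    have id: "Ck_on k ?N (\<lambda>z. z)" "Ck_on k ?N (\<lambda>z. \<i> * z)" for k
      by (intro Ck_on_bounded_linear_apply bounded_linear_ident bounded_linear_mult_right)+
    have "smooth_on ?N Z"
      unfolding smooth_on_def Z_def[abs_def] P_def Q_def power2_eq_square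
      by (intro allI Ck_on_add Ck_on_scaleR Ck_on_minus Ck_on_mult Ck_on_inner Ck_on_const Ck_flat
          Ck_on_norm[OF N N0] N id)
    moreover have "Z z \<noteq> 0 \<and> {v. p z * (z \<bullet> v) + q z * cross2 z v = 0} = span {Z z}" if "z \<in> ?N \<inter> cball 0 1" for z
    proof -
      have z: "x < r0 * cmod z" "cmod z \<le> 1" "z \<noteq> 0" using that N0 by auto
      have "r0 * cmod z \<le> r0" using z(2) pos by simp
      then have r: "r0 * cmod z \<in> {x..r0}" using z(1) by simp
      have zz: "z \<bullet> z = (cmod z)\<^sup>2" by (simp add: power2_norm_eq_inner)
      have PQ: "P z = p z * (cmod z)\<^sup>2" "Q z = q z * (cmod z)\<^sup>2"
        using z(3) by (simp_all add: P_def Q_def p_def q_def q1[OF r] q2[OF r] zz)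
      have Z: "Z z = Complex (Q z) (- P z) * z" by (simp add: Z_def complex_eq_iff)
      have ne: "Q z \<noteq> 0 \<or> - P z \<noteq> 0" using pq[OF z(3,2)] z(3) by (auto simp: PQ)
      then have "Z z \<noteq> 0" using z(3) by (auto simp: Z Complex_eq_0)
      then show ?thesis unfolding Z
        by (intro conjI kernel_polar z(3) ne pq[OF z(3,2)]) (simp_all add: PQ)
    qed
    ultimately show ?thesis using False \<rho> N by (intro exI[of _ ?N] exI[of _ Z]) auto
  qed
  have elliptic: "\<exists>L. ((\<lambda>z. Complex (\<beta> z \<i>) (- \<beta> z 1)) has_derivative L) (at 0) \<and> cross2 (L 1) (L \<i>) > 0"
    if \<beta>_eq: "\<And>z. z \<in> U \<Longrightarrow> \<beta> z = (\<lambda>v. p z * (z \<bullet> v) + q z * cross2 z v)" for \<beta>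
  proof -
    \<comment> \<open>Close to the origin the graph is flat and the form is the negative of
      \<open>prim_form\<close>, so the directing field is a rescaled negative \<open>radial\<close>.
      Its linearisation is -r0^2 times the identity, with determinant r0^4: the singularity is a
      node.\<close>
    let ?B = "{z. r0 * cmod z < min (\<epsilon>/2) \<rho>} \<inter> U"
    have B: "open ?B" by (intro open_Int open_Collect_less continuous_intros U)
    have B0: "0 \<in> ?B" using U \<rho> \<epsilon> by auto
    have Y: "- r0 *\<^sub>R radial (r0 *\<^sub>R z) = Complex (\<beta> z \<i>) (- \<beta> z 1)" if "z \<in> ?B" for z
    proof -
      have z: "r0 * cmod z \<le> \<epsilon>/2" "r0 * cmod z \<le> \<rho>" "z \<in> U" using that by auto
      have "p z = 0" using flat_0[OF z(2)] by (simp add: p_def)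
      then have "Complex (\<beta> z \<i>) (- \<beta> z 1) = q z *\<^sub>R z"
        by (simp add: \<beta>_eq[OF z(3)] cross2_def complex_eq_iff)
      also have "\<dots> = - r0 *\<^sub>R radial (r0 *\<^sub>R z)"
      proof (cases "z = 0")
        case False
        then have "q z = - (r0\<^sup>2 / (1 - (r0 * cmod z)\<^sup>2))"
          using f_inner(2)[of "r0 * cmod z"] z pos by (simp add: q_def power_mult_distrib)
        then show ?thesis using pos by (simp add: radial_def power2_eq_square)
      qed (simp add: radial_def)
      finally show ?thesis ..
    qed
    have "(radial has_derivative (\<lambda>v. v)) (at (r0 *\<^sub>R 0))"
      using radial_has_derivative[of 0] by (simp add: unit_disk_def)
    from has_derivative_compose[OF has_derivative_scaleR_right[OF has_derivative_ident] this]
    have "((\<lambda>z. - r0 *\<^sub>R radial (r0 *\<^sub>R z)) has_derivative (\<lambda>v. - r0 *\<^sub>R (r0 *\<^sub>R v))) (at 0)"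
      by (rule has_derivative_scaleR_right)
    then have "((\<lambda>z. Complex (\<beta> z \<i>) (- \<beta> z 1)) has_derivative (\<lambda>v. - r0 *\<^sub>R (r0 *\<^sub>R v))) (at 0)"
      by (rule has_derivative_transform_within_open[OF _ B B0 Y])
    moreover have "cross2 (- r0 *\<^sub>R (r0 *\<^sub>R 1)) (- r0 *\<^sub>R (r0 *\<^sub>R \<i>)) > 0"
      using pos by (simp add: cross2_def)
    ultimately show ?thesis by blast
  qed
  have Ud: "r0 *\<^sub>R z \<in> unit_disk" if "z \<in> U" for z using rU[OF that] pos by (simp add: unit_disk_def)
  have inj: "inj (D_rep ?\<Phi> (U, id) d z)" if d: "d \<in> cyl_atlas" "z \<in> rep_dom ?\<Phi> (U, id) d" for d z
  proof -
    obtain k where "D_rep ?\<Phi> (U, id) d z = (\<lambda>v. (flat 1 (s z) * (2 * r0\<^sup>2 * (z \<bullet> v)), r0 *\<^sub>R v))"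
      by (rule D_rep_disk_graph[OF U(1) cont_h d der_h]) (rule that, assumption+)
    then show ?thesis using pos by (simp add: inj_def)
  qed
  have "overtwisted_disk cyl cyl_atlas \<alpha>L (?\<Phi> ` cball 0 1)"
    unfolding overtwisted_disk_def Let_def
  proof (rule conjI[OF smooth_manifold_cyl], rule conjI[OF contact_form_\<alpha>L], rule exI[of _ U], rule exI[of _ ?\<Phi>],
      rule exI[of _ "0 :: complex"], intro conjI ballI allI U smooth_map_disk_graph smooth_h refl)
    show "inj_on ?\<Phi> U" using pos by (auto simp: inj_on_def disk_graph_def)
    show "pull1 ?\<Phi> cyl_atlas \<alpha>L (U, id) z (\<i> * z) = 0" if "z \<in> sphere 0 1" for z
    proof -
      have z: "z \<in> U" "cmod z = 1" using that U(2) by auto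
      then have "q z = 0" by (simp add: q_def r0(3))
      then show ?thesis by (simp add: \<beta>[OF z(1)] inner_complex_def)
    qed
    show "pull1 ?\<Phi> cyl_atlas \<alpha>L (U, id) 0 v = 0" for v
      using U(2) by (subst \<beta>) auto
    show "\<exists>N (Z :: complex \<Rightarrow> complex). open N \<and> z0 \<in> N \<and> smooth_on N Z \<and>
        (\<forall>z\<in>N \<inter> cball 0 1. Z z \<noteq> 0 \<and> {v. pull1 ?\<Phi> cyl_atlas \<alpha>L (U, id) z v = 0} = span {Z z})"
      if z0: "z0 \<in> cball 0 1 - {0}" for z0
    proof -
      obtain N and Z :: "complex \<Rightarrow> complex" where N: "open N" "z0 \<in> N" "smooth_on N Z"
        and Z: "\<And>z. z \<in> N \<inter> cball 0 1 \<Longrightarrow> Z z \<noteq> 0 \<and> {v. p z * (z \<bullet> v) + q z * cross2 z v = 0} = span {Z z}"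
        using foliation[OF z0] by blast
      have "{v. pull1 ?\<Phi> cyl_atlas \<alpha>L (U, id) z v = 0} = {v. p z * (z \<bullet> v) + q z * cross2 z v = 0}"
        if "z \<in> N \<inter> cball 0 1" for z
        using that U(2) by (subst \<beta>) auto
      then show ?thesis using N Z by (intro exI[of _ N] exI[of _ Z]) simp
    qed
    show "\<exists>L. ((\<lambda>z. Complex (pull1 ?\<Phi> cyl_atlas \<alpha>L (U, id) z \<i>) (- pull1 ?\<Phi> cyl_atlas \<alpha>L (U, id) z 1))
        has_derivative L) (at 0) \<and> cross2 (L 1) (L \<i>) > 0"
      by (rule elliptic[OF \<beta>])
  qed (use inj Ud in auto)
  moreover have "?\<Phi> ` cball 0 1 \<subseteq> cyl" using Ud U(2) by (auto simp: disk_graph_def)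
  ultimately show ?thesis using that by blast
qed

end

theorem proposition6p4:
  fixes \<Sigma> :: "'a::topological_space set" and p\<Sigma> :: "complex \<Rightarrow> 'a" and genus :: nat
    and G :: "(complex \<Rightarrow> complex) set"
    and \<omega>\<Sigma> :: "(complex, 'a) field2"
    and \<delta> \<epsilon> C :: real and f1 f2 f1' f2' :: "real \<Rightarrow> real"
    and M :: "(complex \<times> 'a) set" and p :: "complex \<times> complex \<Rightarrow> complex \<times> 'a"
    and \<omega>M \<omega>L :: "(R3, complex \<times> 'a) field2"
    and \<eta> \<alpha>L :: "(R3, complex \<times> complex) field1" and \<eta>M :: "(R3, complex \<times> 'a) field1"
  assumes surface: "closed_surface_of_genus genus \<Sigma>" "genus \<ge> 2"
    and group: "discrete_isometry_group G"
    and cover: "orbit_covering G p\<Sigma> \<Sigma>"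
    and area: "form2 (surface_atlas p\<Sigma>) \<omega>\<Sigma>"
      "field2_eq disk_atlas (pull2 p\<Sigma> (surface_atlas p\<Sigma>) \<omega>\<Sigma>) hyp_area"
    and M_def: "M = sphere 0 1 \<times> \<Sigma>"
    and p_def: "p = map_prod id p\<Sigma>"
    and \<omega>M_def: "\<omega>M = pull2 snd (surface_atlas p\<Sigma>) \<omega>\<Sigma>"
    and delta: "0 < \<delta>" "\<delta> \<le> 1/3"
      "\<forall>g\<in>G - {\<one>\<^bsub>BijGroup unit_disk\<^esub>}. g ` ball 0 \<delta> \<inter> ball 0 \<delta> = {}"
    and epsilon: "0 < \<epsilon>" "\<epsilon> \<le> \<delta>/10"
    and C_def: "C = max (C0_norm cyl_atlas cyl_metric prim_form) 1"
    and profile: "twist_profile \<delta> \<epsilon> C f1 f2 f1' f2'"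
    and \<eta>_def: "\<eta> = eta G \<delta> f1 f2"
    and \<eta>M_def: "\<eta>M = descend1 p cyl_atlas (M_atlas p\<Sigma>) \<eta>"
    and \<omega>L_def: "\<omega>L = (\<lambda>c u v w. \<omega>M c u v w + ext_d \<eta>M c u v w)"
    and \<alpha>L_def: "\<alpha>L = (\<lambda>c u v. prim_form c u v + \<eta> c u v)"
  shows "virtual_contact_structure cyl cyl_atlas p M (M_atlas p\<Sigma>) \<omega>L \<alpha>L
         \<and> (\<exists>F. F \<subseteq> cyl \<and> overtwisted_disk cyl cyl_atlas \<alpha>L F)"
proof -
  interpret lutz_twist G p\<Sigma> \<Sigma> \<omega>\<Sigma> \<delta> \<epsilon> C f1 f2 f1' f2'
    using assms by unfold_locales (auto simp: closed_surface_of_genus_def)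
  obtain F where "F \<subseteq> cyl" "overtwisted_disk cyl cyl_atlas \<alpha>L F"
    unfolding \<alpha>L_def \<eta>_def by (rule overtwisted)
  moreover have "virtual_contact_structure cyl cyl_atlas p M (M_atlas p\<Sigma>) \<omega>L \<alpha>L"
    unfolding M_def p_def \<omega>M_def \<eta>M_def \<eta>_def \<omega>L_def \<alpha>L_def by (rule virtual_contact)
  ultimately show ?thesis by blast
qed

end
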